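(* Let $K\ge 2$, $A>0$, $p_1,\ldots,p_K>0$ and real numbers $a=z_1<z_2<\cdots<z_K=b$, and let $w(x)=A\prod_{i=1}^K|x-z_i|^{p_i}$ on $[a,b]$; put $Z:=\{z_1,\ldots,z_K\}$ and $p:=\sum_{j=1}^K p_j$. Then there exist an integer $L$ with $1\le L\le K-1$, a monic real polynomial $P$ of degree $K-L-1$, and $L$ intervals $[a_l,b_l]\subset[a,b]\setminus Z$ with $a<a_1<b_1<a_2<b_2<\cdots<a_L<b_L<b$, such that $$S_w=\bigcup_{l=1}^L[a_l,b_l],$$ and, with $R(x):=\prod_{l=1}^L(x-a_l)(x-b_l)$, the equilibrium measure is $$d\mu_w(x)=(-1)^{L+l+1}\,\frac{(1+p)\sqrt{|R(x)|}\,P(x)}{\pi\prod_{j=1}^K(x-z_j)}\,dx,\qquad x\in[a_l,b_l],\ l=1,\ldots,L.$$ Moreover, setting $b_0:=-\infty$ and $a_{L+1}:=+\infty$, $$P(z_j)=(-1)^{L+l}\,\frac{p_j\prod_{m\ne j}(z_j-z_m)}{(1+p)\sqrt{|R(z_j)|}}\quad\text{whenever } z_j\in[b_l,a_{l+1}],\ j=1,\ldots,K,$$ and $$\int_{b_l}^{a_{l+1}}\frac{\sqrt{|R(x)|}\,P(x)}{\prod_{j=1}^K(x-z_j)}\,dx=0,\qquad l=1,\ldots,L-1,$$ where these integrals are Cauchy principal values.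
   Context: For a compact interval $[a,b]\subset\mathbb R$ and a nonnegative weight $w$ on $[a,b]$ (not identically zero), let $\mathcal M([a,b])$ be the set of positive unit Borel measures supported on $[a,b]$, define the weighted energy $I_w(\mu):=\iint \log\frac{1}{|z-t|\,w(z)\,w(t)}\,d\mu(z)\,d\mu(t)$ and $V_w:=\inf_{\mu\in\mathcal M([a,b])} I_w(\mu)$. For the weights considered here $V_w$ is finite and there is a unique $\mu_w\in\mathcal M([a,b])$ with $I_w(\mu_w)=V_w$ (the weighted equilibrium measure); $S_w:=\operatorname{supp}\mu_w$. *)

theory Defs
  imports "HOL-Probability.Probability" "HOL-Computational_Algebra.Polynomial"
begin

definition log_kernel :: "(real \<Rightarrow> real) \<Rightarrow> real \<Rightarrow> real \<Rightarrow> ereal" where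
  "log_kernel w z t =
     (if \<bar>z - t\<bar> * w z * w t = 0 then \<infinity> else ereal (- ln (\<bar>z - t\<bar> * w z * w t)))"

definition weighted_energy :: "(real \<Rightarrow> real) \<Rightarrow> real measure \<Rightarrow> ereal" where
  "weighted_energy w M =
     enn2ereal (\<integral>\<^sup>+ u. e2ennreal (max 0 (log_kernel w (fst u) (snd u))) \<partial>(M \<Otimes>\<^sub>M M))
   - enn2ereal (\<integral>\<^sup>+ u. e2ennreal (max 0 (- log_kernel w (fst u) (snd u))) \<partial>(M \<Otimes>\<^sub>M M))"

definition unit_measures :: "real \<Rightarrow> real \<Rightarrow> real measure set" where
  "unit_measures a b =
     {M. prob_space M \<and> sets M = sets borel \<and> emeasure M (UNIV - {a..b}) = 0}"

definition min_energy :: "(real \<Rightarrow> real) \<Rightarrow> real \<Rightarrow> real \<Rightarrow> ereal" where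
  "min_energy w a b = Inf (weighted_energy w ` unit_measures a b)"

definition is_equilibrium_measure :: "(real \<Rightarrow> real) \<Rightarrow> real \<Rightarrow> real \<Rightarrow> real measure \<Rightarrow> bool" where
  "is_equilibrium_measure w a b M \<longleftrightarrow>
     M \<in> unit_measures a b \<and> weighted_energy w M = min_energy w a b"

definition measure_support :: "real measure \<Rightarrow> real set" where
  "measure_support M = {x. \<forall>e>0. emeasure M (ball x e) > 0}"

definition pv_integral_has_value :: "(real \<Rightarrow> real) \<Rightarrow> real \<Rightarrow> real \<Rightarrow> real set \<Rightarrow> real \<Rightarrow> bool" where
  "pv_integral_has_value f c d Zs v \<longleftrightarrow>
     ((\<lambda>\<epsilon>. integral ({c..d} - (\<Union>\<zeta>\<in>Zs. {\<zeta> - \<epsilon><..<\<zeta> + \<epsilon>})) f) \<longlongrightarrow> v) (at_right 0)"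

end

theory Submission
  imports Defs
begin

text \<open>
  Up to an additive constant the weighted energy of \<open>N\<close> is
  \<open>\<integral>\<integral> ln (D / \<bar>x - t\<bar>) dN dN + 2 \<Sum>\<^sub>j p\<^sub>j \<integral> ln (D / \<bar>x - z\<^sub>j\<bar>) dN\<close> with \<open>D = z\<^sub>K - z\<^sub>1\<close>,
  a sum of nonnegative terms, so a minimizer \<open>M\<close> exists by weak compactness and Fatou's lemma.
  Moving \<open>M\<close> along \<open>x \<mapsto> x + s \<phi>(x)\<close>, where \<open>\<phi>\<close> vanishes at all \<open>z\<^sub>j\<close>, leaves \<open>[z\<^sub>1, z\<^sub>K]\<close> invariant;
  the first variation for \<open>\<phi>(x) = \<Pi>(x) / (\<zeta> - x)\<close>, \<open>\<Pi>(x) = \<Prod>\<^sub>j (x - z\<^sub>j)\<close>, says that the Stieltjes transform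
  \<open>G\<close> of \<open>M\<close> satisfies \<open>(\<Pi> G + N)\<^sup>2 = T\<close> with \<open>N = \<Pi> \<Sum>\<^sub>j p\<^sub>j / (\<zeta> - z\<^sub>j)\<close> and a real polynomial \<open>T\<close> of degree
  \<open>2K - 2\<close> with leading coefficient \<open>(1 + p)\<^sup>2\<close> and \<open>T(z\<^sub>j) = N(z\<^sub>j)\<^sup>2 > 0\<close>.
  Stieltjes inversion then gives \<open>dM = sqrt (max 0 (-T)) / (\<pi> \<bar>\<Pi>\<bar>) dx\<close>.
  As \<open>N(z\<^sub>j)\<close> alternates in sign, \<open>T\<close> has a root, hence two, in each \<open>(z\<^sub>i, z\<^bsub>i+1\<^esub>)\<close>, and so exactly two by the
  degree: distinct roots bound a component of the support, a double root is a root of \<open>P\<close>.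
  The principal value integrals over the gaps are differences of the effective potential, which by a
  second variation takes the same value on all components. Uniqueness of \<open>M\<close> follows from the positive
  definiteness of the logarithmic kernel as a mixture of Gaussian kernels.
\<close>

text \<open>A priori the minimizer is only a measure of finite energy, and comparing it with
  mixtures \<open>(1 - s) M + s N\<close> would give mere inequalities for its potential. A
  displacement that fixes every \<open>z j\<close> instead multiplies all distances in the energy by
  factors close to 1, so each logarithm changes by a bounded amount and finite energy is all that is
  required. For the chosen \<phi> the divided difference is
  \<open>Pi(\<zeta>) / ((\<zeta> - x) * (\<zeta> - t))\<close> minus a polynomial, hence its
  integral turns the first variation into \<open>Pi G^2 + 2 N G = S\<close>, with a polynomial
  \<open>S\<close> in \<zeta> built from finitely many moments of \<open>M\<close>; multiplying by
  \<open>Pi\<close> and completing the square gives \<open>T = N^2 + Pi S\<close>. Everything else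
  is read off \<open>T\<close>. As \<open>T > 0\<close> at the charges, the density is continuous,
  bounded and zero near them, and only this boundedness makes the later comparison with mixtures
  harmless. Since \<open>T\<close> knows \<open>M\<close> only through moments, uniqueness reduces
  to equality of moments.\<close>

section \<open>The energy as a sum of nonnegative terms\<close>

text \<open>Scaling by the diameter \<open>D\<close> makes the kernel nonnegative for two points of
  the interval. The value at 0 is set by hand because \<open>ln (D / 0)\<close> is 0 in HOL.\<close>

definition log_pot :: "real \<Rightarrow> real \<Rightarrow> ennreal" where
  "log_pot D u = (if u = 0 then \<infinity> else ennreal (ln (D / \<bar>u\<bar>)))"

lemma measurable_log_pot [measurable]: "log_pot D \<in> borel_measurable borel"
  unfolding log_pot_def [abs_def] by measurable

lemma (in prob_space) nn_integral_pair_sum: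
  fixes f g :: "'a \<Rightarrow> ennreal"
  assumes [measurable]: "f \<in> borel_measurable M" "g \<in> borel_measurable M"
  shows "(\<integral>\<^sup>+u. f (fst u) + g (snd u) \<partial>(M \<Otimes>\<^sub>M M)) = (\<integral>\<^sup>+x. f x \<partial>M) + (\<integral>\<^sup>+x. g x \<partial>M)"
proof -
  have "(\<integral>\<^sup>+u. f (fst u) + g (snd u) \<partial>(M \<Otimes>\<^sub>M M)) = (\<integral>\<^sup>+x. \<integral>\<^sup>+y. f x + g y \<partial>M \<partial>M)"
    by (subst nn_integral_fst[symmetric]) simp_all
  also have "\<dots> = (\<integral>\<^sup>+x. f x \<partial>M) + (\<integral>\<^sup>+x. g x \<partial>M)"
    by (simp add: nn_integral_add emeasure_space_1)
  finally show ?thesis .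
qed

locale point_charges =
  fixes K :: nat and p z :: "nat \<Rightarrow> real"
  assumes K: "K \<ge> 2"
    and ppos: "\<And>i. i \<in> {1..K} \<Longrightarrow> p i > 0"
    and zinc: "\<And>i. i \<in> {1..<K} \<Longrightarrow> z i < z (Suc i)"
begin

lemma z_less: "1 \<le> i \<Longrightarrow> i < j \<Longrightarrow> j \<le> K \<Longrightarrow> z i < z j"
proof (induction j)
  case (Suc j)
  show ?case
  proof (cases "i = j")
    case True then show ?thesis using Suc.prems zinc[of j] by auto
  next
    case False
    then have "z i < z j" using Suc by auto
    also have "z j < z (Suc j)" using Suc.prems False by (intro zinc) auto
    finally show ?thesis .
  qed
qed simp

lemma z_mono: "1 \<le> i \<Longrightarrow> i \<le> j \<Longrightarrow> j \<le> K \<Longrightarrow> z i \<le> z j"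
  using z_less[of i j] by (cases "i = j") auto

lemma z_inj: "inj_on z {1..K}"
  by (intro inj_onI) (metis atLeastAtMost_iff linorder_neqE_nat order_less_irrefl z_less)

lemma z_in: "i \<in> {1..K} \<Longrightarrow> z i \<in> {z 1..z K}"
  using z_mono[of 1 i] z_mono[of i K] by auto

definition D :: real where "D = z K - z 1"

lemma D_pos: "D > 0"
  using z_less[of 1 K] K by (simp add: D_def)

definition ext_pot :: "real \<Rightarrow> ennreal" where
  "ext_pot x = (\<Sum>j=1..K. ennreal (p j) * log_pot D (x - z j))"

lemma measurable_ext_pot [measurable]: "ext_pot \<in> borel_measurable borel"
  unfolding ext_pot_def [abs_def] by measurable

definition energy :: "real measure \<Rightarrow> ennreal" where
  "energy N = (\<integral>\<^sup>+u. log_pot D (fst u - snd u) \<partial>(N \<Otimes>\<^sub>M N)) + 2 * (\<integral>\<^sup>+x. ext_pot x \<partial>N)"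

definition ptot :: real where "ptot = (\<Sum>j=1..K. p j)"

definition weight :: "real \<Rightarrow> real \<Rightarrow> real" where
  "weight A x = A * (\<Prod>i=1..K. \<bar>x - z i\<bar> powr p i)"

text \<open>The additive constant between the two energies: the \<open>1 + 2 * ptot\<close>
  logarithms are each normalized by \<open>ln D\<close>, and the factor \<open>A\<close> enters once
  for each of the two points.\<close>

definition energy_shift :: "real \<Rightarrow> real" where
  "energy_shift A = ln D + 2 * (ln A + ptot * ln D)"

lemma ln_weight:
  assumes "A > 0" "\<And>j. j \<in> {1..K} \<Longrightarrow> x \<noteq> z j"
  shows "weight A x > 0" "ln (weight A x) = ln A + (\<Sum>j=1..K. p j * ln \<bar>x - z j\<bar>)"
proof -
  have pos: "(\<Prod>i=1..K. \<bar>x - z i\<bar> powr p i) > 0"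
    using assms by (intro prod_pos) auto
  then show "weight A x > 0" using assms by (simp add: weight_def)
  have "ln (\<Prod>i=1..K. \<bar>x - z i\<bar> powr p i) = (\<Sum>j=1..K. ln (\<bar>x - z j\<bar> powr p j))"
    using assms(2) by (subst ln_prod) auto
  also have "\<dots> = (\<Sum>j=1..K. p j * ln \<bar>x - z j\<bar>)"
    by (simp add: ln_powr)
  finally show "ln (weight A x) = ln A + (\<Sum>j=1..K. p j * ln \<bar>x - z j\<bar>)"
    unfolding weight_def using ln_mult_pos[OF assms(1) pos] by simp
qed

lemma ext_pot_finite:
  assumes "x \<in> {z 1..z K}" "\<And>j. j \<in> {1..K} \<Longrightarrow> x \<noteq> z j"
  shows "ext_pot x = ennreal (\<Sum>j=1..K. p j * ln (D / \<bar>x - z j\<bar>))"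
    "\<And>j. j \<in> {1..K} \<Longrightarrow> 0 \<le> p j * ln (D / \<bar>x - z j\<bar>)"
proof -
  show *: "0 \<le> p j * ln (D / \<bar>x - z j\<bar>)" if "j \<in> {1..K}" for j
  proof -
    have "\<bar>x - z j\<bar> \<le> D" using z_in[OF that] assms(1) by (auto simp: D_def)
    then show ?thesis using assms(2)[OF that] ppos[OF that] by simp
  qed
  have "ext_pot x = (\<Sum>j=1..K. ennreal (p j * ln (D / \<bar>x - z j\<bar>)))"
    unfolding ext_pot_def using assms(2) ppos
    by (intro sum.cong) (auto simp: log_pot_def ennreal_mult'' ennreal_mult' less_imp_le)
  also have "\<dots> = ennreal (\<Sum>j=1..K. p j * ln (D / \<bar>x - z j\<bar>))"
    using * by (intro sum_ennreal) auto
  finally show "ext_pot x = ennreal (\<Sum>j=1..K. p j * ln (D / \<bar>x - z j\<bar>))" .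
qed

lemma ext_pot_infinite: "j \<in> {1..K} \<Longrightarrow> ext_pot (z j) = \<infinity>"
proof -
  assume j: "j \<in> {1..K}"
  have "ennreal (p j) * log_pot D (z j - z j) = \<infinity>"
    using ppos[OF j] by (simp add: log_pot_def ennreal_mult_top)
  moreover have "ennreal (p j) * log_pot D (z j - z j) \<le> ext_pot (z j)"
    unfolding ext_pot_def using j by (intro member_le_sum) auto
  ultimately show ?thesis by (simp add: top_unique)
qed

text \<open>The identity "kernel = nonnegative terms - constant", with all negative parts moved to
  the other side so that it survives in \<open>ennreal\<close> and covers coinciding points and
  zeros of the weight, where both sides are infinite. The bound on the negative part makes its
  integral finite, which excludes a difference of two infinities in
  \<open>weighted_energy\<close>.\<close>

lemma log_kernel_shift:
  assumes A: "A > 0" and x: "x \<in> {z 1..z K}" and t: "t \<in> {z 1..z K}"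
  defines "k \<equiv> log_kernel (weight A) x t" and "c \<equiv> energy_shift A"
  shows "e2ennreal (max 0 k) + ennreal (max 0 c) =
      log_pot D (x - t) + (ext_pot x + ext_pot t) + e2ennreal (max 0 (- k)) + ennreal (max 0 (- c))"
    "e2ennreal (max 0 (- k)) \<le> ennreal \<bar>c\<bar>"
proof -
  have "(e2ennreal (max 0 k) + ennreal (max 0 c) =
      log_pot D (x - t) + (ext_pot x + ext_pot t) + e2ennreal (max 0 (- k)) + ennreal (max 0 (- c)))
    \<and> e2ennreal (max 0 (- k)) \<le> ennreal \<bar>c\<bar>"
  proof (cases "x = t \<or> (\<exists>j\<in>{1..K}. x = z j) \<or> (\<exists>j\<in>{1..K}. t = z j)")
    case True
    have "\<And>j. j \<in> {1..K} \<Longrightarrow> weight A (z j) = 0"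
      by (auto simp: weight_def)
    then have k: "k = \<infinity>" using True by (auto simp: k_def log_kernel_def)
    have "log_pot D (x - t) + (ext_pot x + ext_pot t) = \<infinity>"
      using True ext_pot_infinite by (auto simp: log_pot_def)
    then have "log_pot D (x - t) + (ext_pot x + ext_pot t) + r = \<infinity>" for r by simp
    moreover have "max 0 k = \<infinity>" "max 0 (- k) = 0" using k by (auto simp: max_def)
    ultimately show ?thesis by (simp add: e2ennreal_neg del: ennreal_add_eq_top)
  next
    case False
    define L where "L = ln (D / \<bar>x - t\<bar>)"
    define S where "S y = (\<Sum>j=1..K. p j * ln (D / \<bar>y - z j\<bar>))" for y
    have S: "ext_pot x = ennreal (S x)" "ext_pot t = ennreal (S t)" "0 \<le> S x" "0 \<le> S t"
      unfolding S_def using ext_pot_finite[of x] ext_pot_finite[of t] x t False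
      by (auto intro!: sum_nonneg)
    have L: "L \<ge> 0" using x t False by (auto simp: L_def D_def)
    have Sx: "S y = ptot * ln D - (ln (weight A y) - ln A)"
      if "\<forall>j\<in>{1..K}. y \<noteq> z j" for y
    proof -
      have "S y = (\<Sum>j=1..K. p j * ln D - p j * ln \<bar>y - z j\<bar>)"
        unfolding S_def using that D_pos by (intro sum.cong) (auto simp: ln_div algebra_simps)
      also have "\<dots> = ptot * ln D - (ln (weight A y) - ln A)"
        using ln_weight[OF A, of y] that by (simp add: sum_subtractf ptot_def sum_distrib_right)
      finally show ?thesis .
    qed
    have w: "weight A x > 0" "weight A t > 0" using ln_weight[OF A] False by auto
    have "k = ereal (- ln (\<bar>x - t\<bar> * weight A x * weight A t))"
      using w False by (auto simp: k_def log_kernel_def)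
    also have "- ln (\<bar>x - t\<bar> * weight A x * weight A t) = - ln \<bar>x - t\<bar> - ln (weight A x) - ln (weight A t)"
      using w False by (simp add: ln_mult)
    also have "\<dots> = L + S x + S t - c"
      using Sx[of x] Sx[of t] False D_pos
      by (simp add: c_def energy_shift_def L_def ln_div algebra_simps)
    finally have k: "k = ereal (L + S x + S t - c)" .
    have lp: "log_pot D (x - t) = ennreal L" using False by (simp add: log_pot_def L_def)
    define r where "r = L + S x + S t - c"
    have "max 0 k = ereal (max 0 r)" "max 0 (- k) = ereal (max 0 (- r))"
      by (auto simp: k r_def max_def)
    then have e: "e2ennreal (max 0 k) = ennreal (max 0 r)"
      "e2ennreal (max 0 (- k)) = ennreal (max 0 (- r))" by (simp_all only: e2ennreal_ereal)
    have "ennreal (max 0 r + max 0 c) = ennreal (L + (S x + S t) + max 0 (- r) + max 0 (- c))"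
      by (rule arg_cong[of _ _ ennreal]) (simp add: r_def max_def)
    moreover have "ennreal (max 0 (- r)) \<le> ennreal \<bar>c\<bar>"
      using S(3,4) L by (intro ennreal_leI) (auto simp: r_def)
    ultimately show ?thesis
      unfolding e lp S(1,2) using S(3,4) L by simp
  qed
  then show "e2ennreal (max 0 k) + ennreal (max 0 c) =
      log_pot D (x - t) + (ext_pot x + ext_pot t) + e2ennreal (max 0 (- k)) + ennreal (max 0 (- c))"
    "e2ennreal (max 0 (- k)) \<le> ennreal \<bar>c\<bar>" by auto
qed

abbreviation "unit \<equiv> unit_measures (z 1) (z K)"

lemma unitD:
  assumes "N \<in> unit"
  shows "prob_space N" "sets N = sets borel" "AE x in N. x \<in> {z 1..z K}"
proof -
  show "prob_space N" and sets: "sets N = sets borel"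
    using assms by (auto simp: unit_measures_def)
  have "UNIV - {z 1..z K} \<in> null_sets N"
    using assms by (auto simp: unit_measures_def null_sets_def)
  then show "AE x in N. x \<in> {z 1..z K}" by (rule AE_I') auto
qed

lemma AE_unit_pair:
  assumes "M \<in> unit" "N \<in> unit"
  shows "AE u in M \<Otimes>\<^sub>M N. fst u \<in> {z 1..z K} \<and> snd u \<in> {z 1..z K}"
proof -
  interpret M: prob_space M by (rule unitD[OF assms(1)])
  interpret N: prob_space N by (rule unitD[OF assms(2)])
  interpret P: pair_prob_space M N by unfold_locales
  have sN [measurable_cong]: "sets M = sets borel" "sets N = sets borel" using unitD(2) assms by auto
  have "AE x in M. AE y in N. x \<in> {z 1..z K} \<and> y \<in> {z 1..z K}"
    using unitD(3)[OF assms(1)] by eventually_elim (use unitD(3)[OF assms(2)] in \<open>auto elim: eventually_mono\<close>)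
  then show ?thesis by (subst P.AE_pair_iff[symmetric]) auto
qed

lemma measurable_weight [measurable]: "weight A \<in> borel_measurable borel"
  unfolding weight_def [abs_def] by measurable

lemma weighted_energy_eq:
  assumes A: "A > 0" and N: "N \<in> unit"
  shows "weighted_energy (weight A) N = enn2ereal (energy N) - ereal (energy_shift A)"
proof -
  interpret prob_space N by (rule unitD[OF N])
  have sN [measurable_cong]: "sets N = sets borel" by (rule unitD[OF N])
  define c where "c = energy_shift A"
  define k where "k u = log_kernel (weight A) (fst u) (snd u)" for u
  have [measurable]: "k \<in> borel_measurable (N \<Otimes>\<^sub>M N)"
    unfolding k_def[abs_def] log_kernel_def by measurable
  define Ip where "Ip = (\<integral>\<^sup>+u. e2ennreal (max 0 (k u)) \<partial>(N \<Otimes>\<^sub>M N))"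
  define In where "In = (\<integral>\<^sup>+u. e2ennreal (max 0 (- k u)) \<partial>(N \<Otimes>\<^sub>M N))"
  interpret P: pair_prob_space N N by unfold_locales
  have AE: "AE u in N \<Otimes>\<^sub>M N. fst u \<in> {z 1..z K} \<and> snd u \<in> {z 1..z K}"
    by (rule AE_unit_pair[OF N N])
  have "Ip + ennreal (max 0 c) = (\<integral>\<^sup>+u. e2ennreal (max 0 (k u)) + ennreal (max 0 c) \<partial>(N \<Otimes>\<^sub>M N))"
    unfolding Ip_def by (simp add: nn_integral_add P.emeasure_space_1)
  also have "\<dots> = (\<integral>\<^sup>+u. (log_pot D (fst u - snd u) + (ext_pot (fst u) + ext_pot (snd u))) +
      e2ennreal (max 0 (- k u)) + ennreal (max 0 (- c)) \<partial>(N \<Otimes>\<^sub>M N))"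
    using AE by (intro nn_integral_cong_AE, eventually_elim)
      (use log_kernel_shift(1)[OF A] in \<open>auto simp: k_def c_def\<close>)
  also have "\<dots> = energy N + In + ennreal (max 0 (- c))"
    unfolding In_def energy_def
    by (subst nn_integral_add nn_integral_pair_sum | simp add: P.emeasure_space_1 mult_2)+
  finally have *: "Ip + ennreal (max 0 c) = energy N + In + ennreal (max 0 (- c))" .
  have "In \<le> (\<integral>\<^sup>+u. ennreal \<bar>c\<bar> \<partial>(N \<Otimes>\<^sub>M N))"
    unfolding In_def using AE by (intro nn_integral_mono_AE, eventually_elim)
      (use log_kernel_shift(2)[OF A] in \<open>auto simp: k_def c_def\<close>)
  also have "\<dots> < \<infinity>" by (simp add: P.emeasure_space_1)
  finally obtain i where i: "In = ennreal i" "0 \<le> i" by (cases In rule: ennreal_cases) auto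
  have "enn2ereal Ip - enn2ereal In = enn2ereal (energy N) - ereal c"
  proof (cases "energy N" rule: ennreal_cases)
    case (real e)
    then have "Ip + ennreal (max 0 c) = ennreal (e + i + max 0 (- c))" using * i by simp
    moreover then obtain q where q: "Ip = ennreal q" "0 \<le> q"
      by (cases Ip rule: ennreal_cases) auto
    ultimately have "ennreal (q + max 0 c) = ennreal (e + i + max 0 (- c))" using i by simp
    then have "q + max 0 c = e + i + max 0 (- c)" using real i q by (subst (asm) ennreal_inj) auto
    then show ?thesis using real i q by (simp add: max_def split: if_splits)
  next
    case top
    then have "Ip + ennreal (max 0 c) = top" using * by simp
    then have "Ip = top" by (simp del: ennreal_max_0)
    then show ?thesis using top i by simp
  qed
  then show ?thesis by (simp add: weighted_energy_def Ip_def In_def k_def c_def)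
qed

lemma is_equilibrium_measure_iff:
  assumes A: "A > 0"
  shows "is_equilibrium_measure (weight A) (z 1) (z K) M \<longleftrightarrow>
    M \<in> unit \<and> (\<forall>N\<in>unit. energy M \<le> energy N)"
proof -
  have le: "weighted_energy (weight A) M \<le> weighted_energy (weight A) N \<longleftrightarrow> energy M \<le> energy N"
    if "M \<in> unit" "N \<in> unit" for M N
    using that by (simp add: weighted_energy_eq[OF A] less_eq_ennreal.rep_eq)
      (cases "enn2ereal (energy M)"; cases "enn2ereal (energy N)"; simp)
  have "weighted_energy (weight A) M = min_energy (weight A) (z 1) (z K) \<longleftrightarrow>
      (\<forall>N\<in>unit. weighted_energy (weight A) M \<le> weighted_energy (weight A) N)" if "M \<in> unit"
    unfolding min_energy_def using that
    by (metis (no_types, lifting) INF_greatest INF_lower order_antisym)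
  then show ?thesis unfolding is_equilibrium_measure_def using le by blast
qed

end

section \<open>Existence of a minimizer\<close>

text \<open>From \<open>ln v = 2 * ln (sqrt v)\<close> and \<open>ln r \<le> r - 1\<close>: a
  majorant that is still integrable at 0.\<close>

lemma log_pot_le_powr:
  assumes "D > 0" "u \<noteq> 0"
  shows "log_pot D u \<le> ennreal (2 * sqrt D * \<bar>u\<bar> powr (-1/2))"
proof -
  have "ln (D / \<bar>u\<bar>) = 2 * ln (sqrt (D / \<bar>u\<bar>))"
    using assms by (simp add: ln_sqrt)
  also have "\<dots> \<le> 2 * sqrt (D / \<bar>u\<bar>)"
    using assms ln_le_minus_one[of "sqrt (D / \<bar>u\<bar>)"] by simp
  also have "\<dots> = 2 * sqrt D * \<bar>u\<bar> powr (-1/2)"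
    using assms by (simp add: real_sqrt_divide powr_minus powr_half_sqrt field_simps)
  finally show ?thesis using assms by (auto simp: log_pot_def intro!: ennreal_leI)
qed

text \<open>The set \<open>{-D..D}\<close> contains all differences of two points of the interval,
  so \<open>B * log_mass D\<close> bounds the potential of any density bounded by \<open>B\<close>,
  uniformly in the point.\<close>

definition log_mass :: "real \<Rightarrow> ennreal" where
  "log_mass D = (\<integral>\<^sup>+u. log_pot D u * indicator {-D..D} u \<partial>lborel)"

lemma log_mass_finite:
  assumes D: "D > 0" shows "log_mass D < \<infinity>"
proof -
  define g :: "real \<Rightarrow> real" where "g u = (if u \<in> {0<..D} then 2 * sqrt D * u powr (-1/2) else 0)" for u
  have [measurable]: "g \<in> borel_measurable borel" unfolding g_def by measurable
  have "((\<lambda>u. u powr (-1/2)) has_integral (D powr (-1/2+1) / (-1/2+1))) {0..D}"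
    by (rule has_integral_powr_from_0) (use D in auto)
  then have "((\<lambda>u. 2 * sqrt D * u powr (-1/2)) has_integral (2 * sqrt D * (D powr (-1/2+1) / (-1/2+1)))) {0..D}"
    by (intro has_integral_mult_right)
  then have "((\<lambda>u. if u \<in> {0..D} then 2 * sqrt D * u powr (-1/2) else 0) has_integral (2 * sqrt D * (D powr (-1/2+1) / (-1/2+1)))) UNIV"
    by (simp only: has_integral_restrict_UNIV)
  then have "(g has_integral (2 * sqrt D * (D powr (-1/2+1) / (-1/2+1)))) UNIV"
    by (rule has_integral_spike_finite[rotated 2, where S = "{0}"]) (auto simp: g_def)
  then have g: "(\<integral>\<^sup>+u. g u \<partial>lborel) < \<infinity>"
    by (subst nn_integral_has_integral_lborel) (auto simp: g_def intro!: mult_nonneg_nonneg)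
  have "log_mass D \<le> (\<integral>\<^sup>+u. ennreal (g u) + ennreal (g (- u)) \<partial>lborel)"
    unfolding log_mass_def
  proof (rule nn_integral_mono_AE)
    have "AE u in lborel. u \<noteq> (0::real)" by (rule AE_lborel_singleton)
    then show "AE u in lborel. log_pot D u * indicator {- D..D} u \<le> ennreal (g u) + ennreal (g (- u))"
    proof eventually_elim
      case (elim u)
      then show ?case
        using log_pot_le_powr[OF D, of u] by (auto simp: g_def indicator_def split: if_splits)
    qed
  qed
  also have "\<dots> = (\<integral>\<^sup>+u. g u \<partial>lborel) + (\<integral>\<^sup>+u. g (- u) \<partial>lborel)"
    by (rule nn_integral_add) auto
  also have "(\<integral>\<^sup>+u. g (- u) \<partial>lborel) = (\<integral>\<^sup>+u. g u \<partial>lborel)"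
    using nn_integral_real_affine[of "\<lambda>u. ennreal (g u)" "-1" 0] by simp
  finally have "log_mass D \<le> (\<integral>\<^sup>+u. g u \<partial>lborel) + (\<integral>\<^sup>+u. g u \<partial>lborel)" .
  also have "\<dots> < \<infinity>" using g by (simp add: ennreal_add_less_top)
  finally show ?thesis .
qed

text \<open>Continuity holds at 0 as well, with values in \<open>[0, \<infinity>]\<close>; this
  gives the pointwise convergence for Fatou's lemma without excluding the diagonal or the
  charges.\<close>

lemma tendsto_log_pot:
  assumes D: "D > 0" and f: "(f \<longlongrightarrow> u) F"
  shows "((\<lambda>n. log_pot D (f n)) \<longlongrightarrow> log_pot D u) F"
proof -
  have "isCont (log_pot D) u"
  proof (cases "u = 0")
    case False
    have "eventually (\<lambda>v. v \<noteq> 0) (nhds u)" using False by (rule t1_space_nhds)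
    then have "eventually (\<lambda>v. v \<noteq> 0) (at u)"
      unfolding eventually_at_filter by (rule eventually_mono) simp
    then have ev: "eventually (\<lambda>v. ennreal (ln (D / \<bar>v\<bar>)) = log_pot D v) (at u)"
      by eventually_elim (simp add: log_pot_def)
    have "((\<lambda>v. ennreal (ln (D / \<bar>v\<bar>))) \<longlongrightarrow> ennreal (ln (D / \<bar>u\<bar>))) (at u)"
      using D False by (intro tendsto_intros) auto
    then show ?thesis
      unfolding isCont_def using False by (subst tendsto_cong[OF ev, symmetric]) (simp add: log_pot_def)
  next
    case True
    have ev: "eventually (\<lambda>v. ennreal (ln (D / \<bar>v\<bar>)) = log_pot D v) (at 0)"
      by (auto simp: eventually_at_filter log_pot_def)
    have "filterlim (\<lambda>v. ln (D / \<bar>v\<bar>)) at_top (at 0)"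
    proof (rule filterlim_compose[OF ln_at_top])
      show "filterlim (\<lambda>v::real. D / \<bar>v\<bar>) at_top (at 0)"
      proof (rule LIM_at_top_divide[OF tendsto_const])
        have "((\<lambda>v::real. \<bar>v\<bar>) \<longlongrightarrow> \<bar>0\<bar>) (at 0)" by (intro tendsto_intros)
        then show "((\<lambda>v::real. \<bar>v\<bar>) \<longlongrightarrow> 0) (at 0)" by simp
        show "eventually (\<lambda>v::real. 0 < \<bar>v\<bar>) (at 0)" by (auto simp: eventually_at_filter)
      qed (use D in auto)
    qed
    then have "((\<lambda>v. ennreal (ln (D / \<bar>v\<bar>))) \<longlongrightarrow> top) (at 0)"
      by (simp only: ennreal_tendsto_top_eq_at_top)
    then show ?thesis
      using iffD1[OF tendsto_cong[OF ev]] True by (simp add: isCont_def log_pot_def [of D 0])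
  qed
  then show ?thesis using f by (rule isCont_tendsto_compose)
qed

context point_charges
begin

lemma tendsto_ext_pot: "(f \<longlongrightarrow> x) F \<Longrightarrow> ((\<lambda>n. ext_pot (f n)) \<longlongrightarrow> ext_pot x) F"
  unfolding ext_pot_def
  by (intro tendsto_sum ennreal_tendsto_cmult tendsto_log_pot D_pos tendsto_intros) auto

text \<open>One nonnegative integrand on the product space, so that Fatou's lemma is applied once to
  the whole energy.\<close>

lemma energy_alt:
  assumes "N \<in> unit"
  shows "energy N = (\<integral>\<^sup>+u. log_pot D (fst u - snd u) + (ext_pot (fst u) + ext_pot (snd u)) \<partial>(N \<Otimes>\<^sub>M N))"
proof -
  interpret prob_space N by (rule unitD[OF assms])
  have sN [measurable_cong]: "sets N = sets borel" by (rule unitD[OF assms])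
  show ?thesis
    unfolding energy_def by (subst nn_integral_add nn_integral_pair_sum | simp add: mult_2)+
qed

lemma nn_integral_log_pot_le:
  fixes f :: "real \<Rightarrow> real"
  assumes N: "N \<in> unit" "N = density lborel (\<lambda>t. ennreal (f t))"
    and [measurable]: "f \<in> borel_measurable borel" and B: "\<And>t. f t \<le> B" and x: "x \<in> {z 1..z K}"
  shows "(\<integral>\<^sup>+t. log_pot D (x - t) \<partial>N) \<le> ennreal B * log_mass D"
proof -
  have sN [measurable_cong]: "sets N = sets borel" by (rule unitD[OF N(1)])
  have "(\<integral>\<^sup>+t. log_pot D (x - t) \<partial>N) = (\<integral>\<^sup>+t. log_pot D (x - t) * indicator {-D..D} (x - t) \<partial>N)"
    using unitD(3)[OF N(1)]
    by (intro nn_integral_cong_AE, eventually_elim) (use x in \<open>auto simp: D_def indicator_def\<close>)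
  also have "\<dots> = (\<integral>\<^sup>+t. ennreal (f t) * (log_pot D (x - t) * indicator {-D..D} (x - t)) \<partial>lborel)"
    unfolding N(2) by (subst nn_integral_density) auto
  also have "\<dots> \<le> (\<integral>\<^sup>+t. ennreal B * (log_pot D (x - t) * indicator {-D..D} (x - t)) \<partial>lborel)"
    using B by (intro nn_integral_mono mult_right_mono ennreal_leI) auto
  also have "\<dots> = ennreal B * (\<integral>\<^sup>+t. log_pot D (x - t) * indicator {-D..D} (x - t) \<partial>lborel)"
    by (rule nn_integral_cmult) auto
  also have "(\<integral>\<^sup>+t. log_pot D (x - t) * indicator {-D..D} (x - t) \<partial>lborel) = log_mass D"
    unfolding log_mass_def
    using nn_integral_real_affine[of "\<lambda>u. log_pot D u * indicator {-D..D} u" "-1" x] by simp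
  finally show ?thesis .
qed

lemma energy_finite_of_bounded_density:
  fixes f :: "real \<Rightarrow> real"
  assumes N: "N \<in> unit" "N = density lborel (\<lambda>t. ennreal (f t))"
    and [measurable]: "f \<in> borel_measurable borel" and B: "\<And>t. f t \<le> B"
  shows "energy N < \<infinity>"
proof -
  interpret prob_space N by (rule unitD[OF N(1)])
  have sN [measurable_cong]: "sets N = sets borel" by (rule unitD[OF N(1)])
  note le = nn_integral_log_pot_le[OF N _ B]
  have fin: "ennreal B * log_mass D < \<infinity>"
    using log_mass_finite[OF D_pos] by (auto simp: ennreal_mult_less_top)
  have sym: "log_pot D (x - y) = log_pot D (y - x)" for x y
    by (auto simp: log_pot_def abs_minus_commute)
  have "(\<integral>\<^sup>+u. log_pot D (fst u - snd u) \<partial>(N \<Otimes>\<^sub>M N)) = (\<integral>\<^sup>+x. \<integral>\<^sup>+t. log_pot D (x - t) \<partial>N \<partial>N)"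
    by (subst nn_integral_fst[symmetric]) auto
  also have "\<dots> \<le> (\<integral>\<^sup>+x. ennreal B * log_mass D \<partial>N)"
    using unitD(3)[OF N(1)]
    by (intro nn_integral_mono_AE, eventually_elim) (auto intro!: le)
  also have "\<dots> < \<infinity>" using fin by (simp add: emeasure_space_1)
  finally have 1: "(\<integral>\<^sup>+u. log_pot D (fst u - snd u) \<partial>(N \<Otimes>\<^sub>M N)) < \<infinity>" .
  have "(\<integral>\<^sup>+x. log_pot D (x - z j) \<partial>N) < \<infinity>" if "j \<in> {1..K}" for j
    using le[OF _ z_in[OF that]] fin by (subst sym) (auto intro: le_less_trans)
  then have 2: "(\<integral>\<^sup>+x. ext_pot x \<partial>N) < \<infinity>"
    unfolding ext_pot_def
    by (subst nn_integral_sum) (auto simp: nn_integral_cmult ennreal_mult_less_top)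
  show ?thesis unfolding energy_def using 1 2 by (auto simp: ennreal_mult_less_top ennreal_add_less_top)
qed

text \<open>Normalized Lebesgue measure serves. Finiteness of the minimum is the source of all
  regularity of the minimizer: no atoms and integrable logarithms.\<close>

lemma exists_finite_energy: "\<exists>N\<in>unit. energy N < \<infinity>"
proof -
  define f where "f x = indicator {z 1..z K} x / D" for x :: real
  define N where "N = density lborel (\<lambda>t. ennreal (f t))"
  have [measurable]: "f \<in> borel_measurable borel" unfolding f_def by measurable
  have em: "emeasure N X = emeasure lborel (X \<inter> {z 1..z K}) / ennreal D" if [measurable]: "X \<in> sets borel" for X
  proof -
    have "emeasure N X = (\<integral>\<^sup>+t. indicator (X \<inter> {z 1..z K}) t / ennreal D \<partial>lborel)"
      unfolding N_def by (subst emeasure_density)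
        (use divide_ennreal[of 1 D] D_pos in \<open>auto intro!: nn_integral_cong simp: f_def indicator_def\<close>)
    also have "\<dots> = emeasure lborel (X \<inter> {z 1..z K}) / ennreal D"
      by (subst nn_integral_divide) auto
    finally show ?thesis .
  qed
  have "emeasure N (space N) = 1"
    using em[of UNIV] D_pos by (simp add: N_def D_def divide_ennreal)
  moreover have "emeasure N (UNIV - {z 1..z K}) = 0" 
    using em[of "UNIV - {z 1..z K}"] by (simp add: Diff_Int_distrib2)
  ultimately have "N \<in> unit" by (auto simp: unit_measures_def N_def intro!: prob_spaceI)
  moreover have "energy N < \<infinity>"
    by (rule energy_finite_of_bounded_density[OF calculation N_def, of "1/D"])
      (auto simp: f_def indicator_def D_pos less_imp_le)
  ultimately show ?thesis by blast
qed

lemma exists_minimizer: "\<exists>M\<in>unit. \<forall>N\<in>unit. energy M \<le> energy N"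
proof -
  have ne: "energy ` unit \<noteq> {}" using exists_finite_energy by auto
  obtain f where f: "decseq f" "range f \<subseteq> energy ` unit" "Inf (energy ` unit) = (INF i. f i)"
    using ennreal_Inf_countable_INF[OF ne] by blast
  then have "\<forall>n. \<exists>N. N \<in> unit \<and> f n = energy N" by blast
  then obtain N where N: "\<And>n. N n \<in> unit" "\<And>n. f n = energy (N n)" by metis
  have lim: "(\<lambda>n. energy (N n)) \<longlonglongrightarrow> Inf (energy ` unit)"
  proof -
    have "f = (\<lambda>n. energy (N n))" using N(2) by auto
    then show ?thesis using LIMSEQ_INF[OF f(1)] f(3) by simp
  qed
  have rd: "real_distribution (N n)" for n
    using unitD[OF N(1)[of n]] by (simp add: real_distribution_def real_distribution_axioms_def)
  have "tight N"
    unfolding tight_def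
  proof (intro conjI allI impI rd)
    fix \<epsilon> :: real assume e: "\<epsilon> > 0"
    \<comment> \<open>Tightness is phrased with half-open intervals, so the left end is moved to
      \<open>z 1 - 1\<close> to keep possible mass at \<open>z 1\<close>.\<close>
    have "measure (N n) {z 1 - 1<..z K} = 1" for n
    proof -
      interpret real_distribution "N n" by (rule rd)
      have "AE x in N n. x \<in> {z 1 - 1<..z K}"
        using unitD(3)[OF N(1)[of n]] by eventually_elim auto
      then show ?thesis by (subst prob_eq_1) auto
    qed
    then show "\<exists>a b. a < b \<and> (\<forall>n. 1 - \<epsilon> < measure (N n) {a<..b})"
      using z_less[of 1 K] K e by (intro exI[of _ "z 1 - 1"] exI[of _ "z K"]) auto
  qed
  from tight_imp_convergent_subsubsequence[OF this, of id]
  obtain r M where r: "strict_mono r" "real_distribution M" "weak_conv_m (N \<circ> r) M"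
    by (auto simp: strict_mono_def)
  have rd': "real_distribution ((N \<circ> r) n)" for n using rd by simp
  \<comment> \<open>Skorohod's representation replaces weak convergence by pointwise convergence of
    random variables on one probability space; lower semicontinuity of the energy then is Fatou's
    lemma on the product of that space with itself.\<close>
  obtain \<Omega> :: "real measure" and Y_seq Y where
    \<Omega>: "prob_space \<Omega>" and [measurable]: "\<And>n. Y_seq n \<in> borel_measurable \<Omega>"
    and Yn: "\<And>n. distr \<Omega> borel (Y_seq n) = N (r n)"
    and [measurable]: "Y \<in> borel_measurable \<Omega>" and Y: "distr \<Omega> borel Y = M"
    and Ylim: "\<And>x. x \<in> space \<Omega> \<Longrightarrow> (\<lambda>n. Y_seq n x) \<longlonglongrightarrow> Y x"
    using Skorohod[OF rd' r(2,3)] unfolding measurable_lborel1 o_def by metis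
  interpret \<Omega>: prob_space \<Omega> by fact
  interpret M: real_distribution M by fact
  have "AE x in \<Omega>. Y_seq n x \<in> {z 1..z K}" for n
    by (rule AE_distrD[of "Y_seq n" \<Omega> borel]) (simp, subst Yn, rule unitD(3)[OF N(1)])
  then have "AE x in \<Omega>. \<forall>n. Y_seq n x \<in> {z 1..z K}" by (subst AE_all_countable) auto
  then have "AE x in \<Omega>. Y x \<in> {z 1..z K}"
    using AE_space
    by eventually_elim (rule closed_sequentially[OF closed_atLeastAtMost _ Ylim], auto)
  then have "AE x in M. x \<in> {z 1..z K}" unfolding Y[symmetric] by (subst AE_distr_iff) auto
  then have "emeasure M {x \<in> space M. \<not> x \<in> {z 1..z K}} = 0"
    by (subst (asm) AE_iff_measurable[OF _ refl]) auto
  moreover have "{x \<in> space M. \<not> x \<in> {z 1..z K}} = UNIV - {z 1..z K}"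
    using sets_eq_imp_space_eq[OF M.events_eq_borel] by auto
  ultimately have M: "M \<in> unit"
    by (simp add: unit_measures_def M.prob_space_axioms)
  define e where "e = (\<lambda>u. log_pot D (fst u - snd u) + (ext_pot (fst u) + ext_pot (snd u)))"
  have [measurable]: "e \<in> borel_measurable (borel \<Otimes>\<^sub>M borel)" unfolding e_def by measurable
  have energy_distr: "energy (distr \<Omega> borel X) = (\<integral>\<^sup>+u. e (X (fst u), X (snd u)) \<partial>(\<Omega> \<Otimes>\<^sub>M \<Omega>))"
    if [measurable]: "X \<in> borel_measurable \<Omega>" and unit: "distr \<Omega> borel X \<in> unit" for X
  proof -
    have "sigma_finite_measure (distr \<Omega> borel X)"
      using unitD(1)[OF unit] by (simp add: prob_space_imp_sigma_finite)
    then have "distr \<Omega> borel X \<Otimes>\<^sub>M distr \<Omega> borel X = distr (\<Omega> \<Otimes>\<^sub>M \<Omega>) (borel \<Otimes>\<^sub>M borel) (\<lambda>(x, y). (X x, X y))"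
      by (intro pair_measure_distr) auto
    then show ?thesis
      unfolding energy_alt[OF unit] e_def[symmetric]
      by (subst nn_integral_distr | simp add: case_prod_beta | (rule nn_integral_cong; simp add: e_def))+
  qed
  have "energy M = (\<integral>\<^sup>+u. e (Y (fst u), Y (snd u)) \<partial>(\<Omega> \<Otimes>\<^sub>M \<Omega>))"
    using energy_distr[of Y] M Y by simp
  also have "\<dots> = (\<integral>\<^sup>+u. liminf (\<lambda>n. e (Y_seq n (fst u), Y_seq n (snd u))) \<partial>(\<Omega> \<Otimes>\<^sub>M \<Omega>))"
  proof (rule nn_integral_cong)
    fix u assume "u \<in> space (\<Omega> \<Otimes>\<^sub>M \<Omega>)"
    then have "fst u \<in> space \<Omega>" "snd u \<in> space \<Omega>" by (auto simp: space_pair_measure)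
    then have "(\<lambda>n. e (Y_seq n (fst u), Y_seq n (snd u))) \<longlonglongrightarrow> e (Y (fst u), Y (snd u))"
      unfolding e_def fst_conv snd_conv
      by (intro tendsto_add tendsto_log_pot tendsto_ext_pot tendsto_diff Ylim D_pos)
    then show "e (Y (fst u), Y (snd u)) = liminf (\<lambda>n. e (Y_seq n (fst u), Y_seq n (snd u)))"
      by (intro lim_imp_Liminf[symmetric]) auto
  qed
  also have "\<dots> \<le> liminf (\<lambda>n. \<integral>\<^sup>+u. e (Y_seq n (fst u), Y_seq n (snd u)) \<partial>(\<Omega> \<Otimes>\<^sub>M \<Omega>))"
    by (rule nn_integral_liminf) measurable
  also have "\<dots> = liminf (\<lambda>n. energy (N (r n)))"
    using energy_distr[of "Y_seq n" for n] N(1) by (simp add: Yn)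
  also have "\<dots> = Inf (energy ` unit)"
    using LIMSEQ_subseq_LIMSEQ[OF lim r(1)] by (intro lim_imp_Liminf) (auto simp: o_def)
  finally have "energy M \<le> Inf (energy ` unit)" .
  then show ?thesis using M by (meson INF_lower order_trans)
qed

end

section \<open>The first variation\<close>

lemma zero_of_quadratic_bound:
  fixes a C s0 :: real
  assumes "s0 > 0" and le: "\<And>s. \<bar>s\<bar> \<le> s0 \<Longrightarrow> s * a \<le> s\<^sup>2 * C"
  shows "a = 0"
proof (rule ccontr)
  assume "a \<noteq> 0"
  \<comment> \<open>The sign makes \<open>s * a\<close> positive; the size makes
    \<open>\<bar>s\<bar> * (\<bar>C\<bar> + 1) \<le> \<bar>a\<bar> / 2\<close>, so the hypothesis
    would give \<open>\<bar>a\<bar> \<le> \<bar>a\<bar> / 2\<close>.\<close>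
  define s where "s = sgn a * min s0 (\<bar>a\<bar> / (\<bar>C\<bar> + 1) / 2)"
  have pos: "min s0 (\<bar>a\<bar> / (\<bar>C\<bar> + 1) / 2) > 0" using assms \<open>a \<noteq> 0\<close> by simp
  have abs: "\<bar>s\<bar> = min s0 (\<bar>a\<bar> / (\<bar>C\<bar> + 1) / 2)"
    using pos \<open>a \<noteq> 0\<close> by (simp add: s_def abs_mult)
  have "s * a = \<bar>s\<bar> * \<bar>a\<bar>" using pos \<open>a \<noteq> 0\<close> by (simp add: s_def abs_mult) (simp add: sgn_if)
  moreover have "s * a \<le> s\<^sup>2 * C" using abs by (intro le) simp
  moreover have "s\<^sup>2 * C \<le> \<bar>s\<bar> * (\<bar>s\<bar> * (\<bar>C\<bar> + 1))"
  proof -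
    have "s\<^sup>2 * C \<le> s\<^sup>2 * (\<bar>C\<bar> + 1)" by (intro mult_left_mono) auto
    then show ?thesis by (simp add: power2_eq_square)
  qed
  ultimately have "\<bar>s\<bar> * \<bar>a\<bar> \<le> \<bar>s\<bar> * (\<bar>s\<bar> * (\<bar>C\<bar> + 1))" by linarith
  then have "\<bar>a\<bar> \<le> \<bar>s\<bar> * (\<bar>C\<bar> + 1)" using pos abs by (simp add: mult_le_cancel_left)
  also have "\<dots> \<le> (\<bar>a\<bar> / (\<bar>C\<bar> + 1) / 2) * (\<bar>C\<bar> + 1)" by (intro mult_right_mono) (auto simp: abs)
  also have "\<dots> = \<bar>a\<bar> / 2" by (simp add: divide_simps)
  finally show False using \<open>a \<noteq> 0\<close> by simp
qed

lemma nn_integral_eq_integral_AE: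
  fixes f :: "'a \<Rightarrow> real"
  assumes "integrable M f" "AE x in M. 0 \<le> f x" "AE x in M. g x = ennreal (f x)"
  shows "(\<integral>\<^sup>+x. g x \<partial>M) = ennreal (\<integral>x. f x \<partial>M)" "0 \<le> (\<integral>x. f x \<partial>M)"
  using nn_integral_eq_integral[OF assms(1,2)] nn_integral_cong_AE[OF assms(3)]
    integral_nonneg_AE[OF assms(2)] by auto

lemma integrable_of_log_pot:
  assumes [measurable]: "f \<in> borel_measurable M"
    and le: "AE x in M. \<bar>f x\<bar> \<le> D" and D: "D > 0" and fin: "(\<integral>\<^sup>+x. log_pot D (f x) \<partial>M) < \<infinity>"
  shows "AE x in M. f x \<noteq> 0" "integrable M (\<lambda>x. ln (D / \<bar>f x\<bar>))"
    "AE x in M. 0 \<le> ln (D / \<bar>f x\<bar>)" "AE x in M. log_pot D (f x) = ennreal (ln (D / \<bar>f x\<bar>))"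
proof -
  have "AE x in M. log_pot D (f x) \<noteq> \<infinity>"
    using fin by (intro nn_integral_PInf_AE) auto
  then show ne: "AE x in M. f x \<noteq> 0" by eventually_elim (auto simp: log_pot_def)
  then show eq: "AE x in M. log_pot D (f x) = ennreal (ln (D / \<bar>f x\<bar>))"
    by eventually_elim (simp add: log_pot_def)
  show nn: "AE x in M. 0 \<le> ln (D / \<bar>f x\<bar>)" using ne le by eventually_elim (use D in auto)
  show "integrable M (\<lambda>x. ln (D / \<bar>f x\<bar>))"
    using nn nn_integral_cong_AE[OF eq] fin by (intro integrableI_nonneg) auto
qed

section \<open>Consequences of finite energy, and the first variation\<close>

locale minimizer = point_charges +
  fixes M :: "real measure"
  assumes M: "M \<in> unit" and minimal: "\<And>N. N \<in> unit \<Longrightarrow> energy M \<le> energy N"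
begin

sublocale prob_space M by (rule unitD[OF M])

lemma sets_M [measurable_cong]: "sets M = sets borel" by (rule unitD[OF M])

lemma space_M [simp]: "space M = UNIV" using sets_eq_imp_space_eq[OF sets_M] by simp

lemma prob_UNIV [simp]: "measure M UNIV = 1" using prob_space by simp

lemma emeasure_UNIV [simp]: "emeasure M UNIV = 1" using emeasure_space_1 by simp

lemma AE_M: "AE x in M. x \<in> {z 1..z K}" by (rule unitD[OF M])

lemma AE_MM: "AE u in M \<Otimes>\<^sub>M M. fst u \<in> {z 1..z K} \<and> snd u \<in> {z 1..z K}"
  by (rule AE_unit_pair[OF M M])

lemma energy_finite: "energy M < \<infinity>"
  using exists_finite_energy minimal by (auto intro: le_less_trans)

lemma
  shows AE_fst_neq_snd: "AE u in M \<Otimes>\<^sub>M M. fst u - snd u \<noteq> 0"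
    and integrable_pair_log: "integrable (M \<Otimes>\<^sub>M M) (\<lambda>u. ln (D / \<bar>fst u - snd u\<bar>))"
    and pair_log_nonneg: "AE u in M \<Otimes>\<^sub>M M. 0 \<le> ln (D / \<bar>fst u - snd u\<bar>)"
    and pair_log_eq: "AE u in M \<Otimes>\<^sub>M M. log_pot D (fst u - snd u) = ennreal (ln (D / \<bar>fst u - snd u\<bar>))"
proof -
  have le: "AE u in M \<Otimes>\<^sub>M M. \<bar>fst u - snd u\<bar> \<le> D"
    using AE_MM by eventually_elim (auto simp: D_def)
  have fin: "(\<integral>\<^sup>+u. log_pot D (fst u - snd u) \<partial>(M \<Otimes>\<^sub>M M)) < \<infinity>"
    using energy_finite by (simp add: energy_def)
  show "AE u in M \<Otimes>\<^sub>M M. fst u - snd u \<noteq> 0"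
    "integrable (M \<Otimes>\<^sub>M M) (\<lambda>u. ln (D / \<bar>fst u - snd u\<bar>))"
    "AE u in M \<Otimes>\<^sub>M M. 0 \<le> ln (D / \<bar>fst u - snd u\<bar>)"
    "AE u in M \<Otimes>\<^sub>M M. log_pot D (fst u - snd u) = ennreal (ln (D / \<bar>fst u - snd u\<bar>))"
    using integrable_of_log_pot[OF _ le D_pos fin] by auto
qed

lemma
  assumes j: "j \<in> {1..K}"
  shows AE_neq_z: "AE x in M. x - z j \<noteq> 0"
    and integrable_z_log: "integrable M (\<lambda>x. ln (D / \<bar>x - z j\<bar>))"
    and z_log_nonneg: "AE x in M. 0 \<le> ln (D / \<bar>x - z j\<bar>)"
    and z_log_eq: "AE x in M. log_pot D (x - z j) = ennreal (ln (D / \<bar>x - z j\<bar>))"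
proof -
  have le: "AE x in M. \<bar>x - z j\<bar> \<le> D"
    using AE_M by eventually_elim (use z_in[OF j] in \<open>auto simp: D_def\<close>)
  have "(\<integral>\<^sup>+x. ext_pot x \<partial>M) < \<infinity>"
    using energy_finite by (auto simp: energy_def ennreal_mult_less_top)
  moreover have "(\<integral>\<^sup>+x. ennreal (p j) * log_pot D (x - z j) \<partial>M) \<le> (\<integral>\<^sup>+x. ext_pot x \<partial>M)"
    unfolding ext_pot_def using j by (intro nn_integral_mono member_le_sum) auto
  ultimately have "ennreal (p j) * (\<integral>\<^sup>+x. log_pot D (x - z j) \<partial>M) < \<infinity>"
    by (subst nn_integral_cmult[symmetric]) (auto intro: le_less_trans)
  then have fin: "(\<integral>\<^sup>+x. log_pot D (x - z j) \<partial>M) < \<infinity>"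
    using ppos[OF j] by (auto simp: ennreal_mult_less_top)
  show "AE x in M. x - z j \<noteq> 0"
    "integrable M (\<lambda>x. ln (D / \<bar>x - z j\<bar>))"
    "AE x in M. 0 \<le> ln (D / \<bar>x - z j\<bar>)"
    "AE x in M. log_pot D (x - z j) = ennreal (ln (D / \<bar>x - z j\<bar>))"
    using integrable_of_log_pot[OF _ le D_pos fin] by auto
qed

text \<open>An atom would give the diagonal positive product mass, and the kernel is infinite
  there.\<close>

lemma no_atoms: "emeasure M {x} = 0"
proof -
  have "AE u in M \<Otimes>\<^sub>M M. u \<notin> {x} \<times> {x}"
    using AE_fst_neq_snd by eventually_elim auto
  moreover have "{x} \<times> {x} \<in> sets (M \<Otimes>\<^sub>M M)" by (intro pair_measureI) (auto simp: sets_M)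
  ultimately have "emeasure (M \<Otimes>\<^sub>M M) ({x} \<times> {x}) = 0"
    by (subst (asm) AE_iff_null_sets[symmetric]) (auto simp: null_sets_def)
  then show ?thesis
    by (subst (asm) emeasure_pair_measure_Times) auto
qed

text \<open>Turns the energy of a pushforward into real integrals over \<open>M\<close>, with
  \<open>f\<close> and \<open>g j\<close> the finite versions of the transported kernels. It serves
  both for the identity and for the perturbed position, so that the two energies can be
  subtracted.\<close>

lemma energy_distr:
  fixes f :: "real \<times> real \<Rightarrow> real" and g :: "nat \<Rightarrow> real \<Rightarrow> real"
  assumes [measurable]: "T \<in> borel_measurable borel" and T: "distr M borel T \<in> unit"
    and f: "integrable (M \<Otimes>\<^sub>M M) f" "AE u in M \<Otimes>\<^sub>M M. 0 \<le> f u"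
      "AE u in M \<Otimes>\<^sub>M M. log_pot D (T (fst u) - T (snd u)) = ennreal (f u)"
    and g: "\<And>j. j \<in> {1..K} \<Longrightarrow> integrable M (g j)" "\<And>j. j \<in> {1..K} \<Longrightarrow> AE x in M. 0 \<le> g j x"
      "\<And>j. j \<in> {1..K} \<Longrightarrow> AE x in M. log_pot D (T x - z j) = ennreal (g j x)"
  shows "energy (distr M borel T) = ennreal ((\<integral>u. f u \<partial>(M \<Otimes>\<^sub>M M)) + 2 * (\<Sum>j=1..K. p j * (\<integral>x. g j x \<partial>M)))"
    "0 \<le> (\<integral>u. f u \<partial>(M \<Otimes>\<^sub>M M)) + 2 * (\<Sum>j=1..K. p j * (\<integral>x. g j x \<partial>M))"
proof -
  note 1 = nn_integral_eq_integral_AE[OF f]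
  have 2: "(\<integral>\<^sup>+x. log_pot D (T x - z j) \<partial>M) = ennreal (\<integral>x. g j x \<partial>M)" "0 \<le> (\<integral>x. g j x \<partial>M)"
    if "j \<in> {1..K}" for j
    by (rule nn_integral_eq_integral_AE[OF g[OF that]])+
  have "distr M borel T \<Otimes>\<^sub>M distr M borel T = distr (M \<Otimes>\<^sub>M M) (borel \<Otimes>\<^sub>M borel) (\<lambda>(x, y). (T x, T y))"
    using unitD(1)[OF T] by (intro pair_measure_distr) (auto simp: prob_space_imp_sigma_finite)
  then have e1: "(\<integral>\<^sup>+u. log_pot D (fst u - snd u) \<partial>(distr M borel T \<Otimes>\<^sub>M distr M borel T)) = ennreal (\<integral>u. f u \<partial>(M \<Otimes>\<^sub>M M))"
    unfolding 1(1)[symmetric] by (simp, subst nn_integral_distr) (auto simp: case_prod_beta)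
  have "(\<integral>\<^sup>+x. ext_pot x \<partial>distr M borel T) = (\<Sum>j=1..K. ennreal (p j) * (\<integral>\<^sup>+x. log_pot D (T x - z j) \<partial>M))"
    unfolding ext_pot_def by (subst nn_integral_distr) (auto simp: nn_integral_sum nn_integral_cmult)
  also have "\<dots> = (\<Sum>j=1..K. ennreal (p j * (\<integral>x. g j x \<partial>M)))"
    using 2 ppos by (intro sum.cong) (auto simp: ennreal_mult less_imp_le)
  also have "\<dots> = ennreal (\<Sum>j=1..K. p j * (\<integral>x. g j x \<partial>M))"
    using 2 ppos by (intro sum_ennreal) (auto intro!: mult_nonneg_nonneg simp: less_imp_le)
  finally have e2: "(\<integral>\<^sup>+x. ext_pot x \<partial>distr M borel T) = ennreal (\<Sum>j=1..K. p j * (\<integral>x. g j x \<partial>M))" .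
  have nn: "0 \<le> (\<Sum>j=1..K. p j * (\<integral>x. g j x \<partial>M))"
    using 2 ppos by (intro sum_nonneg mult_nonneg_nonneg) (auto simp: less_imp_le)
  show "energy (distr M borel T) = ennreal ((\<integral>u. f u \<partial>(M \<Otimes>\<^sub>M M)) + 2 * (\<Sum>j=1..K. p j * (\<integral>x. g j x \<partial>M)))"
    unfolding energy_def e1 e2 using 1(2) nn by (simp add: ennreal_mult)
  show "0 \<le> (\<integral>u. f u \<partial>(M \<Otimes>\<^sub>M M)) + 2 * (\<Sum>j=1..K. p j * (\<integral>x. g j x \<partial>M))" using 1(2) nn by simp
qed

text \<open>
  \<open>d\<close> is the divided difference of \<open>\<phi>\<close>. Under \<open>x \<mapsto> x + s \<phi>(x)\<close> the distances \<open>x - t\<close> and \<open>x - z\<^sub>j\<close> are multiplied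
  by \<open>1 + s d(x, t)\<close> and \<open>1 + s d(x, z\<^sub>j)\<close>, so the energy changes by \<open>- s A + O(s\<^sup>2)\<close> for \<open>s\<close> of both signs,
  where \<open>A\<close> is the left-hand side.
\<close>
lemma loop_equation:
  fixes d :: "real \<Rightarrow> real \<Rightarrow> real" and \<phi> :: "real \<Rightarrow> real"
  assumes [measurable]: "(\<lambda>u. d (fst u) (snd u)) \<in> borel_measurable (borel \<Otimes>\<^sub>M borel)"
    "\<phi> \<in> borel_measurable borel"
    and C: "\<And>x t. x \<in> {z 1..z K} \<Longrightarrow> t \<in> {z 1..z K} \<Longrightarrow> \<bar>d x t\<bar> \<le> C"
    and \<phi>z: "\<And>j. j \<in> {1..K} \<Longrightarrow> \<phi> (z j) = 0"
    and \<phi>d: "\<And>x t. x \<in> {z 1..z K} \<Longrightarrow> t \<in> {z 1..z K} \<Longrightarrow> \<phi> x - \<phi> t = (x - t) * d x t"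
  shows "(\<integral>u. d (fst u) (snd u) \<partial>(M \<Otimes>\<^sub>M M)) + 2 * (\<Sum>j=1..K. p j * (\<integral>x. d x (z j) \<partial>M)) = 0"
proof -
  interpret P: pair_prob_space M M by unfold_locales
  have dj [measurable]: "(\<lambda>x. d x (z j)) \<in> borel_measurable borel" for j
    using measurable_compose[of "\<lambda>x. (x, z j)" borel "borel \<Otimes>\<^sub>M borel" "\<lambda>u. d (fst u) (snd u)"] by simp
  have C0: "0 \<le> C" using C[of "z 1" "z 1"] z_in[of 1] K by auto
  \<comment> \<open>Ensures \<open>\<bar>s * d x t\<bar> \<le> 1/2\<close>, which keeps
    \<open>1 + s * d x t\<close> positive and lies in the range of the quadratic estimate for
    \<open>ln (1 + v)\<close>.\<close>
  define s0 where "s0 = 1 / (2 * C + 2)"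
  have s0: "s0 > 0" using C0 by (simp add: s0_def)
  define L where "L u = ln (D / \<bar>fst u - snd u\<bar>)" for u :: "real \<times> real"
  define Lz where "Lz j x = ln (D / \<bar>x - z j\<bar>)" for j x
  define A where "A = (\<integral>u. d (fst u) (snd u) \<partial>(M \<Otimes>\<^sub>M M)) + 2 * (\<Sum>j=1..K. p j * (\<integral>x. d x (z j) \<partial>M))"
  \<comment> \<open>In \<open>ln (1 + v) \<ge> v - 2 * v\<^sup>2\<close> the remainder is at most
    \<open>2 * s\<^sup>2 * C\<^sup>2\<close>; the pair term carries total weight 1 and the charges
    carry \<open>2 * ptot\<close>.\<close>
  have "s * A \<le> s\<^sup>2 * (2 * C\<^sup>2 * (1 + 2 * ptot))" if s: "\<bar>s\<bar> \<le> s0" for s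
  proof -
    have small: "\<bar>s * d x t\<bar> \<le> 1/2" if "x \<in> {z 1..z K}" "t \<in> {z 1..z K}" for x t
    proof -
      have "\<bar>s * d x t\<bar> \<le> s0 * C" unfolding abs_mult using s C[OF that] by (intro mult_mono) auto
      also have "\<dots> \<le> 1/2" using C0 by (simp add: s0_def field_simps)
      finally show ?thesis .
    qed
    define T where "T x = x + s * \<phi> x" for x
    have [measurable]: "T \<in> borel_measurable borel" unfolding T_def by measurable
    have T: "T x - T t = (x - t) * (1 + s * d x t)" if "x \<in> {z 1..z K}" "t \<in> {z 1..z K}" for x t
    proof -
      have "T x - T t = (x - t) + s * (\<phi> x - \<phi> t)" by (simp add: T_def algebra_simps)
      also have "\<dots> = (x - t) * (1 + s * d x t)" unfolding \<phi>d[OF that] by (simp add: algebra_simps)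
      finally show ?thesis .
    qed
    have Tz: "T (z j) = z j" if "j \<in> {1..K}" for j using \<phi>z[OF that] by (simp add: T_def)
    \<comment> \<open>The end points are charges and hence fixed, and positive factors preserve the
      order relative to them.\<close>
    have Tin: "T x \<in> {z 1..z K}" if "x \<in> {z 1..z K}" for x
    proof -
      have z: "1 \<in> {1..K}" "K \<in> {1..K}" using K by auto
      have "T x - z 1 \<ge> 0" "z K - T x \<ge> 0"
        using T[OF that z_in[OF z(1)]] T[OF z_in[OF z(2)] that] that
          small[OF that z_in[OF z(1)]] small[OF z_in[OF z(2)] that]
        unfolding Tz[OF z(1)] Tz[OF z(2)] by (auto intro!: mult_nonneg_nonneg)
      then show ?thesis by auto
    qed
    define N where "N = distr M borel T"
    have N: "N \<in> unit"
    proof -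
      have "prob_space N" unfolding N_def by (rule prob_space_distr) simp
      moreover have "AE x in M. T x \<in> {z 1..z K}" using AE_M by eventually_elim (rule Tin)
      then have "AE x in N. x \<in> {z 1..z K}" unfolding N_def by (subst AE_distr_iff) auto
      then have "emeasure N {x \<in> space N. \<not> x \<in> {z 1..z K}} = 0"
        by (rule AE_iff_measurable[THEN iffD1, OF _ refl, rotated]) (auto simp: N_def)
      moreover have "{x \<in> space N. \<not> x \<in> {z 1..z K}} = UNIV - {z 1..z K}" by (auto simp: N_def)
      ultimately show ?thesis by (simp add: unit_measures_def N_def)
    qed
    define l where "l u = ln (1 + s * d (fst u) (snd u))" for u :: "real \<times> real"
    define lz where "lz j x = ln (1 + s * d x (z j))" for j x
    have lower: "ln (1 + v) \<ge> v - 2 * v\<^sup>2" and bnd: "\<bar>ln (1 + v)\<bar> \<le> 1" if "\<bar>v\<bar> \<le> 1/2" for v :: real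
    proof -
      have "\<bar>ln (1 + v) - v\<bar> \<le> 2 * v\<^sup>2" by (rule abs_ln_one_plus_x_minus_x_bound[OF that])
      moreover have "v\<^sup>2 \<le> (1/2)\<^sup>2" using that by (subst abs_le_square_iff[symmetric]) auto
      ultimately show "ln (1 + v) \<ge> v - 2 * v\<^sup>2" "\<bar>ln (1 + v)\<bar> \<le> 1"
        using that by (auto simp: power2_eq_square)
    qed
    have intl: "integrable (M \<Otimes>\<^sub>M M) l"
    proof (rule P.integrable_const_bound[where B = 1])
      show "AE u in M \<Otimes>\<^sub>M M. norm (l u) \<le> 1"
        using AE_MM by eventually_elim (auto simp: l_def intro!: bnd small)
    qed (unfold l_def, measurable)
    have intd: "integrable (M \<Otimes>\<^sub>M M) (\<lambda>u. d (fst u) (snd u))"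
    proof (rule P.integrable_const_bound[where B = C])
      show "AE u in M \<Otimes>\<^sub>M M. norm (d (fst u) (snd u)) \<le> C"
        using AE_MM by eventually_elim (auto intro!: C)
    qed simp
    have intlz: "integrable M (lz j)" if j: "j \<in> {1..K}" for j
    proof (rule integrable_const_bound[where B = 1])
      show "AE x in M. norm (lz j x) \<le> 1"
        using AE_M by eventually_elim (use z_in[OF j] in \<open>auto simp: lz_def intro!: bnd small\<close>)
    qed (unfold lz_def, measurable)
    have intdz: "integrable M (\<lambda>x. d x (z j))" if j: "j \<in> {1..K}" for j
    proof (rule integrable_const_bound[where B = C])
      show "AE x in M. norm (d x (z j)) \<le> C"
        using AE_M by eventually_elim (use z_in[OF j] in \<open>auto intro!: C\<close>)
    qed simp
    have log_T: "ln (D / \<bar>T x - T t\<bar>) = ln (D / \<bar>x - t\<bar>) - ln (1 + s * d x t)"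
      "T x - T t \<noteq> 0" "0 \<le> ln (D / \<bar>T x - T t\<bar>)"
      if "x \<in> {z 1..z K}" "t \<in> {z 1..z K}" "x - t \<noteq> 0" for x t
    proof -
      have pos: "1 + s * d x t > 0" using small[OF that(1,2)] by linarith
      show ne: "T x - T t \<noteq> 0" using T[OF that(1,2)] that(3) pos by simp
      show "ln (D / \<bar>T x - T t\<bar>) = ln (D / \<bar>x - t\<bar>) - ln (1 + s * d x t)"
        unfolding T[OF that(1,2)] using pos that(3) D_pos by (simp add: abs_mult ln_div ln_mult)
      have "\<bar>T x - T t\<bar> \<le> D" using Tin[OF that(1)] Tin[OF that(2)] by (auto simp: D_def)
      then show "0 \<le> ln (D / \<bar>T x - T t\<bar>)" using ne D_pos by simp
    qed
    have *: "AE u in M \<Otimes>\<^sub>M M. fst u \<in> {z 1..z K} \<and> snd u \<in> {z 1..z K} \<and> fst u - snd u \<noteq> 0"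
      using AE_MM AE_fst_neq_snd by eventually_elim auto
    have f: "integrable (M \<Otimes>\<^sub>M M) (\<lambda>u. L u - l u)"
      using integrable_pair_log intl by (auto simp: L_def)
    have f': "AE u in M \<Otimes>\<^sub>M M. 0 \<le> L u - l u"
      "AE u in M \<Otimes>\<^sub>M M. log_pot D (T (fst u) - T (snd u)) = ennreal (L u - l u)"
      using * by (eventually_elim, use log_T in \<open>auto simp: L_def l_def log_pot_def\<close>)+
    have g: "integrable M (\<lambda>x. Lz j x - lz j x)" "AE x in M. 0 \<le> Lz j x - lz j x"
      "AE x in M. log_pot D (T x - z j) = ennreal (Lz j x - lz j x)" if j: "j \<in> {1..K}" for j
    proof -
      have *: "AE x in M. x \<in> {z 1..z K} \<and> x - z j \<noteq> 0"
        using AE_M AE_neq_z[OF j] by eventually_elim auto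
      show "integrable M (\<lambda>x. Lz j x - lz j x)"
        using integrable_z_log[OF j] intlz[OF j] by (auto simp: Lz_def)
      show "AE x in M. 0 \<le> Lz j x - lz j x" "AE x in M. log_pot D (T x - z j) = ennreal (Lz j x - lz j x)"
        using * by (eventually_elim,
            use log_T[of _ "z j"] Tz[OF j] z_in[OF j] in \<open>auto simp: Lz_def lz_def log_pot_def\<close>)+
    qed
    have id: "distr M borel (\<lambda>x. x) = M" by (rule distr_id2) (simp add: sets_M)
    have e4: "energy M = ennreal ((\<integral>u. L u \<partial>(M \<Otimes>\<^sub>M M)) + 2 * (\<Sum>j=1..K. p j * (\<integral>x. Lz j x \<partial>M)))"
      using energy_distr(1)[of "\<lambda>x. x" L Lz] integrable_pair_log pair_log_nonneg pair_log_eq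
        integrable_z_log z_log_nonneg z_log_eq M
      by (simp add: id L_def[abs_def] Lz_def[abs_def])
    have "(\<integral>u. L u \<partial>(M \<Otimes>\<^sub>M M)) + 2 * (\<Sum>j=1..K. p j * (\<integral>x. Lz j x \<partial>M))
       \<le> (\<integral>u. L u - l u \<partial>(M \<Otimes>\<^sub>M M)) + 2 * (\<Sum>j=1..K. p j * (\<integral>x. Lz j x - lz j x \<partial>M))"
      using minimal[OF N] energy_distr[OF _ N[unfolded N_def] f f' g] unfolding e4 N_def
      by (simp add: ennreal_le_iff)
    also have "\<dots> = (\<integral>u. L u \<partial>(M \<Otimes>\<^sub>M M)) + 2 * (\<Sum>j=1..K. p j * (\<integral>x. Lz j x \<partial>M))
       - ((\<integral>u. l u \<partial>(M \<Otimes>\<^sub>M M)) + 2 * (\<Sum>j=1..K. p j * (\<integral>x. lz j x \<partial>M)))"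
    proof -
      have "(\<integral>u. L u - l u \<partial>(M \<Otimes>\<^sub>M M)) = (\<integral>u. L u \<partial>(M \<Otimes>\<^sub>M M)) - (\<integral>u. l u \<partial>(M \<Otimes>\<^sub>M M))"
        using integrable_pair_log intl by (intro Bochner_Integration.integral_diff) (auto simp: L_def)
      moreover have "(\<Sum>j=1..K. p j * (\<integral>x. Lz j x - lz j x \<partial>M)) =
        (\<Sum>j=1..K. p j * (\<integral>x. Lz j x \<partial>M) - p j * (\<integral>x. lz j x \<partial>M))"
        using integrable_z_log intlz
        by (intro sum.cong refl) (simp add: Lz_def right_diff_distrib Bochner_Integration.integral_diff)
      ultimately show ?thesis by (simp add: sum_subtractf algebra_simps)
    qed
    finally have le0: "(\<integral>u. l u \<partial>(M \<Otimes>\<^sub>M M)) + 2 * (\<Sum>j=1..K. p j * (\<integral>x. lz j x \<partial>M)) \<le> 0" by simp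
    have ge: "s * d x t - 2 * (s\<^sup>2 * C\<^sup>2) \<le> ln (1 + s * d x t)"
      if "x \<in> {z 1..z K}" "t \<in> {z 1..z K}" for x t
    proof -
      have "(d x t)\<^sup>2 \<le> C\<^sup>2" using C[OF that] C0 by (subst abs_le_square_iff[symmetric]) auto
      then have "(s * d x t)\<^sup>2 \<le> s\<^sup>2 * C\<^sup>2" by (simp add: power_mult_distrib mult_left_mono)
      then show ?thesis using lower[OF small[OF that]] by linarith
    qed
    have "s * (\<integral>u. d (fst u) (snd u) \<partial>(M \<Otimes>\<^sub>M M)) - 2 * (s\<^sup>2 * C\<^sup>2) = (\<integral>u. s * d (fst u) (snd u) - 2 * (s\<^sup>2 * C\<^sup>2) \<partial>(M \<Otimes>\<^sub>M M))"
      using intd by (subst Bochner_Integration.integral_diff) (auto simp: P.prob_space)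
    also have "\<dots> \<le> (\<integral>u. l u \<partial>(M \<Otimes>\<^sub>M M))"
    proof (rule integral_mono_AE)
      show "AE u in M \<Otimes>\<^sub>M M. s * d (fst u) (snd u) - 2 * (s\<^sup>2 * C\<^sup>2) \<le> l u"
        using AE_MM by eventually_elim (auto intro!: ge simp: l_def)
    qed (use intd intl in auto)
    finally have le1: "s * (\<integral>u. d (fst u) (snd u) \<partial>(M \<Otimes>\<^sub>M M)) - 2 * (s\<^sup>2 * C\<^sup>2) \<le> (\<integral>u. l u \<partial>(M \<Otimes>\<^sub>M M))" .
    have le2: "s * (\<integral>x. d x (z j) \<partial>M) - 2 * (s\<^sup>2 * C\<^sup>2) \<le> (\<integral>x. lz j x \<partial>M)" if j: "j \<in> {1..K}" for j
    proof -
      have "s * (\<integral>x. d x (z j) \<partial>M) - 2 * (s\<^sup>2 * C\<^sup>2) = (\<integral>x. s * d x (z j) - 2 * (s\<^sup>2 * C\<^sup>2) \<partial>M)"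
        using intdz[OF j] by (subst Bochner_Integration.integral_diff) (auto simp: prob_space)
      also have "\<dots> \<le> (\<integral>x. lz j x \<partial>M)"
      proof (rule integral_mono_AE)
        show "AE x in M. s * d x (z j) - 2 * (s\<^sup>2 * C\<^sup>2) \<le> lz j x"
          using AE_M by eventually_elim (use z_in[OF j] in \<open>auto intro!: ge simp: lz_def\<close>)
      qed (use intdz[OF j] intlz[OF j] in auto)
      finally show ?thesis .
    qed
    have "(\<Sum>j=1..K. p j * (s * (\<integral>x. d x (z j) \<partial>M) - 2 * (s\<^sup>2 * C\<^sup>2))) \<le> (\<Sum>j=1..K. p j * (\<integral>x. lz j x \<partial>M))"
      using le2 ppos by (intro sum_mono mult_left_mono) (auto simp: less_imp_le)
    moreover have "(\<Sum>j=1..K. p j * (s * (\<integral>x. d x (z j) \<partial>M) - 2 * (s\<^sup>2 * C\<^sup>2))) =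
       s * (\<Sum>j=1..K. p j * (\<integral>x. d x (z j) \<partial>M)) - 2 * (s\<^sup>2 * C\<^sup>2) * ptot"
      unfolding ptot_def by (simp add: right_diff_distrib sum_subtractf sum_distrib_left sum_distrib_right mult_ac)
    ultimately show ?thesis using le0 le1 unfolding A_def by (simp add: algebra_simps)
  qed
  then have "A = 0" by (rule zero_of_quadratic_bound[OF s0])
  then show ?thesis by (simp add: A_def)
qed

end

section \<open>The algebraic equation for the Stieltjes transform\<close>

text \<open>The divided difference of the \<open>n\<close>-th power, in polynomial form so that it
  makes sense on the diagonal.\<close>

definition geo_diff :: "nat \<Rightarrow> 'a::comm_ring_1 \<Rightarrow> 'a \<Rightarrow> 'a" where
  "geo_diff n x t = (\<Sum>u<n. x ^ u * t ^ (n - 1 - u))"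

lemma geo_diff: "x ^ n - t ^ n = (x - t) * geo_diff n x t"
  unfolding geo_diff_def using power_diff_sumr2[of x n t] by (simp add: mult.commute)

lemma of_real_geo_diff:
  "of_real (geo_diff n x t) = (geo_diff n (of_real x) (of_real t) :: 'a::{comm_ring_1,real_algebra_1})"
  by (simp add: geo_diff_def)

abbreviation cpoly :: "real poly \<Rightarrow> complex \<Rightarrow> complex" where
  "cpoly P \<equiv> poly (map_poly complex_of_real P)"

lemma cpoly_mult: "cpoly (P * Q) \<zeta> = cpoly P \<zeta> * cpoly Q \<zeta>"
proof -
  have "map_poly complex_of_real (P * Q) = map_poly complex_of_real P * map_poly complex_of_real Q"
    by (intro poly_eqI) (simp add: coeff_map_poly coeff_mult)
  then show ?thesis by simp
qed

lemma cpoly_add: "cpoly (P + Q) \<zeta> = cpoly P \<zeta> + cpoly Q \<zeta>"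
proof -
  have "map_poly complex_of_real (P + Q) = map_poly complex_of_real P + map_poly complex_of_real Q"
    by (intro poly_eqI) (simp add: coeff_map_poly)
  then show ?thesis by simp
qed

lemma cpoly_power: "cpoly (P ^ n) \<zeta> = cpoly P \<zeta> ^ n"
  by (induction n) (simp_all add: cpoly_mult)

lemma cpoly_smult: "cpoly (smult c P) \<zeta> = of_real c * cpoly P \<zeta>"
proof -
  have "map_poly complex_of_real (smult c P) = smult (of_real c) (map_poly complex_of_real P)"
    by (intro poly_eqI) (simp add: coeff_map_poly)
  then show ?thesis by simp
qed

lemma cpoly_monom: "cpoly (monom c n) \<zeta> = of_real c * \<zeta> ^ n"
  by (simp add: map_poly_monom poly_monom)

lemma cpoly_sum: "cpoly (\<Sum>i\<in>I. P i) \<zeta> = (\<Sum>i\<in>I. cpoly (P i) \<zeta>)"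
  by (induction I rule: infinite_finite_induct) (simp_all add: cpoly_add)

lemma cpoly_prod: "cpoly (\<Prod>i\<in>I. P i) \<zeta> = (\<Prod>i\<in>I. cpoly (P i) \<zeta>)"
  by (induction I rule: infinite_finite_induct) (simp_all add: cpoly_mult)

lemma cpoly_linear: "cpoly [:- c, 1:] \<zeta> = \<zeta> - of_real c"
  by (simp add: map_poly_pCons)

lemma cpoly_of_real: "cpoly P (of_real x) = of_real (poly P x)"
  by (induction P) (simp_all add: map_poly_pCons)

lemma cpoly_altdef: "degree P \<le> n \<Longrightarrow> cpoly P \<zeta> = (\<Sum>k\<le>n. of_real (coeff P k) * \<zeta> ^ k)"
proof -
  assume n: "degree P \<le> n"
  have "P = (\<Sum>k\<le>n. monom (coeff P k) k)"
    using n poly_as_sum_of_monoms'[of P n] by simp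
  then have "cpoly P \<zeta> = cpoly (\<Sum>k\<le>n. monom (coeff P k) k) \<zeta>" by simp
  then show ?thesis by (simp add: cpoly_sum cpoly_monom)
qed

lemma coeff_mult_of_degree_le:
  fixes P Q :: "'a::comm_semiring_1 poly"
  assumes "degree P \<le> m" "degree Q \<le> n"
  shows "coeff (P * Q) (m + n) = coeff P m * coeff Q n"
proof -
  have "coeff (P * Q) (m + n) = (\<Sum>i\<le>m + n. coeff P i * coeff Q (m + n - i))" by (rule coeff_mult)
  also have "\<dots> = (\<Sum>i\<le>m + n. if i = m then coeff P m * coeff Q n else 0)"
  proof (rule sum.cong[OF refl])
    fix i assume "i \<in> {..m + n}"
    consider "i = m" | "i < m" | "i > m" by linarith
    then show "coeff P i * coeff Q (m + n - i) = (if i = m then coeff P m * coeff Q n else 0)"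
    proof cases
      case 2
      then have "coeff Q (m + n - i) = 0" using assms by (intro coeff_eq_0) auto
      then show ?thesis using 2 by simp
    next
      case 3
      then have "coeff P i = 0" using assms by (intro coeff_eq_0) auto
      then show ?thesis using 3 by simp
    qed simp
  qed
  finally show ?thesis by simp
qed

context point_charges
begin

definition Pi_poly :: "real poly" where "Pi_poly = (\<Prod>j=1..K. [:- z j, 1:])"

text \<open>The polynomial \<open>N\<close> of the overview:
  \<open>Pi * (\<Sum>j. p j / (x - z j))\<close> with denominators cleared. Its values at the
  charges are \<open>p j\<close> times the derivative of \<open>Pi\<close> there.\<close>

definition residue_poly :: "real poly" where
  "residue_poly = (\<Sum>j=1..K. smult (p j) (\<Prod>m\<in>{1..K} - {j}. [:- z m, 1:]))"

text \<open>
  \<open>loop_poly \<mu>\<close> is, for the moments \<open>\<mu>\<close> of \<open>M\<close>, the polynomial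
  \<open>\<integral>\<integral> \<Pi>[\<zeta>, x, t] dM dM + 2 \<Sum>\<^sub>j p\<^sub>j \<integral> \<Pi>[\<zeta>, x, z\<^sub>j] dM\<close> in \<open>\<zeta>\<close>, written out by the expansion of the
  second divided differences \<open>\<Pi>[\<zeta>, x, t]\<close> into monomials.
\<close>
definition loop_coeff :: "(nat \<Rightarrow> real) \<Rightarrow> nat \<Rightarrow> real" where
  "loop_coeff \<mu> n = (\<Sum>u<n. \<mu> u * \<mu> (n - 1 - u)) + 2 * (\<Sum>j=1..K. p j * (\<Sum>u<n. \<mu> u * z j ^ (n - 1 - u)))"

definition loop_poly :: "(nat \<Rightarrow> real) \<Rightarrow> real poly" where
  "loop_poly \<mu> = (\<Sum>k\<le>K. \<Sum>i<k. monom (coeff Pi_poly k * loop_coeff \<mu> (k - 1 - i)) i)"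

text \<open>The polynomial \<open>T\<close>:
  \<open>(Pi G + N)^2 = N^2 + Pi * (Pi G^2 + 2 N G)\<close>, and the last bracket equals
  \<open>loop_poly\<close> by the loop equation.\<close>

definition curve_poly :: "(nat \<Rightarrow> real) \<Rightarrow> real poly" where
  "curve_poly \<mu> = residue_poly\<^sup>2 + Pi_poly * loop_poly \<mu>"

lemma degree_Pi_poly: "degree Pi_poly = K" and lead_coeff_Pi_poly: "coeff Pi_poly K = 1"
proof -
  show deg: "degree Pi_poly = K" unfolding Pi_poly_def by (subst degree_prod_eq_sum_degree) auto
  have "lead_coeff Pi_poly = 1" unfolding Pi_poly_def by (subst lead_coeff_prod) auto
  then show "coeff Pi_poly K = 1" using deg by simp
qed

lemma poly_Pi_poly: "poly Pi_poly x = (\<Prod>j=1..K. x - z j)"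
  by (simp add: Pi_poly_def poly_prod)

lemma degree_residue_poly: "degree residue_poly \<le> K - 1"
  and coeff_residue_poly: "coeff residue_poly (K - 1) = ptot"
proof -
  have deg: "degree (\<Prod>m\<in>{1..K} - {j}. [:- z m, 1:]) = K - 1"
    and lc: "coeff (\<Prod>m\<in>{1..K} - {j}. [:- z m, 1:]) (K - 1) = 1" if "j \<in> {1..K}" for j
  proof -
    show "degree (\<Prod>m\<in>{1..K} - {j}. [:- z m, 1:]) = K - 1"
      using that by (subst degree_prod_eq_sum_degree) auto
    moreover have "lead_coeff (\<Prod>m\<in>{1..K} - {j}. [:- z m, 1:]) = 1"
      by (subst lead_coeff_prod) auto
    ultimately show "coeff (\<Prod>m\<in>{1..K} - {j}. [:- z m, 1:]) (K - 1) = 1" by simp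
  qed
  show "degree residue_poly \<le> K - 1"
    unfolding residue_poly_def using deg by (intro degree_sum_le) (auto intro!: order_trans[OF degree_smult_le])
  show "coeff residue_poly (K - 1) = ptot"
    unfolding residue_poly_def ptot_def using lc by (simp add: coeff_sum)
qed

lemma poly_residue_poly_z:
  assumes "j \<in> {1..K}"
  shows "poly residue_poly (z j) = p j * (\<Prod>m\<in>{1..K} - {j}. z j - z m)"
proof -
  have "poly residue_poly (z j) = (\<Sum>i=1..K. p i * (\<Prod>m\<in>{1..K} - {i}. z j - z m))"
    by (simp add: residue_poly_def poly_sum poly_prod)
  also have "\<dots> = (\<Sum>i=1..K. if i = j then p j * (\<Prod>m\<in>{1..K} - {j}. z j - z m) else 0)"
    using assms by (intro sum.cong) auto
  finally show ?thesis using assms by simp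
qed

lemma cpoly_residue_poly:
  assumes "\<And>j. j \<in> {1..K} \<Longrightarrow> \<zeta> \<noteq> of_real (z j)"
  shows "cpoly residue_poly \<zeta> = cpoly Pi_poly \<zeta> * (\<Sum>j=1..K. of_real (p j) / (\<zeta> - of_real (z j)))"
proof -
  have "cpoly Pi_poly \<zeta> = (\<zeta> - of_real (z j)) * (\<Prod>m\<in>{1..K} - {j}. \<zeta> - of_real (z m))" if "j \<in> {1..K}" for j
    unfolding Pi_poly_def cpoly_prod cpoly_linear by (rule prod.remove) (use that in auto)
  then have *: "(\<Prod>m\<in>{1..K} - {j}. \<zeta> - of_real (z m)) = cpoly Pi_poly \<zeta> / (\<zeta> - of_real (z j))" if "j \<in> {1..K}" for j
    using assms that by simp
  have "cpoly residue_poly \<zeta> = (\<Sum>j=1..K. of_real (p j) * (\<Prod>m\<in>{1..K} - {j}. \<zeta> - of_real (z m)))"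
    by (simp add: residue_poly_def cpoly_sum cpoly_smult cpoly_prod cpoly_linear)
  also have "\<dots> = (\<Sum>j=1..K. of_real (p j) * (cpoly Pi_poly \<zeta> / (\<zeta> - of_real (z j))))"
    by (intro sum.cong refl arg_cong2[of _ _ _ _ "(*)"] *)
  also have "\<dots> = cpoly Pi_poly \<zeta> * (\<Sum>j=1..K. of_real (p j) / (\<zeta> - of_real (z j)))"
    by (simp add: sum_distrib_left mult.commute)
  finally show ?thesis .
qed

lemma degree_loop_poly: "degree (loop_poly \<mu>) \<le> K - 2"
  and coeff_loop_poly: "coeff (loop_poly \<mu>) (K - 2) = \<mu> 0 * \<mu> 0 + 2 * ptot * \<mu> 0"
proof -
  \<comment> \<open>\<open>loop_coeff \<mu> 0\<close> consists of empty sums, so the power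
    \<open>k - 1\<close> drops out of the expansion and the degree falls from \<open>K - 1\<close>
    to \<open>K - 2\<close>.\<close>
  have zero: "monom (coeff Pi_poly k * loop_coeff \<mu> (k - 1 - i)) i = 0" if "i = k - 1" for i k
    using that by (simp add: loop_coeff_def)
  have "degree (monom (coeff Pi_poly k * loop_coeff \<mu> (k - 1 - i)) i) \<le> K - 2" if "k \<le> K" "i < k" for k i
  proof (cases "i = k - 1")
    case True then show ?thesis unfolding zero[OF True] by simp
  next
    case False
    then show ?thesis using that by (intro order_trans[OF degree_monom_le]) auto
  qed
  then show "degree (loop_poly \<mu>) \<le> K - 2"
    unfolding loop_poly_def by (intro degree_sum_le) auto
  have "coeff (loop_poly \<mu>) (K - 2) =
     (\<Sum>k\<le>K. \<Sum>i<k. if i = K - 2 then coeff Pi_poly k * loop_coeff \<mu> (k - 1 - i) else 0)"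
    unfolding loop_poly_def coeff_sum coeff_monom ..
  also have "\<dots> = (\<Sum>k\<le>K. if k = K then loop_coeff \<mu> 1 else 0)"
  proof (rule sum.cong[OF refl])
    fix k assume k: "k \<in> {..K}"
    have "(\<Sum>i<k. if i = K - 2 then coeff Pi_poly k * loop_coeff \<mu> (k - 1 - i) else 0) =
       (if K - 2 < k then coeff Pi_poly k * loop_coeff \<mu> (k - 1 - (K - 2)) else 0)"
      by simp
    also have "\<dots> = (if k = K then loop_coeff \<mu> 1 else 0)"
    proof -
      consider "k = K" | "k = K - 1" | "k \<le> K - 2" using k by force
      then show ?thesis
        by cases (use K in \<open>auto simp: lead_coeff_Pi_poly loop_coeff_def\<close>)
    qed
    finally show "(\<Sum>i<k. if i = K - 2 then coeff Pi_poly k * loop_coeff \<mu> (k - 1 - i) else 0) =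
      (if k = K then loop_coeff \<mu> 1 else 0)" .
  qed
  also have "\<dots> = \<mu> 0 * \<mu> 0 + 2 * ptot * \<mu> 0"
    by (simp add: loop_coeff_def ptot_def sum_distrib_right sum_distrib_left mult_ac)
  finally show "coeff (loop_poly \<mu>) (K - 2) = \<mu> 0 * \<mu> 0 + 2 * ptot * \<mu> 0" .
qed

lemma ptot_pos: "ptot > 0"
  unfolding ptot_def using ppos K by (intro sum_pos) auto

text \<open>The two summands have the same degree and their top coefficients add up to a square:
  \<open>ptot\<^sup>2 + (1 + 2 * ptot)\<close>. The normalization \<open>\<mu> 0 = 1\<close> enters
  here.\<close>

lemma degree_curve_poly:
  assumes "\<mu> 0 = 1"
  shows "degree (curve_poly \<mu>) = 2 * K - 2" "lead_coeff (curve_poly \<mu>) = (1 + ptot)\<^sup>2"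
proof -
  have deg: "degree (residue_poly\<^sup>2) \<le> 2 * K - 2" "degree (Pi_poly * loop_poly \<mu>) \<le> 2 * K - 2"
    using degree_power_le[of residue_poly 2] degree_residue_poly
      degree_mult_le[of Pi_poly "loop_poly \<mu>"] degree_loop_poly[of \<mu>] K degree_Pi_poly by auto
  have "coeff (residue_poly\<^sup>2) ((K - 1) + (K - 1)) = ptot\<^sup>2"
    unfolding power2_eq_square coeff_residue_poly[symmetric]
    by (rule coeff_mult_of_degree_le) (rule degree_residue_poly)+
  moreover have "coeff (Pi_poly * loop_poly \<mu>) (K + (K - 2)) = 1 + 2 * ptot"
    using coeff_mult_of_degree_le[of Pi_poly K "loop_poly \<mu>" "K - 2"] degree_loop_poly[of \<mu>]
    by (simp add: degree_Pi_poly lead_coeff_Pi_poly coeff_loop_poly assms)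
  moreover have "(K - 1) + (K - 1) = 2 * K - 2" "K + (K - 2) = 2 * K - 2" using K by auto
  ultimately have c: "coeff (curve_poly \<mu>) (2 * K - 2) = (1 + ptot)\<^sup>2"
    by (simp add: curve_poly_def power2_eq_square algebra_simps)
  moreover have "degree (curve_poly \<mu>) \<le> 2 * K - 2"
    unfolding curve_poly_def using deg by (rule degree_add_le)
  moreover have "(1 + ptot)\<^sup>2 \<noteq> 0" using ptot_pos by simp
  ultimately show "degree (curve_poly \<mu>) = 2 * K - 2" 
    using le_degree[of "curve_poly \<mu>" "2 * K - 2"] by (intro antisym) auto
  then show "lead_coeff (curve_poly \<mu>) = (1 + ptot)\<^sup>2" using c by simp
qed

lemma poly_curve_poly_z:
  assumes "j \<in> {1..K}"
  shows "poly (curve_poly \<mu>) (z j) = (poly residue_poly (z j))\<^sup>2" "poly (curve_poly \<mu>) (z j) > 0"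
proof -
  have "poly Pi_poly (z j) = 0" unfolding poly_Pi_poly using assms by auto
  then show 1: "poly (curve_poly \<mu>) (z j) = (poly residue_poly (z j))\<^sup>2" by (simp add: curve_poly_def)
  have "z j \<noteq> z m" if "m \<in> {1..K} - {j}" for m using inj_onD[OF z_inj, of j m] that assms by blast
  then have "poly residue_poly (z j) \<noteq> 0"
    unfolding poly_residue_poly_z[OF assms] using ppos[OF assms] by (simp add: prod_zero_iff)
  then show "poly (curve_poly \<mu>) (z j) > 0" unfolding 1 by simp
qed

lemma integrable_unit:
  fixes f :: "real \<Rightarrow> 'b::{banach, second_countable_topology}"
  assumes "M \<in> unit" "continuous_on UNIV f"
  shows "integrable M f"
proof -
  interpret M: prob_space M by (rule unitD[OF assms(1)])
  have sN [measurable_cong]: "sets M = sets borel" using unitD(2) assms by auto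
  have "compact (f ` {z 1..z K})"
    using assms by (intro compact_continuous_image) (auto intro: continuous_on_subset)
  then obtain C where C: "\<And>x. x \<in> {z 1..z K} \<Longrightarrow> norm (f x) \<le> C"
    using compact_imp_bounded by (force simp: bounded_iff)
  have [measurable]: "f \<in> borel_measurable borel" using assms by (intro borel_measurable_continuous_onI)
  have "AE x in M. norm (f x) \<le> C" using unitD(3)[OF assms(1)] by eventually_elim (rule C)
  then show ?thesis by (intro M.integrable_const_bound[where B = C]) auto
qed

end

context minimizer
begin

definition mom :: "nat \<Rightarrow> real" where "mom k = (\<integral>x. x ^ k \<partial>M)"

lemma mom_0: "mom 0 = 1" using prob_space by (simp add: mom_def)

definition stieltjes :: "complex \<Rightarrow> complex" where
  "stieltjes \<zeta> = (\<integral>x. 1 / (\<zeta> - of_real x) \<partial>M)"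

definition curve :: "real poly" where "curve = curve_poly mom"

lemmas integrable_continuous = integrable_unit[OF M]

text \<open>The displacement field \<open>F x = Pi(x) / (\<zeta> - x)\<close> is smooth on the real
  line and vanishes at every charge. Its divided difference splits into a product kernel, which
  integrates to \<open>W * G\<^sup>2\<close>, and a polynomial \<open>q\<close>, which integrates to
  moments.\<close>

lemma complex_loop_equation:
  assumes \<zeta>: "Im \<zeta> \<noteq> 0"
  shows "(cpoly Pi_poly \<zeta> * stieltjes \<zeta> + cpoly residue_poly \<zeta>)\<^sup>2 = cpoly curve \<zeta>"
proof -
  interpret P: pair_prob_space M M by unfold_locales
  have ne: "\<zeta> - of_real x \<noteq> 0" for x using \<zeta> by (metis Im_complex_of_real eq_iff_diff_eq_0)
  define W where "W = cpoly Pi_poly \<zeta>"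
  define c where "c k = complex_of_real (coeff Pi_poly k)" for k
  define q1 where "q1 x = (\<Sum>k\<le>K. c k * geo_diff k \<zeta> (of_real x))" for x :: real
  define q where "q x t = (\<Sum>k\<le>K. \<Sum>i<k. c k * \<zeta> ^ i * of_real (geo_diff (k - 1 - i) x t))" for x t :: real
  \<comment> \<open>The divided difference of \<open>F\<close>: the first term comes from
    \<open>W / (\<zeta> - x)\<close>, and \<open>q\<close> is the divided difference of
    \<open>q1\<close>, the polynomial part of \<open>F\<close> up to sign.\<close>
  define d where "d x t = W * (1 / (\<zeta> - of_real x)) * (1 / (\<zeta> - of_real t)) - q x t" for x t :: real
  define F where "F x = cpoly Pi_poly (of_real x) / (\<zeta> - of_real x)" for x :: real
  have q1: "W - cpoly Pi_poly (of_real x) = (\<zeta> - of_real x) * q1 x" for x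
  proof -
    have "W - cpoly Pi_poly (of_real x) = (\<Sum>k\<le>K. c k * (\<zeta> ^ k - of_real x ^ k))"
      unfolding W_def using cpoly_altdef[of Pi_poly K] degree_Pi_poly
      by (simp add: c_def right_diff_distrib sum_subtractf)
    then show ?thesis by (simp add: geo_diff q1_def sum_distrib_left mult_ac)
  qed
  have q: "q1 x - q1 t = of_real (x - t) * q x t" for x t
  proof -
    have "geo_diff k \<zeta> (of_real x) - geo_diff k \<zeta> (of_real t)
       = of_real (x - t) * (\<Sum>i<k. \<zeta> ^ i * of_real (geo_diff (k - 1 - i) x t))" for k
    proof -
      have "geo_diff k \<zeta> (of_real x) - geo_diff k \<zeta> (of_real t)
        = (\<Sum>i<k. \<zeta> ^ i * (of_real x ^ (k - 1 - i) - of_real t ^ (k - 1 - i)))"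
        by (simp add: geo_diff_def right_diff_distrib sum_subtractf)
      then show ?thesis by (simp add: geo_diff of_real_geo_diff sum_distrib_left mult_ac)
    qed
    then have "c k * geo_diff k \<zeta> (of_real x) - c k * geo_diff k \<zeta> (of_real t)
       = of_real (x - t) * (\<Sum>i<k. c k * \<zeta> ^ i * of_real (geo_diff (k - 1 - i) x t))" for k
      by (simp add: right_diff_distrib[symmetric] sum_distrib_left mult_ac)
    then show ?thesis unfolding q1_def q_def sum_subtractf[symmetric]
      by (simp add: sum_distrib_left)
  qed
  have F: "F x = W / (\<zeta> - of_real x) - q1 x" for x
    using q1[of x] ne[of x] by (simp add: F_def field_simps)
  have Fd: "F x - F t = of_real (x - t) * d x t" for x t
  proof -
    have "F x - F t = W * (1 / (\<zeta> - of_real x) - 1 / (\<zeta> - of_real t)) - (q1 x - q1 t)"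
      by (simp add: F algebra_simps)
    also have "1 / (\<zeta> - of_real x) - 1 / (\<zeta> - of_real t) = of_real (x - t) * (1 / (\<zeta> - of_real x) * (1 / (\<zeta> - of_real t)))"
      using ne by (simp add: field_simps)
    finally show ?thesis unfolding q by (simp add: d_def algebra_simps)
  qed
  have cont_d: "continuous_on UNIV (\<lambda>u. d (fst u) (snd u))"
    unfolding d_def q_def geo_diff_def by (intro continuous_intros) (use ne in auto)
  then have d_meas: "(\<lambda>u. d (fst u) (snd u)) \<in> borel_measurable (borel \<Otimes>\<^sub>M borel)"
    unfolding borel_prod by (rule borel_measurable_continuous_onI)
  have "compact ((\<lambda>u. d (fst u) (snd u)) ` ({z 1..z K} \<times> {z 1..z K}))"
    using cont_d by (intro compact_continuous_image compact_Times) (auto intro: continuous_on_subset)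
  then obtain C where C: "\<And>x t. x \<in> {z 1..z K} \<Longrightarrow> t \<in> {z 1..z K} \<Longrightarrow> norm (d x t) \<le> C"
    using compact_imp_bounded by (force simp: bounded_iff)
  have int_d: "integrable (M \<Otimes>\<^sub>M M) (\<lambda>u. d (fst u) (snd u))"
  proof (rule P.integrable_const_bound[where B = C])
    show "AE u in M \<Otimes>\<^sub>M M. norm (d (fst u) (snd u)) \<le> C"
      using AE_MM by eventually_elim (auto intro!: C)
  qed (use d_meas in measurable)
  have int_dz: "integrable M (\<lambda>x. d x y)" for y
    by (rule integrable_continuous) (unfold d_def q_def geo_diff_def, intro continuous_intros, use ne in auto)
  define A where "A = (\<integral>u. d (fst u) (snd u) \<partial>(M \<Otimes>\<^sub>M M)) + 2 * (\<Sum>j=1..K. of_real (p j) * (\<integral>x. d x (z j) \<partial>M))"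
  \<comment> \<open>\<open>loop_equation\<close> is about real displacements, so it is applied to
    \<open>Re (e * F x)\<close>; \<open>e = 1\<close> and \<open>e = - \<i>\<close> then give the
    real and the imaginary part of \<open>A\<close>.\<close>
  have "Re (e * A) = 0" if e: "norm e = 1" for e
  proof -
    have "(\<integral>u. Re (e * d (fst u) (snd u)) \<partial>(M \<Otimes>\<^sub>M M)) + 2 * (\<Sum>j=1..K. p j * (\<integral>x. Re (e * d x (z j)) \<partial>M)) = 0"
    proof (rule loop_equation[where \<phi> = "\<lambda>x. Re (e * F x)" and C = C])
      show "(\<lambda>u. Re (e * d (fst u) (snd u))) \<in> borel_measurable (borel \<Otimes>\<^sub>M borel)"
        using d_meas by measurable
      have "continuous_on UNIV (\<lambda>x. Re (e * F x))"
        unfolding F_def cpoly_of_real by (intro continuous_intros) (use ne in auto)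
      then show "(\<lambda>x. Re (e * F x)) \<in> borel_measurable borel" by (rule borel_measurable_continuous_onI)
      show "\<bar>Re (e * d x t)\<bar> \<le> C" if "x \<in> {z 1..z K}" "t \<in> {z 1..z K}" for x t
        using abs_Re_le_cmod[of "e * d x t"] C[OF that] e by (simp add: norm_mult)
      show "Re (e * F (z j)) = 0" if "j \<in> {1..K}" for j
      proof -
        have "poly Pi_poly (z j) = 0" unfolding poly_Pi_poly using that by auto
        then show ?thesis by (simp add: F_def cpoly_of_real)
      qed
      show "Re (e * F x) - Re (e * F t) = (x - t) * Re (e * d x t)" for x t
      proof -
        have "Re (e * F x) - Re (e * F t) = Re (e * (F x - F t))" by (simp add: algebra_simps)
        also have "e * (F x - F t) = of_real (x - t) * (e * d x t)" unfolding Fd by (simp only: mult_ac)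
        also have "Re \<dots> = (x - t) * Re (e * d x t)"
          using times_complex.sel(1)[of "of_real (x - t)" "e * d x t"] by simp
        finally show ?thesis .
      qed
    qed
    moreover have "(\<integral>u. Re (e * d (fst u) (snd u)) \<partial>(M \<Otimes>\<^sub>M M)) = Re (e * (\<integral>u. d (fst u) (snd u) \<partial>(M \<Otimes>\<^sub>M M)))"
      using int_d by (subst integral_Re) auto
    moreover have "(\<integral>x. Re (e * d x (z j)) \<partial>M) = Re (e * (\<integral>x. d x (z j) \<partial>M))" for j
      using int_dz by (subst integral_Re) auto
    moreover have "Re (e * (2 * (\<Sum>j=1..K. of_real (p j) * (\<integral>x. d x (z j) \<partial>M))))
       = 2 * (\<Sum>j=1..K. p j * Re (e * (\<integral>x. d x (z j) \<partial>M)))"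
    proof -
      have "e * (2 * (\<Sum>j=1..K. of_real (p j) * (\<integral>x. d x (z j) \<partial>M)))
         = (\<Sum>j=1..K. of_real (2 * p j) * (e * (\<integral>x. d x (z j) \<partial>M)))"
        by (simp add: sum_distrib_left mult_ac)
      also have "Re \<dots> = (\<Sum>j=1..K. 2 * p j * Re (e * (\<integral>x. d x (z j) \<partial>M)))"
        unfolding Re_sum by (intro sum.cong) simp_all
      finally show ?thesis by (simp add: sum_distrib_left mult_ac)
    qed
    ultimately show ?thesis unfolding A_def distrib_left[of e] plus_complex.sel by simp
  qed
  from this[of 1] this[of "- \<i>"] have A0: "A = 0" by (simp add: complex_eq_iff)
  define G where "G = stieltjes \<zeta>"
  have int_pow: "integrable M (\<lambda>x. complex_of_real (x ^ u))" for u
    by (intro integrable_continuous continuous_intros)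
  have int_st: "integrable M (\<lambda>x. 1 / (\<zeta> - complex_of_real x))"
    by (intro integrable_continuous continuous_intros) (use ne in auto)
  have mom: "(\<integral>x. complex_of_real (x ^ u) \<partial>M) = of_real (mom u)" for u
    unfolding mom_def by (rule integral_complex_of_real)
  have int_geo: "integrable M (\<lambda>x. complex_of_real (geo_diff n x t))" for n t
    unfolding geo_diff_def by (intro integrable_continuous continuous_intros)
  have geo: "(\<integral>x. complex_of_real (geo_diff n x t) \<partial>M) = of_real (\<Sum>u<n. mom u * t ^ (n - 1 - u))" for n t
    unfolding integral_complex_of_real geo_diff_def mom_def
    by (subst Bochner_Integration.integral_sum) (auto intro!: integrable_continuous continuous_intros)
  have geo_mom: "(\<integral>y. complex_of_real (\<Sum>u<n. mom u * y ^ (n - 1 - u)) \<partial>M) = of_real (\<Sum>u<n. mom u * mom (n - 1 - u))" for n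
    unfolding integral_complex_of_real
    by (subst Bochner_Integration.integral_sum)
      (auto intro!: integrable_continuous continuous_intros simp: mom_def)
  have d1: "(\<integral>x. d x y \<partial>M) = W * G * (1 / (\<zeta> - of_real y)) -
      (\<Sum>k\<le>K. \<Sum>i<k. c k * \<zeta> ^ i * of_real (\<Sum>u<k - 1 - i. mom u * y ^ (k - 1 - i - 1 - u)))" for y
  proof -
    have "(\<integral>x. q x y \<partial>M) = (\<Sum>k\<le>K. \<integral>x. (\<Sum>i<k. c k * \<zeta> ^ i * of_real (geo_diff (k - 1 - i) x y)) \<partial>M)"
      unfolding q_def by (rule Bochner_Integration.integral_sum) (use int_geo in auto)
    also have "\<dots> = (\<Sum>k\<le>K. \<Sum>i<k. \<integral>x. c k * \<zeta> ^ i * of_real (geo_diff (k - 1 - i) x y) \<partial>M)"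
      by (intro sum.cong refl Bochner_Integration.integral_sum) (use int_geo in auto)
    finally have q: "(\<integral>x. q x y \<partial>M) = (\<Sum>k\<le>K. \<Sum>i<k. c k * \<zeta> ^ i *
        of_real (\<Sum>u<k - 1 - i. mom u * y ^ (k - 1 - i - 1 - u)))"
      unfolding integral_mult_right_zero geo .
    have "(\<integral>x. d x y \<partial>M) = (\<integral>x. W * (1 / (\<zeta> - of_real x)) * (1 / (\<zeta> - of_real y)) \<partial>M) - (\<integral>x. q x y \<partial>M)"
      unfolding d_def
    proof (rule Bochner_Integration.integral_diff)
      show "integrable M (\<lambda>x. q x y)" unfolding q_def using int_geo by auto
    qed (rule integrable_mult_left, rule integrable_mult_right, rule int_st)
    then show ?thesis
      unfolding q integral_mult_right_zero integral_mult_left_zero G_def stieltjes_def .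
  qed
  have "(\<integral>u. d (fst u) (snd u) \<partial>(M \<Otimes>\<^sub>M M)) = (\<integral>y. \<integral>x. d x y \<partial>M \<partial>M)"
    using P.integral_snd[of d] int_d by (simp add: case_prod_beta')
  also have "\<dots> = W * G\<^sup>2 - (\<Sum>k\<le>K. \<Sum>i<k. c k * \<zeta> ^ i * of_real (\<Sum>u<k - 1 - i. mom u * mom (k - 1 - i - 1 - u)))"
  proof -
    have i: "integrable M (\<lambda>y. complex_of_real (\<Sum>u<n. mom u * y ^ (n - 1 - u)))" for n
      by (intro integrable_continuous continuous_intros)
    define S where "S y = (\<Sum>k\<le>K. \<Sum>i<k. c k * \<zeta> ^ i * of_real (\<Sum>u<k - 1 - i. mom u * y ^ (k - 1 - i - 1 - u)))" for y
    have "(\<integral>y. S y \<partial>M) = (\<Sum>k\<le>K. \<integral>y. (\<Sum>i<k. c k * \<zeta> ^ i *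
        of_real (\<Sum>u<k - 1 - i. mom u * y ^ (k - 1 - i - 1 - u))) \<partial>M)"
      unfolding S_def by (rule Bochner_Integration.integral_sum, rule Bochner_Integration.integrable_sum,
          rule integrable_mult_right, rule i)
    also have "\<dots> = (\<Sum>k\<le>K. \<Sum>i<k. \<integral>y. c k * \<zeta> ^ i *
        of_real (\<Sum>u<k - 1 - i. mom u * y ^ (k - 1 - i - 1 - u)) \<partial>M)"
      by (intro sum.cong refl Bochner_Integration.integral_sum integrable_mult_right i)
    finally have S: "(\<integral>y. S y \<partial>M) = (\<Sum>k\<le>K. \<Sum>i<k. c k * \<zeta> ^ i *
        of_real (\<Sum>u<k - 1 - i. mom u * mom (k - 1 - i - 1 - u)))"
      unfolding integral_mult_right_zero geo_mom .
    have "(\<integral>y. W * G * (1 / (\<zeta> - of_real y)) - S y \<partial>M) = (\<integral>y. W * G * (1 / (\<zeta> - of_real y)) \<partial>M) - (\<integral>y. S y \<partial>M)"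
    proof (rule Bochner_Integration.integral_diff)
      show "integrable M S"
        unfolding S_def by (rule Bochner_Integration.integrable_sum, rule Bochner_Integration.integrable_sum,
          rule integrable_mult_right, rule i)
    qed (rule integrable_mult_right, rule int_st)
    then show ?thesis
      unfolding d1 S_def[symmetric] S integral_mult_right_zero stieltjes_def[symmetric] G_def[symmetric]
      by (simp add: power2_eq_square mult.assoc)
  qed
  finally have d2: "(\<integral>u. d (fst u) (snd u) \<partial>(M \<Otimes>\<^sub>M M)) = W * G\<^sup>2 - (\<Sum>k\<le>K. \<Sum>i<k. c k * \<zeta> ^ i * of_real (\<Sum>u<k - 1 - i. mom u * mom (k - 1 - i - 1 - u)))" .
  have res: "cpoly residue_poly \<zeta> = W * (\<Sum>j=1..K. of_real (p j) / (\<zeta> - of_real (z j)))"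
    unfolding W_def by (rule cpoly_residue_poly) (use ne in auto)
  have loop: "cpoly (loop_poly mom) \<zeta> = (\<Sum>k\<le>K. \<Sum>i<k. c k * \<zeta> ^ i * of_real (loop_coeff mom (k - 1 - i)))"
    by (simp add: loop_poly_def cpoly_sum cpoly_monom c_def mult_ac)
  have "A = W * G\<^sup>2 + 2 * cpoly residue_poly \<zeta> * G - cpoly (loop_poly mom) \<zeta>"
  proof -
    define e where "e n j = (\<Sum>u<n. mom u * z j ^ (n - 1 - u))" for n j
    have d1': "(\<integral>x. d x (z j) \<partial>M) = W * G * (1 / (\<zeta> - of_real (z j))) -
      (\<Sum>k\<le>K. \<Sum>i<k. c k * \<zeta> ^ i * of_real (e (k - 1 - i) j))" for j
      unfolding d1 e_def ..
    have s: "(\<Sum>j=1..K. of_real (p j) * (\<integral>x. d x (z j) \<partial>M)) = cpoly residue_poly \<zeta> * G -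
      (\<Sum>k\<le>K. \<Sum>i<k. c k * \<zeta> ^ i * of_real (\<Sum>j=1..K. p j * e (k - 1 - i) j))"
    proof -
      have "(\<Sum>j=1..K. of_real (p j) * (\<integral>x. d x (z j) \<partial>M)) =
         (\<Sum>j=1..K. W * G * (of_real (p j) / (\<zeta> - of_real (z j)))) -
         (\<Sum>j=1..K. \<Sum>k\<le>K. \<Sum>i<k. c k * \<zeta> ^ i * of_real (p j * e (k - 1 - i) j))"
        unfolding d1' right_diff_distrib sum_subtractf
        by (simp add: sum_distrib_left mult_ac)
      also have "(\<Sum>j=1..K. W * G * (of_real (p j) / (\<zeta> - of_real (z j)))) = cpoly residue_poly \<zeta> * G"
        unfolding res by (simp add: sum_distrib_left sum_distrib_right mult_ac)
      also have "(\<Sum>j=1..K. \<Sum>k\<le>K. \<Sum>i<k. c k * \<zeta> ^ i * of_real (p j * e (k - 1 - i) j))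
        = (\<Sum>k\<le>K. \<Sum>i<k. c k * \<zeta> ^ i * of_real (\<Sum>j=1..K. p j * e (k - 1 - i) j))"
        unfolding of_real_sum sum_distrib_left
        by (rule trans[OF sum.swap]) (intro sum.cong refl sum.swap)
      finally show ?thesis .
    qed
    show ?thesis
      unfolding A_def d2 s loop loop_coeff_def e_def[symmetric] of_real_add of_real_mult distrib_left sum.distrib of_real_numeral
      by (simp add: sum_distrib_left algebra_simps del: of_real_sum)
  qed
  then have "W * G\<^sup>2 + 2 * cpoly residue_poly \<zeta> * G = cpoly (loop_poly mom) \<zeta>" using A0 by simp
  \<comment> \<open>Multiplication by \<open>W\<close> prepares the completion of the square: adding
    \<open>N^2\<close> makes the left side \<open>(W * G + N)^2\<close>.\<close>
  then have "W * (W * G\<^sup>2 + 2 * cpoly residue_poly \<zeta> * G) = W * cpoly (loop_poly mom) \<zeta>" by simp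
  then show ?thesis
    unfolding curve_def curve_poly_def cpoly_add cpoly_mult cpoly_power G_def[symmetric] W_def[symmetric]
    by (simp add: power2_eq_square algebra_simps)
qed

end

section \<open>Stieltjes inversion\<close>

text \<open>
  This recovers \<open>\<bar>Im (\<Pi> G + N)\<bar>\<close> at the real line from the boundary values of \<open>T\<close>, without choosing a
  branch of \<open>sqrt T\<close>.
\<close>
lemma sq_Im_eq: "(Im h)\<^sup>2 = (norm (h\<^sup>2) - Re (h\<^sup>2)) / 2"
  by (simp add: norm_power cmod_power2) (simp add: power2_eq_square algebra_simps)

lemma Im_inverse_diff: "Im (1 / (Complex x y - of_real t)) = - (y / ((x - t)\<^sup>2 + y\<^sup>2))"
  by (simp add: Complex_eq Im_divide power2_eq_square)

lemma continuous_on_cpoly [continuous_intros]: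
  "continuous_on A f \<Longrightarrow> continuous_on A (\<lambda>x. cpoly P (f x))"
  by (intro continuous_on_poly)

lemma tendsto_approach: "(\<lambda>n. Complex x (1 / real (Suc n))) \<longlonglongrightarrow> of_real x"
proof -
  have "(\<lambda>n. Complex x (1 / real (Suc n))) \<longlonglongrightarrow> Complex x 0"
    by (intro tendsto_intros LIMSEQ_Suc[OF lim_1_over_n])
  then show ?thesis by (simp add: complex_of_real_def)
qed

lemma tendsto_cpoly_approach: "(\<lambda>n. cpoly P (Complex x (1 / real (Suc n)))) \<longlonglongrightarrow> of_real (poly P x)"
  using isCont_tendsto_compose[OF poly_isCont tendsto_approach, of "map_poly complex_of_real P" x]
  by (simp only: cpoly_of_real)

lemma tendsto_arctan_div_pos: "u > 0 \<Longrightarrow> (\<lambda>n. arctan (u * real (Suc n))) \<longlonglongrightarrow> pi / 2"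
  by (rule filterlim_compose[OF tendsto_arctan_at_top])
    (intro filterlim_tendsto_pos_mult_at_top[OF tendsto_const] filterlim_compose[OF filterlim_real_sequentially filterlim_Suc])

lemma tendsto_arctan_div_neg: "u < 0 \<Longrightarrow> (\<lambda>n. arctan (u * real (Suc n))) \<longlonglongrightarrow> - (pi / 2)"
  using tendsto_minus[OF tendsto_arctan_div_pos[of "- u"]] by (simp add: arctan_minus)

lemma has_integral_mult_indicator:
  fixes f :: "real \<Rightarrow> real"
  shows "((\<lambda>x. f x * indicator S x) has_integral I) UNIV \<longleftrightarrow> (f has_integral I) S"
proof -
  have "(\<lambda>x. f x * indicator S x) = (\<lambda>x. if x \<in> S then f x else 0)"
    by (auto simp: fun_eq_iff indicator_def)
  then show ?thesis by (simp only: has_integral_restrict_UNIV)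
qed

context minimizer
begin

text \<open>The density predicted by Stieltjes inversion, \<open>- Im G / pi\<close> at the real
  line, where \<open>\<bar>Im (Pi G)\<bar>\<close> is the root of the negative part of
  \<open>T\<close>. At a charge the division by 0 yields 0, which is the correct value because
  \<open>T > 0\<close> there.\<close>

definition dens :: "real \<Rightarrow> real" where
  "dens x = sqrt (max 0 (- poly curve x)) / (pi * \<bar>poly Pi_poly x\<bar>)"

abbreviation "Z \<equiv> z ` {1..K}"

lemma poly_Pi_poly_eq_0_iff: "poly Pi_poly x = 0 \<longleftrightarrow> x \<in> Z"
  unfolding poly_Pi_poly by (auto simp: prod_zero_iff)

lemma curve_z: "j \<in> {1..K} \<Longrightarrow> poly curve (z j) > 0"
  unfolding curve_def by (rule poly_curve_poly_z)

lemma dens_nonneg: "dens x \<ge> 0" by (simp add: dens_def)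

lemma dens_eq_0: "poly curve x \<ge> 0 \<Longrightarrow> dens x = 0" by (simp add: dens_def)

text \<open>The zeros of the denominator are harmless: \<open>T\<close> is positive at a charge, so
  the numerator vanishes identically near it.\<close>

lemma isCont_dens: "isCont dens x"
proof (cases "x \<in> Z")
  case True
  then have "poly curve x > 0" using curve_z by auto
  moreover have "isCont (poly curve) x" by simp
  ultimately have "eventually (\<lambda>y. poly curve y > 0) (at x)"
    unfolding isCont_def by (rule order_tendstoD(1)[rotated])
  then have ev: "eventually (\<lambda>y. dens y = 0) (at x)" by eventually_elim (simp add: dens_eq_0)
  have "(dens \<longlongrightarrow> 0) (at x)" by (subst tendsto_cong[OF ev]) simp
  then show ?thesis using \<open>poly curve x > 0\<close> by (simp add: isCont_def dens_eq_0)
next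
  case False
  then have "poly Pi_poly x \<noteq> 0" by (simp add: poly_Pi_poly_eq_0_iff)
  then show ?thesis unfolding dens_def by (intro continuous_intros) auto
qed

lemma continuous_dens: "continuous_on A dens"
  using isCont_dens continuous_at_imp_continuous_on by blast

lemma measurable_dens [measurable]: "dens \<in> borel_measurable borel"
  by (intro borel_measurable_continuous_onI continuous_dens)

lemma Im_stieltjes:
  assumes "y > 0"
  shows "- Im (stieltjes (Complex x y)) = (\<integral>t. y / ((x - t)\<^sup>2 + y\<^sup>2) \<partial>M)"
    "integrable M (\<lambda>t. y / ((x - t)\<^sup>2 + y\<^sup>2))"
proof -
  have pos: "(x - t)\<^sup>2 + y\<^sup>2 \<noteq> 0" for t using assms by (simp add: add_nonneg_eq_0_iff)
  show i: "integrable M (\<lambda>t. y / ((x - t)\<^sup>2 + y\<^sup>2))"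
    by (intro integrable_continuous continuous_intros) (use pos in auto)
  have "integrable M (\<lambda>t. 1 / (Complex x y - complex_of_real t))"
    by (intro integrable_continuous continuous_intros) (use assms in \<open>auto simp: complex_eq_iff\<close>)
  then have "Im (stieltjes (Complex x y)) = (\<integral>t. - (y / ((x - t)\<^sup>2 + y\<^sup>2)) \<partial>M)"
    unfolding stieltjes_def by (subst integral_Im[symmetric]) (simp_all only: Im_inverse_diff)
  then show "- Im (stieltjes (Complex x y)) = (\<integral>t. y / ((x - t)\<^sup>2 + y\<^sup>2) \<partial>M)" by simp
qed

text \<open>The algebraic equation itself yields a bound up to the real axis:
  \<open>\<bar>Pi G\<bar>\<close> is at most \<open>sqrt \<bar>T\<bar> + \<bar>N\<bar>\<close>, and
  \<open>Pi\<close> stays away from 0 on the compact rectangle over \<open>{c..d}\<close>. This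
  provides the dominating constant for the inversion.\<close>

lemma stieltjes_bounded:
  assumes "{c..d} \<inter> Z = {}"
  obtains B where "\<And>x y. x \<in> {c..d} \<Longrightarrow> 0 < y \<Longrightarrow> y \<le> 1 \<Longrightarrow> norm (stieltjes (Complex x y)) \<le> B"
proof -
  define f where "f u = (sqrt (norm (cpoly curve (Complex (fst u) (snd u)))) + norm (cpoly residue_poly (Complex (fst u) (snd u))))
      / norm (cpoly Pi_poly (Complex (fst u) (snd u)))" for u :: "real \<times> real"
  have ne: "cpoly Pi_poly (Complex x y) \<noteq> 0" if "x \<in> {c..d}" for x y
  proof -
    have "Complex x y \<noteq> complex_of_real (z j)" if "j \<in> {1..K}" for j
      using assms \<open>x \<in> {c..d}\<close> that by (auto simp: complex_eq_iff)
    then show ?thesis by (auto simp: Pi_poly_def cpoly_prod cpoly_linear prod_zero_iff)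
  qed
  have "continuous_on ({c..d} \<times> {0..1}) f"
    unfolding f_def Complex_eq by (intro continuous_intros) (use ne in \<open>auto simp: Complex_eq\<close>)
  then have "compact (f ` ({c..d} \<times> {0..1}))"
    by (intro compact_continuous_image compact_Times) auto
  then obtain B where B: "\<And>u. u \<in> {c..d} \<times> {0..1} \<Longrightarrow> norm (f u) \<le> B"
    using compact_imp_bounded by (force simp: bounded_iff)
  have "norm (stieltjes (Complex x y)) \<le> B" if "x \<in> {c..d}" "0 < y" "y \<le> 1" for x y
  proof -
    define P G R where "P = cpoly Pi_poly (Complex x y)" "G = stieltjes (Complex x y)" "R = cpoly residue_poly (Complex x y)"
    have sq: "(P * G + R)\<^sup>2 = cpoly curve (Complex x y)"
      using complex_loop_equation[of "Complex x y"] that by (simp add: P_G_R_def)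
    have "norm (P * G) \<le> norm (P * G + R) + norm R"
      using norm_triangle_ineq4[of "P * G + R" R] by simp
    also have "norm (P * G + R) = sqrt (norm (cpoly curve (Complex x y)))"
      unfolding sq[symmetric] norm_power by simp
    finally have "norm G \<le> f (x, y)"
      using ne[of x y] that by (simp add: f_def P_G_R_def norm_mult field_simps)
    also have "\<dots> \<le> B" using B[of "(x, y)"] that by auto
    finally show ?thesis by (simp add: P_G_R_def)
  qed
  then show thesis using that by blast
qed

text \<open>The equation determines only the modulus of \<open>Im (Pi G + N)\<close>, and
  \<open>Im N\<close> tends to 0. The sign needs no branch analysis because \<open>- Im G\<close>, a
  Poisson integral, is nonnegative.\<close>

lemma Im_stieltjes_tendsto:
  assumes x: "x \<notin> Z"
  shows "(\<lambda>n. - Im (stieltjes (Complex x (1 / real (Suc n))))) \<longlonglongrightarrow> pi * dens x"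
proof -
  define \<zeta> where "\<zeta> n = Complex x (1 / real (Suc n))" for n
  note lim = tendsto_approach[of x, folded \<zeta>_def] and cp = tendsto_cpoly_approach[of _ x, folded \<zeta>_def]
  define G where "G n = stieltjes (\<zeta> n)" for n
  define H where "H n = cpoly Pi_poly (\<zeta> n) * G n + cpoly residue_poly (\<zeta> n)" for n
  have sq: "(H n)\<^sup>2 = cpoly curve (\<zeta> n)" for n
    unfolding H_def G_def by (rule complex_loop_equation) (simp add: \<zeta>_def)
  have "{x..x} \<inter> Z = {}" using x by auto
  then obtain B where B: "\<And>x' y. x' \<in> {x..x} \<Longrightarrow> 0 < y \<Longrightarrow> y \<le> 1 \<Longrightarrow> norm (stieltjes (Complex x' y)) \<le> B"
    using stieltjes_bounded by blast
  then have B: "norm (G n) \<le> B" for n by (simp add: G_def \<zeta>_def)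
  have "(\<lambda>n. (norm (cpoly curve (\<zeta> n)) - Re (cpoly curve (\<zeta> n))) / 2) \<longlonglongrightarrow> (norm (complex_of_real (poly curve x)) - Re (of_real (poly curve x))) / 2"
    by (intro tendsto_intros cp) auto
  also have "(norm (complex_of_real (poly curve x)) - Re (of_real (poly curve x))) / 2 = max 0 (- poly curve x)"
    by (simp add: max_def)
  finally have "(\<lambda>n. sqrt ((Im (H n))\<^sup>2)) \<longlonglongrightarrow> sqrt (max 0 (- poly curve x))"
    unfolding sq_Im_eq sq by (rule tendsto_real_sqrt)
  then have H: "(\<lambda>n. \<bar>Im (H n)\<bar>) \<longlonglongrightarrow> sqrt (max 0 (- poly curve x))" by simp
  \<comment> \<open>As \<open>G\<close> stays bounded, \<open>Pi\<close> may be replaced by its real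
    value at \<open>x\<close>, which then factors out of the imaginary part.\<close>
  have "(\<lambda>n. (cpoly Pi_poly (\<zeta> n) - of_real (poly Pi_poly x)) * G n) \<longlonglongrightarrow> 0"
  proof (rule Lim_null_comparison)
    show "\<forall>\<^sub>F n in sequentially. norm ((cpoly Pi_poly (\<zeta> n) - of_real (poly Pi_poly x)) * G n)
        \<le> norm (cpoly Pi_poly (\<zeta> n) - of_real (poly Pi_poly x)) * B"
      by (intro always_eventually allI) (simp add: norm_mult B mult_left_mono)
    have "(\<lambda>n. norm (cpoly Pi_poly (\<zeta> n) - of_real (poly Pi_poly x)) * B) \<longlonglongrightarrow> norm (complex_of_real (poly Pi_poly x) - of_real (poly Pi_poly x)) * B"
      by (intro tendsto_intros cp)
    then show "(\<lambda>n. norm (cpoly Pi_poly (\<zeta> n) - of_real (poly Pi_poly x)) * B) \<longlonglongrightarrow> 0" by simp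
  qed
  then have "(\<lambda>n. Im ((cpoly Pi_poly (\<zeta> n) - of_real (poly Pi_poly x)) * G n) + Im (cpoly residue_poly (\<zeta> n))) \<longlonglongrightarrow> Im 0 + Im (of_real (poly residue_poly x))"
    by (intro tendsto_add tendsto_Im cp)
  moreover have "Im ((cpoly Pi_poly (\<zeta> n) - of_real (poly Pi_poly x)) * G n) + Im (cpoly residue_poly (\<zeta> n))
      = Im (H n) - poly Pi_poly x * Im (G n)" for n
    by (simp add: H_def algebra_simps)
  ultimately have "(\<lambda>n. Im (H n) - poly Pi_poly x * Im (G n)) \<longlonglongrightarrow> 0" by simp
  then have "(\<lambda>n. \<bar>Im (H n)\<bar> - \<bar>poly Pi_poly x * Im (G n)\<bar>) \<longlonglongrightarrow> 0"
    by (rule tendsto_rabs_zero[THEN Lim_null_comparison[rotated]]) (auto intro!: always_eventually)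
  from tendsto_diff[OF H this] have "(\<lambda>n. \<bar>poly Pi_poly x * Im (G n)\<bar>) \<longlonglongrightarrow> sqrt (max 0 (- poly curve x))" by simp
  then have "(\<lambda>n. \<bar>poly Pi_poly x * Im (G n)\<bar> / \<bar>poly Pi_poly x\<bar>) \<longlonglongrightarrow> sqrt (max 0 (- poly curve x)) / \<bar>poly Pi_poly x\<bar>"
    using x by (intro tendsto_divide tendsto_const) (auto simp: poly_Pi_poly_eq_0_iff)
  moreover have "\<bar>poly Pi_poly x * Im (G n)\<bar> / \<bar>poly Pi_poly x\<bar> = - Im (G n)" for n
  proof -
    have "- Im (G n) \<ge> 0"
      unfolding G_def \<zeta>_def by (subst Im_stieltjes(1)) (auto intro!: Bochner_Integration.integral_nonneg)
    then show ?thesis using x by (auto simp: abs_mult poly_Pi_poly_eq_0_iff)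
  qed
  ultimately show ?thesis by (simp add: dens_def G_def \<zeta>_def)
qed

text \<open>The Poisson integral of \<open>M\<close> over \<open>[c, d]\<close> is a difference of arcus tangents tending to \<open>\<pi>\<close> times an indicator.\<close>
lemma emeasure_M_Icc:
  assumes cd: "c < d" "{c..d} \<inter> Z = {}"
  shows "emeasure M {c..d} = (\<integral>\<^sup>+x. ennreal (dens x) * indicator {c..d} x \<partial>lborel)"
proof -
  define y where "y n = 1 / real (Suc n)" for n
  have y: "y n > 0" "y n \<le> 1" for n by (auto simp: y_def)
  obtain B where B: "\<And>x y. x \<in> {c..d} \<Longrightarrow> 0 < y \<Longrightarrow> y \<le> 1 \<Longrightarrow> norm (stieltjes (Complex x y)) \<le> B"
    using stieltjes_bounded[OF cd(2)] by blast
  define k where "k n x t = y n / ((x - t)\<^sup>2 + (y n)\<^sup>2)" for n x t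
  have [measurable]: "(\<lambda>u. k n (fst u) (snd u)) \<in> borel_measurable (borel \<Otimes>\<^sub>M borel)" for n
    unfolding k_def by measurable
  have k_meas: "(\<lambda>t. ennreal (k n x t)) \<in> borel_measurable M" for n x
    unfolding k_def by measurable
  have k0: "k n x t \<ge> 0" for n x t using y[of n] by (simp add: k_def)
  define u where "u n x = (\<integral>\<^sup>+t. ennreal (k n x t) \<partial>M) * indicator {c..d} x" for n x
  have u_eq: "u n x = ennreal (- Im (stieltjes (Complex x (y n)))) * indicator {c..d} x" for n x
    unfolding u_def k_def Im_stieltjes(1)[OF y(1)]
    by (subst nn_integral_eq_integral[OF Im_stieltjes(2)[OF y(1)]]) (auto intro!: divide_nonneg_nonneg less_imp_le[OF y(1)])
  interpret lM: pair_sigma_finite lborel M by unfold_locales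
  have u_int: "(\<integral>\<^sup>+x. u n x \<partial>lborel) = (\<integral>\<^sup>+t. ennreal (arctan ((d - t) / y n) - arctan ((c - t) / y n)) \<partial>M)" for n
  proof -
    have "(\<integral>\<^sup>+x. u n x \<partial>lborel) = (\<integral>\<^sup>+x. \<integral>\<^sup>+t. ennreal (k n x t) * indicator {c..d} x \<partial>M \<partial>lborel)"
      unfolding u_def by (subst nn_integral_multc) (auto simp: k_meas)
    also have "\<dots> = (\<integral>\<^sup>+t. \<integral>\<^sup>+x. ennreal (k n x t) * indicator {c..d} x \<partial>lborel \<partial>M)"
      by (rule lM.Fubini'[symmetric]) (simp add: case_prod_beta')
    also have "\<dots> = (\<integral>\<^sup>+t. ennreal (arctan ((d - t) / y n) - arctan ((c - t) / y n)) \<partial>M)"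
    proof (rule nn_integral_cong)
      fix t
      show "(\<integral>\<^sup>+x. ennreal (k n x t) * indicator {c..d} x \<partial>lborel) = ennreal (arctan ((d - t) / y n) - arctan ((c - t) / y n))"
      proof (rule nn_integral_FTC_Icc)
        fix x
        have "((\<lambda>x. arctan ((x - t) / y n)) has_real_derivative (1 / (1 + ((x - t) / y n)\<^sup>2)) * (1 / y n)) (at x)"
          using y[of n] by (auto intro!: derivative_eq_intros simp: divide_simps)
        also have "(1 / (1 + ((x - t) / y n)\<^sup>2)) * (1 / y n) = k n x t"
          using y[of n] by (simp add: k_def power_divide divide_simps) (simp add: power2_eq_square algebra_simps)
        finally show "((\<lambda>x. arctan ((x - t) / y n)) has_real_derivative k n x t) (at x)" .
      qed (use cd k0 in \<open>auto simp: k_def\<close>)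
    qed
    finally show ?thesis .
  qed
  \<comment> \<open>The same sequence of integrals is evaluated twice: here through the boundary
    values of \<open>G\<close>, below through Fubini and the arcus tangents.\<close>
  have "(\<lambda>n. \<integral>\<^sup>+x. u n x \<partial>lborel) \<longlonglongrightarrow> (\<integral>\<^sup>+x. ennreal (pi * dens x) * indicator {c..d} x \<partial>lborel)"
  proof (rule nn_integral_dominated_convergence[where w = "\<lambda>x. ennreal B * indicator {c..d} x"])
    show "AE x in lborel. u j x \<le> ennreal B * indicator {c..d} x" for j
    proof (intro AE_I2)
      fix x show "u j x \<le> ennreal B * indicator {c..d} x"
        unfolding u_eq using B[OF _ y, of x j] abs_Im_le_cmod[of "stieltjes (Complex x (y j))"]
        by (auto simp: indicator_def intro!: ennreal_leI)
    qed
    show "(\<integral>\<^sup>+x. ennreal B * indicator {c..d} x \<partial>lborel) < \<infinity>"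
      using cd by (simp add: nn_integral_cmult ennreal_mult_less_top)
    show "AE x in lborel. (\<lambda>i. u i x) \<longlonglongrightarrow> ennreal (pi * dens x) * indicator {c..d} x"
    proof (intro AE_I2)
      fix x
      show "(\<lambda>i. u i x) \<longlonglongrightarrow> ennreal (pi * dens x) * indicator {c..d} x"
      proof (cases "x \<in> {c..d}")
        case True
        then have "x \<notin> Z" using cd by auto
        then show ?thesis unfolding u_eq y_def using True tendsto_ennrealI[OF Im_stieltjes_tendsto] by simp
      qed (simp add: u_eq)
    qed
    show "u i \<in> borel_measurable lborel" for i unfolding u_def by measurable
  qed auto
  moreover have "(\<lambda>n. \<integral>\<^sup>+x. u n x \<partial>lborel) \<longlonglongrightarrow> (\<integral>\<^sup>+t. ennreal pi * indicator {c..d} t \<partial>M)"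
    unfolding u_int
  proof (rule nn_integral_dominated_convergence[where w = "\<lambda>x. ennreal pi"])
    show "AE t in M. ennreal (arctan ((d - t) / y j) - arctan ((c - t) / y j)) \<le> ennreal pi" for j
    proof (intro AE_I2 ennreal_leI)
      fix t show "arctan ((d - t) / y j) - arctan ((c - t) / y j) \<le> pi"
        using arctan_bounded[of "(d - t) / y j"] arctan_bounded[of "(c - t) / y j"] by auto
    qed
    \<comment> \<open>At an end point the arcus tangents would give only half of \<open>pi\<close>;
      absence of atoms removes this case.\<close>
    have "AE t in M. t \<notin> {c}" "AE t in M. t \<notin> {d}"
      by (rule AE_not_in, simp add: null_sets_def no_atoms sets_M)+
    then show "AE t in M. (\<lambda>i. ennreal (arctan ((d - t) / y i) - arctan ((c - t) / y i))) \<longlonglongrightarrow> ennreal pi * indicator {c..d} t"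
    proof eventually_elim
      case (elim t)
      consider "t < c" | "c < t" "t < d" | "d < t" using elim by fastforce
      then have "(\<lambda>i. arctan ((d - t) * real (Suc i)) - arctan ((c - t) * real (Suc i))) \<longlonglongrightarrow> pi * indicator {c..d} t"
      proof cases
        case 1
        then show ?thesis using cd tendsto_diff[OF tendsto_arctan_div_pos[of "d - t"] tendsto_arctan_div_pos[of "c - t"]]
          by simp
      next
        case 2
        then show ?thesis using cd tendsto_diff[OF tendsto_arctan_div_pos[of "d - t"] tendsto_arctan_div_neg[of "c - t"]]
          by simp
      next
        case 3
        then show ?thesis using cd tendsto_diff[OF tendsto_arctan_div_neg[of "d - t"] tendsto_arctan_div_neg[of "c - t"]]
          by simp
      qed
      from tendsto_ennrealI[OF this] show ?case
        by (auto simp: y_def indicator_def)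
    qed
  qed auto
  ultimately have "(\<integral>\<^sup>+x. ennreal (pi * dens x) * indicator {c..d} x \<partial>lborel) = (\<integral>\<^sup>+t. ennreal pi * indicator {c..d} t \<partial>M)"
    by (rule LIMSEQ_unique)
  also have "\<dots> = ennreal pi * emeasure M {c..d}" by (subst nn_integral_cmult) auto
  also have "(\<integral>\<^sup>+x. ennreal (pi * dens x) * indicator {c..d} x \<partial>lborel)
      = ennreal pi * (\<integral>\<^sup>+x. ennreal (dens x) * indicator {c..d} x \<partial>lborel)"
    by (subst nn_integral_cmult[symmetric]) (auto simp: ennreal_mult' dens_nonneg mult.assoc)
  finally show ?thesis by (simp add: ennreal_mult_cancel_left)
qed

text \<open>Off the finite set \<open>Z\<close> the distribution function has derivative
  \<open>dens\<close> by \<open>emeasure_M_Icc\<close>. It is continuous since \<open>M\<close> has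
  no atoms, and the strong fundamental theorem of calculus tolerates the missing derivatives on
  \<open>Z\<close>, so no mass hides at the charges.\<close>

lemma has_integral_dens:
  assumes "c \<le> d"
  shows "(dens has_integral measure M {c..d}) {c..d}"
proof -
  interpret F: finite_borel_measure M by unfold_locales (auto simp: sets_M)
  have diff: "cdf M d' - cdf M c' = measure M {c'..d'}" if "c' \<le> d'" for c' d'
  proof -
    have "measure M {c'} = 0" using no_atoms by (simp add: measure_def)
    then have "measure M {c'..d'} = measure M {c'<..d'}"
      using that no_atoms[of c']
      by (cases "c' = d'") (auto intro!: measure_eq_AE AE_I[where N = "{c'}"] simp: sets_M)
    then show ?thesis using F.cdf_diff_eq[of c' d'] that by (cases "c' = d'") auto
  qed
  have "(dens has_integral (cdf M d - cdf M c)) {c..d}"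
  proof (rule fundamental_theorem_of_calculus_strong)
    show "finite Z" by simp
    show "continuous_on {c..d} (cdf M)"
      using F.isCont_cdf no_atoms by (intro continuous_at_imp_continuous_on) (auto simp: measure_def)
    fix x assume "x \<in> {c..d} - Z"
    then have "x \<in> - Z" "open (- Z)" by (auto intro!: finite_imp_closed simp: open_Compl)
    then obtain e where e: "e > 0" "cball x e \<subseteq> - Z" using open_contains_cball by blast
    define l where "l = x - e" define r where "r = x + e"
    have lr: "x \<in> {l<..<r}" "{l..r} \<inter> Z = {}"
      using e by (auto simp only: l_def r_def cball_eq_atLeastAtMost) auto
    have eq: "cdf M l + integral {l..t} dens = cdf M t" if "t \<in> {l<..<r}" for t
    proof -
      have "{l..t} \<subseteq> {l..r}" using that by auto
      then have "{l..t} \<inter> Z = {}" using lr(2) by blast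
      then have "emeasure M {l..t} = (\<integral>\<^sup>+x. ennreal (dens x) * indicator {l..t} x \<partial>lborel)"
        using that by (intro emeasure_M_Icc) auto
      then have "emeasure M {l..t} = (\<integral>\<^sup>+x. ennreal (dens x * indicator {l..t} x) \<partial>lborel)"
        by (simp add: ennreal_mult' dens_nonneg flip: ennreal_indicator)
      moreover have "((\<lambda>x. dens x * indicator {l..t} x) has_integral integral {l..t} dens) UNIV"
        unfolding has_integral_mult_indicator
        by (intro integrable_integral integrable_continuous_real continuous_dens)
      ultimately have "emeasure M {l..t} = ennreal (integral {l..t} dens)"
        by (subst (asm) nn_integral_has_integral_lborel) (auto simp: dens_nonneg)
      moreover have "0 \<le> integral {l..t} dens"
        by (intro Henstock_Kurzweil_Integration.integral_nonneg integrable_continuous_real continuous_dens dens_nonneg)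
      ultimately have "measure M {l..t} = integral {l..t} dens" by (simp add: measure_def)
      then show ?thesis using diff[of l t] that by auto
    qed
    have "((\<lambda>t. integral {l..t} dens) has_real_derivative dens x) (at x within {l..r})"
      using lr by (intro integral_has_real_derivative continuous_dens) auto
    then have "((\<lambda>t. cdf M l + integral {l..t} dens) has_real_derivative 0 + dens x) (at x within {l..r})"
      by (intro DERIV_add DERIV_const)
    then have "((\<lambda>t. cdf M l + integral {l..t} dens) has_real_derivative 0 + dens x) (at x within {l<..<r})"
      by (rule DERIV_subset) auto
    then have "((\<lambda>t. cdf M l + integral {l..t} dens) has_real_derivative dens x) (at x)"
      using lr by (subst (asm) at_within_open) auto
    then have "(cdf M has_real_derivative dens x) (at x)"
      by (rule has_field_derivative_transform_within_open[where S = "{l<..<r}"]) (use lr eq in auto)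
    then show "(cdf M has_vector_derivative dens x) (at x)"
      by (simp add: has_real_derivative_iff_has_vector_derivative)
  qed fact
  then show ?thesis using diff[OF assms] by simp
qed

lemma M_eq_density: "M = density lborel (\<lambda>x. ennreal (dens x))"
proof (rule measure_eqI_generator_eq[where E = "range (\<lambda>(a, b). {a..b::real})" and \<Omega> = UNIV
      and A = "\<lambda>n. {- real n..real n}"])
  show "Int_stable (range (\<lambda>(a, b). {a..b::real}))"
    by (auto simp: Int_stable_def)
  show "sets M = sigma_sets UNIV (range (\<lambda>(a, b). {a..b::real}))"
    "sets (density lborel (\<lambda>x. ennreal (dens x))) = sigma_sets UNIV (range (\<lambda>(a, b). {a..b::real}))"
    by (simp_all add: sets_M borel_eq_atLeastAtMost)
  show "range (\<lambda>n. {- real n..real n}) \<subseteq> range (\<lambda>(a, b). {a..b::real})" by auto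
  show "(\<Union>n. {- real n..real n}) = UNIV"
  proof (intro set_eqI iffI UNIV_I)
    fix x :: real
    obtain n where "\<bar>x\<bar> \<le> real n" using real_arch_simple by blast
    then show "x \<in> (\<Union>n. {- real n..real n})" by (auto simp: abs_le_iff intro!: exI[of _ n])
  qed
  fix X :: "real set" assume "X \<in> range (\<lambda>(a, b). {a..b::real})"
  then obtain c d where X: "X = {c..d}" by auto
  show "emeasure M X = emeasure (density lborel (\<lambda>x. ennreal (dens x))) X"
  proof (cases "c \<le> d")
    case True
    have "((\<lambda>x. dens x * indicator {c..d} x) has_integral measure M {c..d}) UNIV"
      unfolding has_integral_mult_indicator by (rule has_integral_dens[OF True])
    then have "(\<integral>\<^sup>+x. ennreal (dens x * indicator {c..d} x) \<partial>lborel) = ennreal (measure M {c..d})"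
      by (intro nn_integral_has_integral_lborel) (auto simp: dens_nonneg)
    then show ?thesis
      by (simp add: X emeasure_density emeasure_eq_measure ennreal_mult' dens_nonneg flip: ennreal_indicator)
  qed (simp add: X)
qed auto

end

section \<open>The roots of the curve polynomial\<close>

lemma sgn_prod_diff:
  fixes x :: real
  assumes "finite I" "\<And>i. i \<in> I \<Longrightarrow> x \<noteq> c i"
  shows "sgn (\<Prod>i\<in>I. x - c i) = (-1) ^ card {i\<in>I. x < c i}"
  using assms
proof (induction I rule: finite_induct)
  case (insert j I)
  have "{i\<in>insert j I. x < c i} = (if x < c j then insert j {i\<in>I. x < c i} else {i\<in>I. x < c i})"
    by auto
  moreover have "sgn (x - c j) = (if x < c j then -1 else 1)" using insert.prems[of j] by auto
  ultimately show ?case using insert by (simp add: sgn_mult)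
qed simp

lemma eq_sgn_mult_abs_of_power2_eq:
  fixes a b :: real
  assumes "a\<^sup>2 = b" "sgn a = s"
  shows "a = s * sqrt b"
  using assms by (auto simp: mult.commute[of "sgn a"] abs_mult_sgn)

context minimizer
begin

definition rstieltjes :: "real \<Rightarrow> real" where "rstieltjes x = (\<integral>t. 1 / (x - t) \<partial>M)"

lemma AE_dens_pos: "AE t in M. dens t > 0"
  by (subst M_eq_density, subst AE_density) (auto intro!: AE_I2)

text \<open>Where \<open>T > 0\<close> the density vanishes, so near such a point integrals against
  \<open>M\<close> have no singularity. This \<delta> supplies the domination in all limits on the
  gaps.\<close>

lemma gap_exists:
  assumes "poly curve x > 0"
  obtains \<delta> where "\<delta> > 0" "\<And>y. \<bar>y - x\<bar> < \<delta> \<Longrightarrow> poly curve y > 0" "AE t in M. \<delta> \<le> \<bar>x - t\<bar>"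
proof -
  have "open {y. poly curve y > 0}" by (intro open_Collect_less continuous_intros)
  then obtain \<delta> where \<delta>: "\<delta> > 0" "ball x \<delta> \<subseteq> {y. poly curve y > 0}"
    using assms unfolding open_contains_ball by blast
  then have pos: "poly curve y > 0" if "\<bar>y - x\<bar> < \<delta>" for y
    using that by (auto simp: subset_iff ball_def dist_real_def abs_minus_commute)
  have "AE t in M. \<delta> \<le> \<bar>x - t\<bar>"
    using AE_dens_pos
    by eventually_elim (use pos in \<open>force simp: dens_def abs_minus_commute not_less[symmetric]\<close>)
  then show thesis using that \<delta>(1) pos by blast
qed

lemma integrable_inverse_diff:
  assumes "\<delta> > 0" "AE t in M. \<delta> \<le> \<bar>x - t\<bar>"
  shows "integrable M (\<lambda>t. 1 / (x - t))"
proof (rule integrable_const_bound[where B = "1 / \<delta>"])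
  show "AE t in M. norm (1 / (x - t)) \<le> 1 / \<delta>"
    using assms(2) by eventually_elim (use assms(1) in \<open>auto simp: divide_simps\<close>)
qed measurable

lemma isCont_rstieltjes:
  assumes "poly curve x > 0"
  shows "isCont rstieltjes x"
proof -
  obtain \<delta> where \<delta>: "\<delta> > 0" "AE t in M. \<delta> \<le> \<bar>x - t\<bar>" using gap_exists[OF assms] by blast
  have "\<bar>rstieltjes (x + s) - rstieltjes x\<bar> \<le> \<bar>s\<bar> * (2 / \<delta>\<^sup>2)" if s: "\<bar>s\<bar> < \<delta> / 2" for s
  proof -
    have ae: "AE t in M. \<delta> / 2 \<le> \<bar>x + s - t\<bar>"
      using \<delta>(2)
    proof eventually_elim
      case (elim t)
      then show ?case using s abs_triangle_ineq4[of "x + s - t" s] by simp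
    qed
    have i: "integrable M (\<lambda>t. 1 / (x + s - t))" "integrable M (\<lambda>t. 1 / (x - t))"
      using integrable_inverse_diff[OF _ ae] integrable_inverse_diff[OF \<delta>] \<delta>(1) by auto
    have "\<bar>rstieltjes (x + s) - rstieltjes x\<bar> = \<bar>\<integral>t. 1 / (x + s - t) - 1 / (x - t) \<partial>M\<bar>"
      unfolding rstieltjes_def using i by simp
    also have "\<dots> \<le> (\<integral>t. \<bar>1 / (x + s - t) - 1 / (x - t)\<bar> \<partial>M)" by (rule integral_abs_bound)
    also have "\<dots> \<le> (\<integral>t. \<bar>s\<bar> * (2 / \<delta>\<^sup>2) \<partial>M)"
    proof (rule integral_mono_AE)
      show "AE t in M. \<bar>1 / (x + s - t) - 1 / (x - t)\<bar> \<le> \<bar>s\<bar> * (2 / \<delta>\<^sup>2)"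
        using \<delta>(2) ae
      proof eventually_elim
        case (elim t)
        then have ne: "x - t \<noteq> 0" "x + s - t \<noteq> 0" using \<delta>(1) by auto
        have "1 / (x + s - t) - 1 / (x - t) = - s * (1 / ((x + s - t) * (x - t)))"
          using ne by (simp add: field_simps)
        then have "\<bar>1 / (x + s - t) - 1 / (x - t)\<bar> = \<bar>s\<bar> * (1 / (\<bar>x + s - t\<bar> * \<bar>x - t\<bar>))"
          by (simp add: abs_mult)
        also have "\<dots> \<le> \<bar>s\<bar> * (1 / ((\<delta> / 2) * \<delta>))"
          using elim \<delta>(1) by (intro mult_left_mono divide_left_mono mult_mono mult_pos_pos) auto
        finally show ?case by (simp add: power2_eq_square)
      qed
    qed (use i in auto)
    finally show ?thesis by simp
  qed
  then have "\<forall>\<^sub>F s in at 0. norm (rstieltjes (x + s) - rstieltjes x) \<le> \<bar>s\<bar> * (2 / \<delta>\<^sup>2)"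
    using \<delta>(1) by (auto simp: eventually_at intro!: exI[of _ "\<delta> / 2"])
  moreover have "((\<lambda>s::real. \<bar>s\<bar> * (2 / \<delta>\<^sup>2)) \<longlongrightarrow> \<bar>0\<bar> * (2 / \<delta>\<^sup>2)) (at 0)" by (intro tendsto_intros)
  then have "((\<lambda>s::real. \<bar>s\<bar> * (2 / \<delta>\<^sup>2)) \<longlongrightarrow> 0) (at 0)" by simp
  ultimately have "((\<lambda>s. rstieltjes (x + s) - rstieltjes x) \<longlongrightarrow> 0) (at 0)"
    by (rule Lim_null_comparison)
  then show ?thesis by (simp add: isCont_iff LIM_zero_iff)
qed

text \<open>\<open>Pi G + N\<close> on the real line, meaningful where \<open>T > 0\<close>. There
  it is a continuous choice of the square root of \<open>T\<close>, and at a charge it reduces to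
  \<open>N\<close>.\<close>

definition resolvent :: "real \<Rightarrow> real" where
  "resolvent x = poly Pi_poly x * rstieltjes x + poly residue_poly x"

lemma isCont_resolvent: "poly curve x > 0 \<Longrightarrow> isCont resolvent x"
  unfolding resolvent_def by (intro continuous_intros isCont_rstieltjes)

lemma resolvent_z: "j \<in> {1..K} \<Longrightarrow> resolvent (z j) = poly residue_poly (z j)"
  using poly_Pi_poly_eq_0_iff[of "z j"] by (auto simp: resolvent_def)

text \<open>The complex equation passes to the limit from the upper half plane, since
  \<open>1 / \<delta>\<close> dominates the integrands of \<open>G\<close>.\<close>

lemma resolvent_sq:
  assumes "poly curve x > 0"
  shows "(resolvent x)\<^sup>2 = poly curve x"
proof -
  obtain \<delta> where \<delta>: "\<delta> > 0" "AE t in M. \<delta> \<le> \<bar>x - t\<bar>" using gap_exists[OF assms] by blast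
  define \<zeta> where "\<zeta> n = Complex x (1 / real (Suc n))" for n
  note lim = tendsto_approach[of x, folded \<zeta>_def] and cp = tendsto_cpoly_approach[of _ x, folded \<zeta>_def]
  have "(\<lambda>n. stieltjes (\<zeta> n)) \<longlonglongrightarrow> (\<integral>t. complex_of_real (1 / (x - t)) \<partial>M)"
    unfolding stieltjes_def
  proof (rule integral_dominated_convergence[where w = "\<lambda>t. 1 / \<delta>"])
    show "AE t in M. (\<lambda>n. 1 / (\<zeta> n - complex_of_real t)) \<longlonglongrightarrow> complex_of_real (1 / (x - t))"
      using \<delta>(2)
    proof eventually_elim
      case (elim t)
      have "(\<lambda>n. 1 / (\<zeta> n - complex_of_real t)) \<longlonglongrightarrow> 1 / (of_real x - of_real t)"
        using elim \<delta>(1) by (intro tendsto_intros lim) auto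
      then show ?case by simp
    qed
    show "AE t in M. norm (1 / (\<zeta> n - complex_of_real t)) \<le> 1 / \<delta>" for n
      using \<delta>(2)
    proof eventually_elim
      case (elim t)
      have "\<delta> \<le> norm (\<zeta> n - complex_of_real t)"
        using abs_Re_le_cmod[of "\<zeta> n - complex_of_real t"] elim by (simp add: \<zeta>_def)
      then show ?case using \<delta>(1) by (simp add: norm_divide divide_simps)
    qed
  qed auto
  then have "(\<lambda>n. stieltjes (\<zeta> n)) \<longlonglongrightarrow> of_real (rstieltjes x)"
    unfolding rstieltjes_def integral_complex_of_real .
  then have "(\<lambda>n. (cpoly Pi_poly (\<zeta> n) * stieltjes (\<zeta> n) + cpoly residue_poly (\<zeta> n))\<^sup>2) \<longlonglongrightarrow>
      (of_real (poly Pi_poly x) * of_real (rstieltjes x) + of_real (poly residue_poly x))\<^sup>2"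
    by (intro tendsto_intros cp)
  then have "(\<lambda>n. cpoly curve (\<zeta> n)) \<longlonglongrightarrow> of_real ((resolvent x)\<^sup>2)"
    by (subst (asm) complex_loop_equation) (simp_all add: \<zeta>_def resolvent_def)
  from LIMSEQ_unique[OF this cp] have "complex_of_real ((resolvent x)\<^sup>2) = of_real (poly curve x)" .
  then show ?thesis by (simp only: of_real_eq_iff)
qed

lemma sgn_residue_poly:
  assumes j: "j \<in> {1..K}"
  shows "sgn (poly residue_poly (z j)) = (-1) ^ (K - j)"
proof -
  have "sgn (\<Prod>m\<in>{1..K} - {j}. z j - z m) = (-1) ^ card {m \<in> {1..K} - {j}. z j < z m}"
    using inj_onD[OF z_inj] j by (intro sgn_prod_diff) auto
  also have "{m \<in> {1..K} - {j}. z j < z m} = {j<..K}"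
  proof (intro set_eqI iffI)
    fix m assume "m \<in> {m \<in> {1..K} - {j}. z j < z m}"
    then show "m \<in> {j<..K}" using z_mono[of m j] j by (cases "m \<le> j") auto
  qed (use z_less[of j] j in auto)
  finally show ?thesis unfolding poly_residue_poly_z[OF j] using ppos[OF j] by (simp add: sgn_mult)
qed

text \<open>
  Without a root, \<open>M\<close> has no mass near \<open>[z\<^sub>i, z\<^bsub>i+1\<^esub>]\<close>, so \<open>\<Pi> G + N\<close> is continuous and real there, with square
  \<open>T > 0\<close> but values of opposite sign at the two ends.
\<close>
lemma curve_root_exists:
  assumes i: "i \<in> {1..<K}"
  shows "\<exists>x. z i < x \<and> x < z (Suc i) \<and> poly curve x = 0"
proof (rule ccontr)
  assume neg: "\<not> ?thesis"
  have j: "i \<in> {1..K}" "Suc i \<in> {1..K}" using i by auto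
  have lt: "z i < z (Suc i)" using zinc[OF i] .
  have pos: "poly curve x > 0" if "x \<in> {z i..z (Suc i)}" for x
  proof (rule ccontr)
    assume "\<not> poly curve x > 0"
    moreover have "x \<noteq> z i" "x \<noteq> z (Suc i)" using curve_z j calculation by auto
    moreover have "poly curve x \<noteq> 0" using neg that calculation by (auto simp: less_le)
    ultimately have "poly curve x < 0" "z i < x" using that by auto
    with poly_IVT_neg[of "z i" x curve] curve_z[OF j(1)]
    obtain y where "z i < y" "y < x" "poly curve y = 0" by auto
    then show False using neg that by auto
  qed
  have "continuous_on {z i..z (Suc i)} (\<lambda>x. resolvent x * (-1) ^ (K - i))"
    using pos isCont_resolvent
    by (intro continuous_intros continuous_at_imp_continuous_on) auto
  moreover have "resolvent (z i) * (-1) ^ (K - i) > 0"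
    using sgn_residue_poly[OF j(1)] unfolding resolvent_z[OF j(1)]
    by (metis minus_one_power_iff mult.right_neutral mult_minus1_right neg_0_less_iff_less sgn_1_neg sgn_1_pos)
  moreover have "resolvent (z (Suc i)) * (-1) ^ (K - i) < 0"
  proof -
    have "K - i = Suc (K - Suc i)" using i by auto
    then have "(-1) ^ (K - i) = - ((-1) ^ (K - Suc i) :: real)" by simp
    moreover have "poly residue_poly (z (Suc i)) * (-1) ^ (K - Suc i) > 0"
      using sgn_residue_poly[OF j(2)]
      by (metis minus_one_power_iff mult.right_neutral mult_minus1_right neg_0_less_iff_less sgn_1_neg sgn_1_pos)
    ultimately show ?thesis unfolding resolvent_z[OF j(2)] by simp
  qed
  ultimately obtain x where "x \<in> {z i..z (Suc i)}" "resolvent x * (-1) ^ (K - i) = 0"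
    using IVT2'[of "\<lambda>x. resolvent x * (-1) ^ (K - i)" "z (Suc i)" 0 "z i"] lt by auto
  then show False using resolvent_sq[OF pos] pos by force
qed

text \<open>\<open>T\<close> is positive at both ends, while the linear factor of a first root
  changes sign in between; hence the cofactor changes sign and has a root too, possibly the same
  one.\<close>

lemma curve_root_pair_exists:
  assumes i: "i \<in> {1..<K}"
  shows "\<exists>\<alpha> \<beta>. z i < \<alpha> \<and> \<alpha> \<le> \<beta> \<and> \<beta> < z (Suc i) \<and> [:- \<alpha>, 1:] * [:- \<beta>, 1:] dvd curve"
proof -
  have j: "i \<in> {1..K}" "Suc i \<in> {1..K}" using i by auto
  obtain x where x: "z i < x" "x < z (Suc i)" "poly curve x = 0" using curve_root_exists[OF i] by blast
  then obtain S where S: "curve = [:- x, 1:] * S" by (auto simp: poly_eq_0_iff_dvd elim: dvdE)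
  have "(z i - x) * poly S (z i) > 0" "(z (Suc i) - x) * poly S (z (Suc i)) > 0"
    using curve_z[OF j(1)] curve_z[OF j(2)] unfolding S by (simp_all add: algebra_simps)
  then have "poly S (z i) < 0" "poly S (z (Suc i)) > 0"
    using x by (auto simp: zero_less_mult_iff)
  then obtain y where y: "z i < y" "y < z (Suc i)" "poly S y = 0"
    using poly_IVT_pos[of "z i" "z (Suc i)" S] x by auto
  then obtain V where V: "S = [:- y, 1:] * V" by (auto simp: poly_eq_0_iff_dvd elim: dvdE)
  have "[:- x, 1:] * [:- y, 1:] dvd curve" "[:- y, 1:] * [:- x, 1:] dvd curve"
    unfolding S V by (metis dvd_triv_left mult.assoc mult.commute)+
  then show ?thesis
    using x y by (cases "x \<le> y") (rule exI[of _ x], rule exI[of _ y], simp, rule exI[of _ y], rule exI[of _ x], simp)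
qed

text \<open>Pairs from different gaps are separated by a charge, so their product divides
  \<open>T\<close>. Its degree is already \<open>2 * K - 2\<close>, which leaves only the leading
  coefficient.\<close>

lemma curve_factor:
  assumes \<alpha>\<beta>: "\<And>i. i \<in> {1..<K} \<Longrightarrow> z i < \<alpha> i \<and> \<alpha> i \<le> \<beta> i \<and> \<beta> i < z (Suc i) \<and> [:- \<alpha> i, 1:] * [:- \<beta> i, 1:] dvd curve"
  shows "curve = smult ((1 + ptot)\<^sup>2) (\<Prod>i=1..<K. [:- \<alpha> i, 1:] * [:- \<beta> i, 1:])"
proof -
  define q where "q i = [:- \<alpha> i, 1:] * [:- \<beta> i, 1:]" for i
  have sep: "\<beta> i < \<alpha> j" if "i \<in> {1..<K}" "j \<in> {1..<K}" "i < j" for i j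
  proof -
    have "\<beta> i < z (Suc i)" "z (Suc i) \<le> z j" "z j < \<alpha> j"
      using \<alpha>\<beta>[OF that(1)] \<alpha>\<beta>[OF that(2)] z_mono[of "Suc i" j] that by auto
    then show ?thesis by linarith
  qed
  have "\<exists>S. curve = (\<Prod>i\<in>I. q i) * S" if "finite I" "I \<subseteq> {1..<K}" for I
    using that
  proof (induction I rule: finite_induct)
    case (insert j I)
    then obtain S where S: "curve = (\<Prod>i\<in>I. q i) * S" by auto
    obtain V where V: "curve = q j * V" using \<alpha>\<beta>[of j] insert.prems by (auto simp: q_def elim: dvdE)
    have ne: "poly (\<Prod>i\<in>I. q i) x \<noteq> 0" if "x = \<alpha> j \<or> x = \<beta> j" for x
    proof -
      have "poly (q i) x \<noteq> 0" if i: "i \<in> I" for i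
      proof -
        have i': "i \<in> {1..<K}" "j \<in> {1..<K}" "i \<noteq> j" using i insert by auto
        then consider "i < j" | "j < i" by linarith
        then have "x \<noteq> \<alpha> i \<and> x \<noteq> \<beta> i"
          by cases (use sep[of i j] sep[of j i] i' \<alpha>\<beta>[of i] \<alpha>\<beta>[of j] \<open>x = \<alpha> j \<or> x = \<beta> j\<close> in force)+
        then show ?thesis by (simp add: q_def del: mult_pCons_left mult_pCons_right)
      qed
      then show ?thesis using insert.hyps by (simp add: poly_prod prod_zero_iff)
    qed
    have "poly curve (\<alpha> j) = 0" unfolding V by (simp add: q_def del: mult_pCons_left mult_pCons_right)
    then have "poly S (\<alpha> j) = 0" unfolding S using ne by simp
    then obtain S1 where S1: "S = [:- \<alpha> j, 1:] * S1" by (auto simp: poly_eq_0_iff_dvd elim: dvdE)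
    \<comment> \<open>The two factors are split off one after the other:
      \<open>\<alpha> j = \<beta> j\<close> may be a double root, and only after cancelling the
      first factor does evaluation at \<open>\<beta> j\<close> give information.\<close>
    have "[:- \<alpha> j, 1:] * ((\<Prod>i\<in>I. q i) * S1) = [:- \<alpha> j, 1:] * ([:- \<beta> j, 1:] * V)"
      using S V unfolding S1 q_def[of j] by (metis mult.assoc mult.left_commute)
    then have "(\<Prod>i\<in>I. q i) * S1 = [:- \<beta> j, 1:] * V" by (subst (asm) mult_left_cancel) auto
    then have "poly ((\<Prod>i\<in>I. q i) * S1) (\<beta> j) = 0" by (simp del: mult_pCons_left mult_pCons_right)
    then have "poly S1 (\<beta> j) = 0" using ne by simp
    then obtain S2 where S2: "S1 = [:- \<beta> j, 1:] * S2" by (auto simp: poly_eq_0_iff_dvd elim: dvdE)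
    have "curve = (\<Prod>i\<in>insert j I. q i) * S2"
      unfolding S S1 S2 using insert.hyps by (simp add: q_def mult_ac del: mult_pCons_left mult_pCons_right)
    then show ?case by blast
  qed (auto intro: exI[of _ curve])
  then obtain S where S: "curve = (\<Prod>i=1..<K. q i) * S" by blast
  have deg: "degree curve = 2 * K - 2" "lead_coeff curve = (1 + ptot)\<^sup>2"
    unfolding curve_def using degree_curve_poly[of mom, OF mom_0] by auto
  have q0: "q i \<noteq> 0" and lq: "lead_coeff (q i) = 1" and dq: "degree (q i) = 2" for i
    by (simp_all add: q_def)
  have "degree (\<Prod>i=1..<K. q i) = 2 * K - 2"
    by (subst degree_prod_eq_sum_degree) (use q0 dq in \<open>auto simp: algebra_simps\<close>)
  moreover have P0: "(\<Prod>i=1..<K. q i) \<noteq> 0" using q0 by (simp add: prod_zero_iff)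
  moreover have "S \<noteq> 0" using S deg(2) ptot_pos by auto
  ultimately have "degree S = 0" using deg(1) unfolding S by (subst (asm) degree_mult_eq) auto
  then obtain s where s: "S = [:s:]" by (rule degree_eq_zeroE)
  have "lead_coeff curve = lead_coeff (\<Prod>i=1..<K. q i) * lead_coeff S" unfolding S by (rule lead_coeff_mult)
  also have "lead_coeff (\<Prod>i=1..<K. q i) = 1" using lq by (simp add: lead_coeff_prod)
  finally have "s = (1 + ptot)\<^sup>2" using deg s by simp
  then show ?thesis using S s by (simp add: q_def)
qed

end

section \<open>Segments around the charges and bands between the paired roots\<close>

locale minimizer_roots = minimizer +
  fixes \<alpha> \<beta> :: "nat \<Rightarrow> real"
  assumes roots: "\<And>i. i \<in> {1..<K} \<Longrightarrow> z i < \<alpha> i \<and> \<alpha> i \<le> \<beta> i \<and> \<beta> i < z (Suc i) \<and> [:- \<alpha> i, 1:] * [:- \<beta> i, 1:] dvd curve"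
begin

lemma poly_curve: "poly curve x = (1 + ptot)\<^sup>2 * (\<Prod>i=1..<K. (x - \<alpha> i) * (x - \<beta> i))"
  by (subst curve_factor[OF roots]) (simp_all add: poly_prod algebra_simps)

lemma roots_sep:
  assumes "i \<in> {1..<K}" "j \<in> {1..<K}" "i < j" shows "\<beta> i < \<alpha> j"
proof -
  have "\<beta> i < z (Suc i)" "z (Suc i) \<le> z j" "z j < \<alpha> j"
    using roots[OF assms(1)] roots[OF assms(2)] z_mono[of "Suc i" j] assms by auto
  then show ?thesis by linarith
qed

text \<open>\<open>seg j\<close> is the component of the complement of all \<open>[\<alpha> i, \<beta> i]\<close> that contains \<open>z j\<close>.\<close>
definition seg :: "nat \<Rightarrow> real set" where
  "seg j = {x. (\<forall>i\<in>{1..<K}. i < j \<longrightarrow> \<beta> i < x) \<and> (\<forall>i\<in>{1..<K}. j \<le> i \<longrightarrow> x < \<alpha> i)}"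

lemma z_in_seg: assumes "j \<in> {1..K}" shows "z j \<in> seg j"
proof -
  have "\<beta> i < z j" if "i \<in> {1..<K}" "i < j" for i
    using roots[OF that(1)] z_mono[of "Suc i" j] that assms by force
  moreover have "z j < \<alpha> i" if "i \<in> {1..<K}" "j \<le> i" for i
    using roots[OF that(1)] z_mono[of j i] that assms by force
  ultimately show ?thesis by (auto simp: seg_def)
qed

lemma seg_interval: "x \<in> seg j \<Longrightarrow> y \<in> seg j \<Longrightarrow> x \<le> v \<Longrightarrow> v \<le> y \<Longrightarrow> v \<in> seg j"
  unfolding seg_def by force

lemma curve_pos_seg: assumes "x \<in> seg j" shows "poly curve x > 0"
  unfolding poly_curve
proof (rule mult_pos_pos[OF _ prod_pos])
  fix i assume i: "i \<in> {1..<K}"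
  show "0 < (x - \<alpha> i) * (x - \<beta> i)"
  proof (cases "i < j")
    case True
    then have "\<beta> i < x" using assms i by (auto simp: seg_def)
    then show ?thesis using roots[OF i] by (intro mult_pos_pos) auto
  next
    case False
    then have "x < \<alpha> i" using assms i by (auto simp: seg_def)
    then show ?thesis using roots[OF i] by (intro mult_neg_neg) auto
  qed
qed (use ptot_pos in auto)

lemma seg_or_band:
  obtains j where "j \<in> {1..K}" "x \<in> seg j" | i where "i \<in> {1..<K}" "x \<in> {\<alpha> i..\<beta> i}"
proof (cases "\<exists>i\<in>{1..<K}. x \<in> {\<alpha> i..\<beta> i}")
  case False
  \<comment> \<open>The pairs lying to the left of \<open>x\<close> form an initial block of
    indices, so the segment of \<open>x\<close> has the index one above their number.\<close>
  define j where "j = Suc (card {i\<in>{1..<K}. \<beta> i < x})"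
  define A where "A = {i\<in>{1..<K}. \<beta> i < x}"
  have down: "i' \<in> A" if "i \<in> A" "i' \<in> {1..<K}" "i' < i" for i i'
    using that roots_sep[of i' i] roots[of i] by (force simp: A_def)
  have A: "A = {1..<j}"
  proof -
    have fin: "finite A" by (simp add: A_def)
    have "A = {1..card A}"
    proof (cases "A = {}")
      case ne: False
      define m where "m = Max A"
      have m: "m \<in> A" "\<And>i. i \<in> A \<Longrightarrow> i \<le> m" using fin ne by (auto simp: m_def)
      have "A = {1..m}"
      proof (intro set_eqI iffI)
        fix i assume "i \<in> {1..m}"
        then show "i \<in> A" using m down[of m i] by (cases "i = m") (auto simp: A_def)
      qed (use m in \<open>auto simp: A_def\<close>)
      then show ?thesis by simp
    qed simp
    then show ?thesis unfolding j_def A_def by (simp add: atLeastLessThanSuc_atLeastAtMost)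
  qed
  have "card A \<le> card {1..<K}" by (rule card_mono) (auto simp: A_def)
  then have "j \<in> {1..K}" using K by (auto simp: j_def A_def)
  moreover have "x \<in> seg j"
  proof -
    have "\<beta> i < x" if "i \<in> {1..<K}" "i < j" for i
    proof -
      have "i \<in> A" unfolding A using that by simp
      then show ?thesis by (simp add: A_def)
    qed
    moreover have "x < \<alpha> i" if "i \<in> {1..<K}" "j \<le> i" for i
    proof -
      have "i \<notin> A" unfolding A using that by simp
      then have "\<not> \<beta> i < x" using that by (simp add: A_def)
      then show ?thesis using False that by force
    qed
    ultimately show ?thesis by (auto simp: seg_def)
  qed
  ultimately show ?thesis using that by blast
qed (use that in blast)

lemma curve_neg_band:
  assumes i: "i \<in> {1..<K}" and x: "x \<in> {\<alpha> i<..<\<beta> i}" shows "poly curve x < 0"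
proof -
  have "(\<Prod>i=1..<K. (x - \<alpha> i) * (x - \<beta> i)) = ((x - \<alpha> i) * (x - \<beta> i)) * (\<Prod>j\<in>{1..<K} - {i}. (x - \<alpha> j) * (x - \<beta> j))"
    by (rule prod.remove) (use i in auto)
  moreover have "(x - \<alpha> i) * (x - \<beta> i) < 0" using x by (intro mult_pos_neg) auto
  moreover have "(\<Prod>j\<in>{1..<K} - {i}. (x - \<alpha> j) * (x - \<beta> j)) > 0"
  proof (rule prod_pos)
    fix j assume j: "j \<in> {1..<K} - {i}"
    then consider "i < j" | "j < i" by force
    then show "0 < (x - \<alpha> j) * (x - \<beta> j)"
    proof cases
      case 1
      then show ?thesis using roots_sep[of i j] roots[of j] i j x by (intro mult_neg_neg) auto
    next
      case 2
      then show ?thesis using roots_sep[of j i] roots[of j] i j x by (intro mult_pos_pos) auto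
    qed
  qed
  ultimately have "(\<Prod>i=1..<K. (x - \<alpha> i) * (x - \<beta> i)) < 0" by (simp add: mult_neg_pos)
  then show ?thesis unfolding poly_curve using ptot_pos by (intro mult_pos_neg) auto
qed

text \<open>The square root of \<open>T\<close> keeps its sign on a segment by continuity and
  absence of zeros; the sign is that of \<open>N\<close> at the charge inside.\<close>

lemma resolvent_seg:
  assumes j: "j \<in> {1..K}" and x: "x \<in> seg j"
  shows "resolvent x = (-1) ^ (K - j) * sqrt (poly curve x)"
proof (rule eq_sgn_mult_abs_of_power2_eq)
  show "(resolvent x)\<^sup>2 = poly curve x" using curve_pos_seg[OF x] by (rule resolvent_sq)
  define l r where "l = min x (z j)" "r = max x (z j)"
  have in_seg: "v \<in> seg j" if "v \<in> {l..r}" for v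
    using seg_interval[of "l" j "r" v] x z_in_seg[OF j] that by (auto simp: l_r_def min_def max_def split: if_splits)
  have ne: "resolvent v \<noteq> 0" if "v \<in> {l..r}" for v
    using resolvent_sq[OF curve_pos_seg[OF in_seg[OF that]]] curve_pos_seg[OF in_seg[OF that]] by force
  have cont: "continuous_on {l..r} resolvent"
    using in_seg curve_pos_seg isCont_resolvent by (intro continuous_at_imp_continuous_on) blast
  have "sgn (resolvent x) = sgn (resolvent (z j))"
  proof (rule ccontr)
    assume "sgn (resolvent x) \<noteq> sgn (resolvent (z j))"
    moreover have "resolvent x \<noteq> 0" "resolvent (z j) \<noteq> 0" by (rule ne; simp add: l_r_def)+
    ultimately have "resolvent x * resolvent (z j) < 0" by (auto simp: sgn_if mult_less_0_iff split: if_splits)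
    moreover have "resolvent l * resolvent r = resolvent x * resolvent (z j)"
      by (simp add: l_r_def min_def max_def)
    ultimately have "resolvent l * resolvent r < 0" by simp
    then have "\<exists>v\<in>{l..r}. resolvent v = 0"
      using cont IVT'[of resolvent l 0 r] IVT2'[of resolvent r 0 l]
      by (force simp: l_r_def mult_less_0_iff)
    then show False using ne by blast
  qed
  then show "sgn (resolvent x) = (-1) ^ (K - j)"
    using resolvent_z[OF j] sgn_residue_poly[OF j] by simp
qed

lemma dens_pos_iff: "dens x > 0 \<longleftrightarrow> (\<exists>i\<in>{1..<K}. x \<in> {\<alpha> i<..<\<beta> i})"
proof
  assume pos: "dens x > 0"
  then have neg: "poly curve x < 0" by (auto simp: dens_def zero_less_divide_iff)
  show "\<exists>i\<in>{1..<K}. x \<in> {\<alpha> i<..<\<beta> i}"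
  proof (cases rule: seg_or_band[of x])
    case (1 j)
    then show ?thesis using curve_pos_seg neg by force
  next
    case (2 i)
    have "x \<noteq> \<alpha> i \<and> x \<noteq> \<beta> i"
    proof (rule ccontr)
      assume "\<not> ?thesis"
      then have "(\<Prod>i=1..<K. (x - \<alpha> i) * (x - \<beta> i)) = 0" using 2(1) by (intro prod_zero bexI[of _ i]) auto
      then have "poly curve x = 0" unfolding poly_curve by (simp only: mult_zero_right)
      then show False using neg by simp
    qed
    then show ?thesis using 2 by (intro bexI[of _ i]) auto
  qed
next
  assume "\<exists>i\<in>{1..<K}. x \<in> {\<alpha> i<..<\<beta> i}"
  then obtain i where i: "i \<in> {1..<K}" "x \<in> {\<alpha> i<..<\<beta> i}" by blast
  have neg: "poly curve x < 0" by (rule curve_neg_band[OF i])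
  moreover have "x \<notin> Z" using neg curve_z by force
  ultimately show "dens x > 0" by (simp add: dens_def poly_Pi_poly_eq_0_iff)
qed

end

section \<open>The effective potential\<close>

lemma integrable_ln_abs:
  fixes R :: real
  assumes R: "R > 0"
  shows "integrable lborel (\<lambda>u. \<bar>ln \<bar>u\<bar>\<bar> * indicator {-R..R} u)"
proof -
  define g where "g u = ln (R / \<bar>u\<bar>) * indicator {-R..R} u" for u :: real
  have g0: "g u \<ge> 0" for u
    using R by (cases "u = 0") (auto simp: g_def indicator_def)
  have [measurable]: "g \<in> borel_measurable lborel" unfolding g_def by measurable
  have "(\<integral>\<^sup>+u. ennreal (g u) \<partial>lborel) \<le> log_mass R"
    unfolding log_mass_def
  proof (rule nn_integral_mono_AE)
    show "AE u in lborel. ennreal (g u) \<le> log_pot R u * indicator {-R..R} u"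
      using AE_lborel_singleton[of "0::real"]
      by eventually_elim (auto simp: g_def log_pot_def indicator_def)
  qed
  then have "(\<integral>\<^sup>+u. ennreal (g u) \<partial>lborel) < \<infinity>" using log_mass_finite[OF R] by (rule le_less_trans)
  then have "integrable lborel g" by (intro integrableI_nonneg) (auto simp: g0)
  then have i: "integrable lborel (\<lambda>u. g u + \<bar>ln R\<bar> * indicator {-R..R} u)"
    by (intro Bochner_Integration.integrable_add integrable_mult_right integrable_real_indicator) (use R in auto)
  show ?thesis
  proof (rule Bochner_Integration.integrable_bound[OF i])
    show "AE u in lborel. norm (\<bar>ln \<bar>u\<bar>\<bar> * indicator {-R..R} u) \<le> norm (g u + \<bar>ln R\<bar> * indicator {-R..R} u)"
      using AE_lborel_singleton[of "0::real"]
    proof eventually_elim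
      case (elim u)
      show ?case
      proof (cases "u \<in> {-R..R}")
        case True
        then have "ln (R / \<bar>u\<bar>) \<ge> 0" "ln (R / \<bar>u\<bar>) = ln R - ln \<bar>u\<bar>" using elim R by (auto simp: ln_div)
        then show ?thesis using True by (simp add: g_def)
      qed (simp add: g_def)
    qed
  qed auto
qed

context point_charges
begin

lemma log_pot_commute: "log_pot D (x - y) = log_pot D (y - x)"
  by (auto simp: log_pot_def abs_minus_commute)

definition mutual :: "real measure \<Rightarrow> real measure \<Rightarrow> ennreal" where
  "mutual M N = (\<integral>\<^sup>+x. \<integral>\<^sup>+t. log_pot D (x - t) \<partial>M \<partial>N)"

lemma energy_eq_mutual:
  assumes N: "N \<in> unit"
  shows "energy N = mutual N N + 2 * (\<integral>\<^sup>+x. ext_pot x \<partial>N)"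
proof -
  interpret prob_space N by (rule unitD[OF N])
  have sN [measurable_cong]: "sets N = sets borel" by (rule unitD[OF N])
  show ?thesis unfolding energy_def mutual_def by (subst nn_integral_fst[symmetric]) auto
qed

lemma mutual_commute:
  assumes M: "M \<in> unit" and N: "N \<in> unit"
  shows "mutual M N = mutual N M"
proof -
  interpret M: prob_space M by (rule unitD[OF M])
  interpret N: prob_space N by (rule unitD[OF N])
  have sN [measurable_cong]: "sets M = sets borel" "sets N = sets borel" using unitD(2) M N by auto
  interpret P: pair_sigma_finite M N by unfold_locales
  show ?thesis unfolding mutual_def
    by (subst P.Fubini') (simp_all add: log_pot_commute)
qed

text \<open>The derivative of the energy at \<open>s = 0\<close> along \<open>(1 - s) M + s N\<close> is nonnegative.\<close>
lemma mutual_le_sum: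
  fixes f g :: "real \<Rightarrow> real"
  assumes M: "M \<in> unit" "M = density lborel (\<lambda>x. ennreal (f x))"
    and N: "N \<in> unit" "N = density lborel (\<lambda>x. ennreal (g x))"
    and [measurable]: "f \<in> borel_measurable borel" "g \<in> borel_measurable borel"
    and f: "\<And>x. 0 \<le> f x" "\<And>x. f x \<le> B" and g: "\<And>x. 0 \<le> g x" "\<And>x. g x \<le> C"
    and min: "\<And>N. N \<in> unit \<Longrightarrow> energy M \<le> energy N"
  shows "mutual M M + (\<integral>\<^sup>+x. ext_pot x \<partial>M) \<le> mutual M N + (\<integral>\<^sup>+x. ext_pot x \<partial>N)"
    "mutual M M < \<infinity>" "mutual M N < \<infinity>" "(\<integral>\<^sup>+x. ext_pot x \<partial>M) < \<infinity>" "(\<integral>\<^sup>+x. ext_pot x \<partial>N) < \<infinity>"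
proof -
  interpret M: prob_space M by (rule unitD[OF M(1)])
  interpret N: prob_space N by (rule unitD[OF N(1)])
  have sN [measurable_cong]: "sets M = sets borel" "sets N = sets borel" using unitD(2) M N by auto
  have fin: "energy M < \<infinity>" "energy N < \<infinity>"
    using energy_finite_of_bounded_density[OF M _ f(2)] energy_finite_of_bounded_density[OF N _ g(2)] by auto
  then show fin': "mutual M M < \<infinity>" "(\<integral>\<^sup>+x. ext_pot x \<partial>M) < \<infinity>" "(\<integral>\<^sup>+x. ext_pot x \<partial>N) < \<infinity>"
    unfolding energy_eq_mutual[OF M(1)] energy_eq_mutual[OF N(1)]
    by (auto simp: ennreal_mult_less_top)
  have finN: "mutual N N < \<infinity>" using fin unfolding energy_eq_mutual[OF N(1)] by auto
  \<comment> \<open>Boundedness of the density of \<open>M\<close> is what matters: its potential is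
    then bounded by \<open>B * log_mass D\<close> on the whole interval.\<close>
  show finMN: "mutual M N < \<infinity>"
  proof -
    have "mutual M N \<le> (\<integral>\<^sup>+x. ennreal B * log_mass D \<partial>N)"
      unfolding mutual_def using unitD(3)[OF N(1)]
      by (intro nn_integral_mono_AE, eventually_elim) (rule nn_integral_log_pot_le[OF M _ f(2)], auto)
    also have "\<dots> < \<infinity>" using log_mass_finite[OF D_pos] by (simp add: ennreal_mult_less_top N.emeasure_space_1)
    finally show ?thesis .
  qed
  have "enn2real (mutual M M) + enn2real (\<integral>\<^sup>+x. ext_pot x \<partial>M)
     \<le> enn2real (mutual M N) + enn2real (\<integral>\<^sup>+x. ext_pot x \<partial>N)"
  proof -
    define a b c v0 v1 where abc: "a = enn2real (mutual M M)" "b = enn2real (mutual M N)" "c = enn2real (mutual N N)"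
      "v0 = enn2real (\<integral>\<^sup>+x. ext_pot x \<partial>M)" "v1 = enn2real (\<integral>\<^sup>+x. ext_pot x \<partial>N)"
    have e: "mutual M M = ennreal a" "mutual M N = ennreal b" "mutual N N = ennreal c"
      "(\<integral>\<^sup>+x. ext_pot x \<partial>M) = ennreal v0" "(\<integral>\<^sup>+x. ext_pot x \<partial>N) = ennreal v1"
      using fin' finN finMN by (auto simp: abc less_top[symmetric])
    have nn: "0 \<le> a" "0 \<le> b" "0 \<le> c" "0 \<le> v0" "0 \<le> v1" by (simp_all add: abc)
    \<comment> \<open>The energy of \<open>(1 - s) M + s N\<close> is a quadratic polynomial in
      \<open>s\<close>; minimality at \<open>s = 0\<close>, divided by \<open>2 * s\<close>, leaves
      an error proportional to \<open>s\<close>.\<close>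
    have step: "a + v0 - (b + v1) \<le> s * ((a - 2 * b + c) / 2)" if s: "0 < s" "s < 1" for s
    proof -
      define N' where "N' = density lborel (\<lambda>x. ennreal ((1 - s) * f x + s * g x))"
      have sN' [measurable_cong]: "sets N' = sets borel" by (simp add: N'_def)
      have int: "(\<integral>\<^sup>+x. h x \<partial>N') = ennreal (1 - s) * (\<integral>\<^sup>+x. h x \<partial>M) + ennreal s * (\<integral>\<^sup>+x. h x \<partial>N)"
        if [measurable]: "h \<in> borel_measurable borel" for h
      proof -
        have "(\<integral>\<^sup>+x. h x \<partial>N') = (\<integral>\<^sup>+x. ennreal (1 - s) * (ennreal (f x) * h x) + ennreal s * (ennreal (g x) * h x) \<partial>lborel)"
          unfolding N'_def using s f g
          by (subst nn_integral_density) (auto intro!: nn_integral_cong simp: ennreal_mult' distrib_right mult.assoc ennreal_mult'' )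
        also have "\<dots> = ennreal (1 - s) * (\<integral>\<^sup>+x. ennreal (f x) * h x \<partial>lborel) + ennreal s * (\<integral>\<^sup>+x. ennreal (g x) * h x \<partial>lborel)"
          by (simp add: nn_integral_add nn_integral_cmult)
        also have "\<dots> = ennreal (1 - s) * (\<integral>\<^sup>+x. h x \<partial>M) + ennreal s * (\<integral>\<^sup>+x. h x \<partial>N)"
          unfolding M(2) N(2) by (simp add: nn_integral_density)
        finally show ?thesis .
      qed
      have em: "emeasure N' X = ennreal (1 - s) * emeasure M X + ennreal s * emeasure N X" if [measurable]: "X \<in> sets borel" for X
        using int[of "indicator X"] by simp
      have "emeasure N' (space N') = 1"
        using em[of UNIV] s M.emeasure_space_1 N.emeasure_space_1
        by (simp add: N'_def sets_eq_imp_space_eq[OF sN(1)] sets_eq_imp_space_eq[OF sN(2)] flip: ennreal_plus)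
      moreover have "emeasure N' (UNIV - {z 1..z K}) = 0"
        using em[of "UNIV - {z 1..z K}"] M(1) N(1) by (simp add: unit_measures_def)
      ultimately have N': "N' \<in> unit" by (auto simp: unit_measures_def N'_def intro!: prob_spaceI)
      have [measurable]: "(\<lambda>x. \<integral>\<^sup>+t. log_pot D (x - t) \<partial>M) \<in> borel_measurable borel"
        "(\<lambda>x. \<integral>\<^sup>+t. log_pot D (x - t) \<partial>N) \<in> borel_measurable borel"
        by measurable
      have "mutual N' N' = (\<integral>\<^sup>+x. ennreal (1 - s) * (\<integral>\<^sup>+t. log_pot D (x - t) \<partial>M) + ennreal s * (\<integral>\<^sup>+t. log_pot D (x - t) \<partial>N) \<partial>N')"
        unfolding mutual_def by (intro nn_integral_cong int) measurable
      also have "\<dots> = ennreal (1 - s) * (ennreal (1 - s) * mutual M M + ennreal s * mutual N M)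
          + ennreal s * (ennreal (1 - s) * mutual M N + ennreal s * mutual N N)"
        by (subst int) (auto simp: nn_integral_add nn_integral_cmult mutual_def)
      also have "\<dots> = ennreal ((1 - s) * ((1 - s) * a + s * b) + s * ((1 - s) * b + s * c))"
        unfolding mutual_commute[OF N(1) M(1)] e using s nn by (simp add: ennreal_mult)
      finally have m: "mutual N' N' = ennreal ((1 - s) * ((1 - s) * a + s * b) + s * ((1 - s) * b + s * c))" .
      have v: "(\<integral>\<^sup>+x. ext_pot x \<partial>N') = ennreal ((1 - s) * v0 + s * v1)"
        by (subst int) (use s nn in \<open>auto simp: e ennreal_mult\<close>)
      have two: "2 * ennreal r = ennreal (2 * r)" if "0 \<le> r" for r
        using that by (simp add: ennreal_mult)
      have "0 \<le> (1 - s) * ((1 - s) * a + s * b) + s * ((1 - s) * b + s * c) + 2 * ((1 - s) * v0 + s * v1)"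
        using s nn by (intro add_nonneg_nonneg mult_nonneg_nonneg) auto
      moreover have "energy M = ennreal (a + 2 * v0)"
        unfolding energy_eq_mutual[OF M(1)] e using nn by (simp add: two)
      moreover have "energy N' = ennreal ((1 - s) * ((1 - s) * a + s * b) + s * ((1 - s) * b + s * c) + 2 * ((1 - s) * v0 + s * v1))"
        unfolding energy_eq_mutual[OF N'] m v using s nn
        by (subst two) (auto simp del: ennreal_plus simp add: ennreal_plus[symmetric])
      ultimately have "a + 2 * v0 \<le> (1 - s) * ((1 - s) * a + s * b) + s * ((1 - s) * b + s * c) + 2 * ((1 - s) * v0 + s * v1)"
        using min[OF N'] by (simp add: ennreal_le_iff del: ennreal_plus)
      then have "2 * s * (a + v0 - (b + v1)) \<le> 2 * s * (s * ((a - 2 * b + c) / 2))"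
        by (simp add: algebra_simps power2_eq_square)
      then show ?thesis using s by (simp add: mult_le_cancel_left)
    qed
    have "((\<lambda>s. s * ((a - 2 * b + c) / 2)) \<longlongrightarrow> 0 * ((a - 2 * b + c) / 2)) (at_right 0)"
      by (intro tendsto_intros)
    moreover have "eventually (\<lambda>s. a + v0 - (b + v1) \<le> s * ((a - 2 * b + c) / 2)) (at_right 0)"
      using step by (auto simp: eventually_at_right[of 0 1] intro!: exI[of _ 1])
    ultimately have "a + v0 - (b + v1) \<le> 0 * ((a - 2 * b + c) / 2)"
      by (intro tendsto_lowerbound) auto
    then show ?thesis unfolding abc by simp
  qed
  then have "ennreal (enn2real (mutual M M) + enn2real (\<integral>\<^sup>+x. ext_pot x \<partial>M))
     \<le> ennreal (enn2real (mutual M N) + enn2real (\<integral>\<^sup>+x. ext_pot x \<partial>N))" by (rule ennreal_leI)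
  then show "mutual M M + (\<integral>\<^sup>+x. ext_pot x \<partial>M) \<le> mutual M N + (\<integral>\<^sup>+x. ext_pot x \<partial>N)"
    using fin' finMN by (simp add: less_top[symmetric])
qed

end

section \<open>The potential of the minimizer and its constancy on the bands\<close>

context minimizer_roots
begin

lemma dens_outside: "x \<notin> {z 1..z K} \<Longrightarrow> dens x = 0"
proof (rule ccontr)
  assume x: "x \<notin> {z 1..z K}" and "dens x \<noteq> 0"
  then have "dens x > 0" using dens_nonneg[of x] by linarith
  then obtain i where i: "i \<in> {1..<K}" "x \<in> {\<alpha> i<..<\<beta> i}" unfolding dens_pos_iff by blast
  then show False using roots[OF i(1)] z_in[of i] z_in[of "Suc i"] x by force
qed

lemma dens_bounded: obtains B where "B \<ge> 0" "\<And>x. dens x \<le> B"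
proof -
  have "compact (dens ` {z 1..z K})" by (intro compact_continuous_image continuous_dens) auto
  then obtain B where B: "\<And>x. x \<in> {z 1..z K} \<Longrightarrow> \<bar>dens x\<bar> \<le> B"
    using compact_imp_bounded by (force simp: bounded_iff)
  have "dens x \<le> \<bar>B\<bar>" for x using B[of x] dens_outside[of x] by (cases "x \<in> {z 1..z K}") auto
  then show thesis using that[of "\<bar>B\<bar>"] by auto
qed

definition log_potential :: "real \<Rightarrow> real" where
  "log_potential x = (\<integral>t. ln \<bar>x - t\<bar> \<partial>M)"

text \<open>Since \<open>dens\<close> vanishes outside the interval, only a bounded window of
  \<open>s\<close> contributes, uniformly for \<open>\<bar>x\<bar> \<le> X\<close>; the summand 1
  keeps the radius of the window positive.\<close>

lemma log_dens_bound:
  assumes B: "\<And>x. dens x \<le> B" and x: "\<bar>x\<bar> \<le> X"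
  shows "\<bar>ln \<bar>s\<bar> * dens (x - s)\<bar> \<le>
    B * (\<bar>ln \<bar>s\<bar>\<bar> * indicator {- (X + \<bar>z 1\<bar> + \<bar>z K\<bar> + 1)..X + \<bar>z 1\<bar> + \<bar>z K\<bar> + 1} s)"
proof (cases "x - s \<in> {z 1..z K}")
  case True
  then have "s \<in> {- (X + \<bar>z 1\<bar> + \<bar>z K\<bar> + 1)..X + \<bar>z 1\<bar> + \<bar>z K\<bar> + 1}" using x by auto
  moreover have "\<bar>ln \<bar>s\<bar>\<bar> * dens (x - s) \<le> \<bar>ln \<bar>s\<bar>\<bar> * B" by (intro mult_left_mono B) auto
  ultimately show ?thesis by (simp add: abs_mult dens_nonneg mult.commute)
next
  case False
  moreover have "B \<ge> 0" using B[of 0] dens_nonneg[of 0] by linarith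
  ultimately show ?thesis by (simp add: dens_outside)
qed

text \<open>The substitution \<open>s = x - t\<close> moves the dependence on \<open>x\<close> from
  the singular logarithm to the continuous density, so continuity of the potential everywhere, also
  on the support, is dominated convergence.\<close>

lemma integrable_ln_M: "integrable M (\<lambda>t. ln \<bar>x - t\<bar>)"
  and log_potential_eq: "log_potential x = (\<integral>s. ln \<bar>s\<bar> * dens (x - s) \<partial>lborel)"
proof -
  obtain B where B: "\<And>x. dens x \<le> B" using dens_bounded by blast
  define R where "R = \<bar>x\<bar> + \<bar>z 1\<bar> + \<bar>z K\<bar> + 1"
  have i: "integrable lborel (\<lambda>s. ln \<bar>s\<bar> * dens (x - s))"
  proof (rule Bochner_Integration.integrable_bound)
    show "integrable lborel (\<lambda>s. B * (\<bar>ln \<bar>s\<bar>\<bar> * indicator {-R..R} s))"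
      by (intro integrable_mult_right integrable_ln_abs) (simp add: R_def)
    show "AE s in lborel. norm (ln \<bar>s\<bar> * dens (x - s)) \<le> norm (B * (\<bar>ln \<bar>s\<bar>\<bar> * indicator {-R..R} s))"
      unfolding real_norm_def R_def
      by (intro AE_I2 order_trans[OF log_dens_bound[OF B order_refl] abs_ge_self])
  qed measurable
  have "integrable lborel (\<lambda>t. ln \<bar>x - t\<bar> * dens (x - (x - t)))"
    using lborel_integrable_real_affine[OF i, of "-1" x] by simp
  then have "integrable lborel (\<lambda>t. dens t *\<^sub>R ln \<bar>x - t\<bar>)" by (simp add: mult.commute)
  then show "integrable M (\<lambda>t. ln \<bar>x - t\<bar>)"
    by (subst M_eq_density, subst integrable_density) (auto simp: dens_nonneg)
  have "log_potential x = (\<integral>t. dens t *\<^sub>R ln \<bar>x - t\<bar> \<partial>lborel)"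
    unfolding log_potential_def by (subst M_eq_density, subst integral_density) (auto simp: dens_nonneg)
  also have "\<dots> = (\<integral>s. ln \<bar>s\<bar> * dens (x - s) \<partial>lborel)"
    using lborel_integral_real_affine[of "-1" "\<lambda>s. ln \<bar>s\<bar> * dens (x - s)" x] by (simp add: mult.commute)
  finally show "log_potential x = (\<integral>s. ln \<bar>s\<bar> * dens (x - s) \<partial>lborel)" .
qed

lemma isCont_log_potential: "isCont log_potential x"
proof -
  obtain B where B: "\<And>x. dens x \<le> B" using dens_bounded by blast
  have "(\<lambda>n. log_potential (u n)) \<longlonglongrightarrow> log_potential x" if u: "u \<longlonglongrightarrow> x" for u
  proof -
    obtain X where X: "\<And>n. \<bar>u n\<bar> \<le> X" using convergent_imp_Bseq[of u] u by (auto simp: convergent_def Bseq_def)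
    define R where "R = X + \<bar>z 1\<bar> + \<bar>z K\<bar> + 1"
    show ?thesis
      unfolding log_potential_eq
    proof (rule integral_dominated_convergence[where w = "\<lambda>s. B * (\<bar>ln \<bar>s\<bar>\<bar> * indicator {-R..R} s)"])
      have "X \<ge> 0" using X[of 0] by linarith
      then show "integrable lborel (\<lambda>s. B * (\<bar>ln \<bar>s\<bar>\<bar> * indicator {-R..R} s))"
        by (intro integrable_mult_right integrable_ln_abs) (simp add: R_def)
      show "AE s in lborel. norm (ln \<bar>s\<bar> * dens (u n - s)) \<le> B * (\<bar>ln \<bar>s\<bar>\<bar> * indicator {-R..R} s)" for n
        using log_dens_bound[OF B X] unfolding R_def by (intro AE_I2) simp
      show "AE s in lborel. (\<lambda>n. ln \<bar>s\<bar> * dens (u n - s)) \<longlonglongrightarrow> ln \<bar>s\<bar> * dens (x - s)"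
        by (intro AE_I2 tendsto_intros isCont_tendsto_compose[OF isCont_dens] u)
    qed measurable
  qed
  then show ?thesis by (auto simp: continuous_at_sequentially o_def)
qed

lemma log_potential_deriv:
  assumes "poly curve x > 0"
  shows "(log_potential has_real_derivative rstieltjes x) (at x)"
proof -
  obtain \<delta> where \<delta>: "\<delta> > 0" "AE t in M. \<delta> \<le> \<bar>x - t\<bar>" using gap_exists[OF assms] by blast
  have bound: "\<bar>log_potential (x + s) - log_potential x - s * rstieltjes x\<bar> \<le> 2 * s\<^sup>2 / \<delta>\<^sup>2" if s: "\<bar>s\<bar> \<le> \<delta> / 2" for s
  proof -
    note i = integrable_ln_M[of "x + s"] integrable_ln_M[of x] integrable_inverse_diff[OF \<delta>]
    have eq: "log_potential (x + s) - log_potential x - s * rstieltjes x = (\<integral>t. ln \<bar>x + s - t\<bar> - ln \<bar>x - t\<bar> - s * (1 / (x - t)) \<partial>M)"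
      unfolding log_potential_def rstieltjes_def integral_mult_right_zero[symmetric]
      using i integrable_mult_right[OF i(3), of s]
      by (subst Bochner_Integration.integral_diff Bochner_Integration.integrable_diff | simp)+
    have "\<bar>log_potential (x + s) - log_potential x - s * rstieltjes x\<bar>
        \<le> (\<integral>t. \<bar>ln \<bar>x + s - t\<bar> - ln \<bar>x - t\<bar> - s * (1 / (x - t))\<bar> \<partial>M)"
      unfolding eq by (rule integral_abs_bound)
    also have "\<dots> \<le> (\<integral>t. 2 * s\<^sup>2 / \<delta>\<^sup>2 \<partial>M)"
    proof (rule integral_mono_AE)
      show "integrable M (\<lambda>t. \<bar>ln \<bar>x + s - t\<bar> - ln \<bar>x - t\<bar> - s * (1 / (x - t))\<bar>)"
        by (rule integrable_abs, rule Bochner_Integration.integrable_diff, rule Bochner_Integration.integrable_diff,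
            rule i(1), rule i(2), rule integrable_mult_right, rule i(3))
      show "AE t in M. \<bar>ln \<bar>x + s - t\<bar> - ln \<bar>x - t\<bar> - s * (1 / (x - t))\<bar> \<le> 2 * s\<^sup>2 / \<delta>\<^sup>2"
        using \<delta>(2)
      proof eventually_elim
        case (elim t)
        \<comment> \<open>The relative displacement of \<open>x\<close> seen from \<open>t\<close>,
          at most 1/2 in modulus, so that the increment of the logarithm is
          \<open>ln (1 + v)\<close> with a quadratic remainder.\<close>
        define v where "v = s / (x - t)"
        have ne: "x - t \<noteq> 0" using elim \<delta>(1) by auto
        have v: "\<bar>v\<bar> \<le> \<bar>s\<bar> / \<delta>" unfolding v_def abs_divide using elim \<delta>(1) by (intro divide_left_mono) auto
        also have "\<dots> \<le> 1 / 2" using s \<delta>(1) by (simp add: divide_simps)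
        finally have v2: "\<bar>v\<bar> \<le> 1 / 2" .
        have "x + s - t = (x - t) * (1 + v)" using ne by (simp add: v_def field_simps)
        then have "ln \<bar>x + s - t\<bar> = ln \<bar>x - t\<bar> + ln (1 + v)"
          using ne v2 by (simp add: abs_mult ln_mult)
        then have "\<bar>ln \<bar>x + s - t\<bar> - ln \<bar>x - t\<bar> - s * (1 / (x - t))\<bar> = \<bar>ln (1 + v) - v\<bar>"
          by (simp add: v_def)
        also have "\<dots> \<le> 2 * v\<^sup>2" by (rule abs_ln_one_plus_x_minus_x_bound[OF v2])
        also have "v\<^sup>2 \<le> (\<bar>s\<bar> / \<delta>)\<^sup>2" using v \<delta>(1) by (subst abs_le_square_iff[symmetric]) auto
        finally show ?case by (simp add: power_divide)
      qed
    qed auto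
    finally show ?thesis by simp
  qed
  have "\<forall>\<^sub>F s in at 0. norm ((log_potential (x + s) - log_potential x) / s - rstieltjes x) \<le> \<bar>s\<bar> * (2 / \<delta>\<^sup>2)"
  proof -
    have "norm ((log_potential (x + s) - log_potential x) / s - rstieltjes x) \<le> \<bar>s\<bar> * (2 / \<delta>\<^sup>2)"
      if "s \<noteq> 0" "\<bar>s\<bar> < \<delta> / 2" for s
    proof -
      have "norm ((log_potential (x + s) - log_potential x) / s - rstieltjes x)
          = \<bar>log_potential (x + s) - log_potential x - s * rstieltjes x\<bar> / \<bar>s\<bar>"
        using that by (simp add: abs_divide[symmetric] diff_divide_distrib)
      also have "\<dots> \<le> (2 * s\<^sup>2 / \<delta>\<^sup>2) / \<bar>s\<bar>"
        using bound[of s] that by (intro divide_right_mono) auto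
      also have "\<dots> = \<bar>s\<bar> * (2 / \<delta>\<^sup>2)"
        using that by (simp add: field_simps power2_eq_square abs_mult_self_eq)
      finally show ?thesis .
    qed
    then show ?thesis using \<delta>(1) by (auto simp: eventually_at intro!: exI[of _ "\<delta> / 2"])
  qed
  moreover have "((\<lambda>s::real. \<bar>s\<bar> * (2 / \<delta>\<^sup>2)) \<longlongrightarrow> \<bar>0\<bar> * (2 / \<delta>\<^sup>2)) (at 0)" by (intro tendsto_intros)
  then have "((\<lambda>s::real. \<bar>s\<bar> * (2 / \<delta>\<^sup>2)) \<longlongrightarrow> 0) (at 0)" by simp
  ultimately have "((\<lambda>s. (log_potential (x + s) - log_potential x) / s - rstieltjes x) \<longlongrightarrow> 0) (at 0)"
    by (rule Lim_null_comparison)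
  then show ?thesis unfolding DERIV_def by (simp add: LIM_zero_iff)
qed

text \<open>Taken with the sign of the logarithm, i.e. minus the usual potential, so that its
  derivative on the gaps is \<open>G + N / Pi\<close>, the integrand of the gap conditions up to a
  constant.\<close>

definition eff_potential :: "real \<Rightarrow> real" where
  "eff_potential x = log_potential x + (\<Sum>j=1..K. p j * ln \<bar>x - z j\<bar>)"

lemma isCont_eff_potential: "x \<notin> Z \<Longrightarrow> isCont eff_potential x"
  unfolding eff_potential_def
  by (intro continuous_intros isCont_log_potential) auto

lemma eff_potential_deriv:
  assumes "poly curve x > 0" "x \<notin> Z"
  shows "(eff_potential has_real_derivative resolvent x / poly Pi_poly x) (at x)"
proof -
  have Pi: "poly Pi_poly x \<noteq> 0" using assms by (simp add: poly_Pi_poly_eq_0_iff)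
  have ne: "x \<noteq> z j" if "j \<in> {1..K}" for j using that assms by auto
  have "complex_of_real (poly residue_poly x) = of_real (poly Pi_poly x * (\<Sum>j=1..K. p j / (x - z j)))"
    using cpoly_residue_poly[of "of_real x"] ne by (simp add: cpoly_of_real)
  then have "poly residue_poly x = poly Pi_poly x * (\<Sum>j=1..K. p j / (x - z j))" by (simp only: of_real_eq_iff)
  then have eq: "resolvent x / poly Pi_poly x = rstieltjes x + (\<Sum>j=1..K. p j / (x - z j))"
    using Pi by (simp add: resolvent_def field_simps)
  have ln: "((\<lambda>x. ln \<bar>x - z j\<bar>) has_real_derivative 1 / (x - z j)) (at x)" if "j \<in> {1..K}" for j
  proof -
    have abs: "ln \<bar>u\<bar> = ln u" for u :: real
      by (cases "u \<ge> 0") (simp_all add: ln_minus abs_if)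
    show ?thesis
    proof (cases "x > z j")
      case True
      then show ?thesis unfolding abs by (auto intro!: derivative_eq_intros)
    next
      case False
      then have "x < z j" using ne[OF that] by simp
      then have "((\<lambda>x. ln (z j - x)) has_real_derivative 1 / (x - z j)) (at x)"
        by (auto intro!: derivative_eq_intros simp: divide_simps)
      moreover have "ln \<bar>y - z j\<bar> = ln (z j - y)" for y
        using abs[of "z j - y"] by (simp add: abs_minus_commute)
      ultimately show ?thesis by simp
    qed
  qed
  have "(eff_potential has_real_derivative rstieltjes x + (\<Sum>j=1..K. p j * (1 / (x - z j)))) (at x)"
    unfolding eff_potential_def
    by (intro DERIV_add log_potential_deriv DERIV_sum DERIV_cmult ln assms) auto
  then show ?thesis by (simp add: eq)
qed

definition pot :: "real \<Rightarrow> ennreal" where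
  "pot x = (\<integral>\<^sup>+t. log_pot D (x - t) \<partial>M) + ext_pot x"

lemma measurable_pot [measurable]: "pot \<in> borel_measurable borel"
  unfolding pot_def by measurable

lemma pot_eq:
  assumes x: "x \<in> {z 1..z K}" "x \<notin> Z"
  shows "pot x = ennreal ((1 + ptot) * ln D - eff_potential x)" "0 \<le> (1 + ptot) * ln D - eff_potential x"
proof -
  have ae: "AE t in M. t \<in> {z 1..z K} \<and> t \<noteq> x"
  proof -
    have "AE t in M. t \<notin> {x}" by (rule AE_not_in) (simp add: null_sets_def no_atoms sets_M)
    then show ?thesis using AE_M by eventually_elim auto
  qed
  have i: "integrable M (\<lambda>t. ln D - ln \<bar>x - t\<bar>)" using integrable_ln_M by auto
  have nn: "AE t in M. 0 \<le> ln D - ln \<bar>x - t\<bar>"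
    using ae by eventually_elim (use x in \<open>auto simp: D_def\<close>)
  have eq: "AE t in M. log_pot D (x - t) = ennreal (ln D - ln \<bar>x - t\<bar>)"
    using ae by eventually_elim (use D_pos in \<open>auto simp: log_pot_def ln_div\<close>)
  have 1: "(\<integral>\<^sup>+t. log_pot D (x - t) \<partial>M) = ennreal (\<integral>t. ln D - ln \<bar>x - t\<bar> \<partial>M)"
    "0 \<le> (\<integral>t. ln D - ln \<bar>x - t\<bar> \<partial>M)"
    by (rule nn_integral_eq_integral_AE[OF i nn eq])+
  have 2: "(\<integral>t. ln D - ln \<bar>x - t\<bar> \<partial>M) = ln D - log_potential x"
    unfolding log_potential_def using integrable_ln_M by (subst Bochner_Integration.integral_diff) auto
  have ne: "x \<noteq> z j" if "j \<in> {1..K}" for j using that x by auto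
  have 3: "(\<Sum>j=1..K. p j * ln (D / \<bar>x - z j\<bar>)) = ptot * ln D - (\<Sum>j=1..K. p j * ln \<bar>x - z j\<bar>)"
  proof -
    have "(\<Sum>j=1..K. p j * ln (D / \<bar>x - z j\<bar>)) = (\<Sum>j=1..K. p j * ln D - p j * ln \<bar>x - z j\<bar>)"
      using ne D_pos by (intro sum.cong) (auto simp: ln_div algebra_simps)
    then show ?thesis by (simp add: sum_subtractf ptot_def sum_distrib_right)
  qed
  have 4: "0 \<le> (\<Sum>j=1..K. p j * ln (D / \<bar>x - z j\<bar>))" using ext_pot_finite[OF x(1) ne] by (intro sum_nonneg) auto
  have 5: "(1 + ptot) * ln D - eff_potential x = (ln D - log_potential x) + (\<Sum>j=1..K. p j * ln (D / \<bar>x - z j\<bar>))"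
    unfolding 3 eff_potential_def by (simp add: algebra_simps)
  have 6: "ext_pot x = ennreal (\<Sum>j=1..K. p j * ln (D / \<bar>x - z j\<bar>))"
    by (rule ext_pot_finite(1)[OF x(1)]) (use ne in auto)
  show "0 \<le> (1 + ptot) * ln D - eff_potential x" unfolding 5 using 1(2) 2 4 by simp
  show "pot x = ennreal ((1 + ptot) * ln D - eff_potential x)"
    unfolding 5 pot_def 6 1 2 using 1(2) 2 4 by simp
qed

lemma dens_pos_imp: assumes "dens x > 0" shows "x \<in> {z 1..z K}" "x \<notin> Z"
  using assms dens_outside[of x] curve_z dens_eq_0 by (auto simp: not_less[symmetric]) (fastforce)+

text \<open>The equilibrium constant of potential theory, for kernels normalized by
  \<open>D\<close>: the average of \<open>pot\<close> over \<open>M\<close>.\<close>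

definition eq_const :: real where "eq_const = enn2real (\<integral>\<^sup>+x. pot x \<partial>M)"

lemma nn_integral_pot_le:
  fixes g :: "real \<Rightarrow> real"
  assumes N: "N \<in> unit" "N = density lborel (\<lambda>x. ennreal (g x))"
    and [measurable]: "g \<in> borel_measurable borel" and g: "\<And>x. 0 \<le> g x" "\<And>x. g x \<le> C"
  shows "ennreal eq_const \<le> (\<integral>\<^sup>+x. pot x \<partial>N)" "(\<integral>\<^sup>+x. pot x \<partial>M) = ennreal eq_const"
proof -
  obtain B where B: "\<And>x. dens x \<le> B" using dens_bounded by blast
  have sN [measurable_cong]: "sets N = sets borel" by (rule unitD[OF N(1)])
  note * = mutual_le_sum[OF M M_eq_density N _ _ dens_nonneg B g minimal]
  have M': "(\<integral>\<^sup>+x. pot x \<partial>M) = mutual M M + (\<integral>\<^sup>+x. ext_pot x \<partial>M)"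
    and N': "(\<integral>\<^sup>+x. pot x \<partial>N) = mutual M N + (\<integral>\<^sup>+x. ext_pot x \<partial>N)"
    unfolding pot_def mutual_def by (auto simp: nn_integral_add)
  have "(\<integral>\<^sup>+x. pot x \<partial>M) < \<infinity>" unfolding M' using * by (auto simp: ennreal_add_less_top)
  then show e: "(\<integral>\<^sup>+x. pot x \<partial>M) = ennreal eq_const" by (simp add: eq_const_def less_top[symmetric])
  show "ennreal eq_const \<le> (\<integral>\<^sup>+x. pot x \<partial>N)" using * unfolding e[symmetric] M' N' by auto
qed

lemma emeasure_ball_pos:
  assumes "dens x > 0" "e > 0"
  shows "emeasure M (ball x e) > 0"
proof -
  have "open {y. dens y > 0}" by (intro open_Collect_less continuous_intros continuous_dens)
  then obtain d where d: "d > 0" "ball x d \<subseteq> {y. dens y > 0}"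
    using assms unfolding open_contains_ball by blast
  define r where "r = min d e"
  have r: "r > 0" "ball x r \<subseteq> {y. dens y > 0}" "ball x r \<subseteq> ball x e" using d assms by (auto simp: r_def)
  have [measurable]: "ball x r \<in> sets borel" by simp
  have "emeasure M (ball x r) \<noteq> 0"
  proof
    assume "emeasure M (ball x r) = 0"
    then have "(\<integral>\<^sup>+y. ennreal (dens y) * indicator (ball x r) y \<partial>lborel) = 0"
      by (subst (asm) M_eq_density) (simp add: emeasure_density)
    then have "AE y in lborel. ennreal (dens y) * indicator (ball x r) y = 0"
      by (subst (asm) nn_integral_0_iff_AE) auto
    then have "AE y in lborel. y \<notin> ball x r"
      by eventually_elim (use r in \<open>auto simp: indicator_def split: if_splits\<close>)
    then have "ball x r \<in> null_sets lborel" by (subst AE_iff_null_sets) auto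
    then have "emeasure lborel (ball x r) = 0" by auto
    moreover have "emeasure lborel (ball x r) = ennreal (2 * r)" using r by (simp add: ball_eq_greaterThanLessThan)
    ultimately show False using r by simp
  qed
  moreover have "emeasure M (ball x r) \<le> emeasure M (ball x e)" using r by (intro emeasure_mono) (auto simp: sets_M)
  ultimately show ?thesis by (metis le_zero_eq not_gr_zero)
qed

text \<open>
  Comparing \<open>M\<close> with its normalized restriction to a small ball shows that the potential is at least its
  \<open>M\<close>-average wherever the density is positive; hence it equals the average there.
\<close>
lemma pot_dens_pos:
  assumes "dens x > 0"
  shows "(1 + ptot) * ln D - eff_potential x = eq_const"
proof -
  define \<psi> where "\<psi> x = (1 + ptot) * ln D - eff_potential x" for x
  have cont: "isCont \<psi> y" if "y \<notin> Z" for y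
    unfolding \<psi>_def by (intro continuous_intros isCont_eff_potential that)
  have near: "\<exists>e>0. \<forall>y\<in>ball x e. P (\<psi> y) \<and> y \<in> {z 1..z K} \<and> y \<notin> Z"
    if "dens x > 0" "open {v. P v}" "P (\<psi> x)" for x P
  proof -
    have "(dens \<longlongrightarrow> dens x) (nhds x)"
      using isCont_dens[of x] unfolding isCont_def tendsto_at_iff_tendsto_nhds .
    then have "eventually (\<lambda>y. dens y > 0) (nhds x)" by (rule order_tendstoD(1)[OF _ that(1)])
    moreover have "(\<psi> \<longlongrightarrow> \<psi> x) (nhds x)"
      using cont[OF dens_pos_imp(2)[OF that(1)]] unfolding isCont_def tendsto_at_iff_tendsto_nhds .
    then have "eventually (\<lambda>y. \<psi> y \<in> {v. P v}) (nhds x)"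
      by (rule topological_tendstoD) (use that in auto)
    ultimately have "eventually (\<lambda>y. P (\<psi> y) \<and> y \<in> {z 1..z K} \<and> y \<notin> Z) (nhds x)"
      by eventually_elim (use dens_pos_imp in auto)
    then show ?thesis unfolding eventually_nhds_metric by (auto simp: dist_commute ball_def)
  qed
  have ge: "\<psi> x \<ge> eq_const" if x: "dens x > 0" for x
  proof (rule ccontr)
    assume "\<not> \<psi> x \<ge> eq_const"
    define v where "v = (\<psi> x + eq_const) / 2"
    have v: "\<psi> x < v" "v < eq_const" using \<open>\<not> \<psi> x \<ge> eq_const\<close> by (auto simp: v_def)
    obtain e where e: "e > 0" "\<And>y. y \<in> ball x e \<Longrightarrow> \<psi> y < v \<and> y \<in> {z 1..z K} \<and> y \<notin> Z"
      using near[OF x, of "\<lambda>u. u < v"] v by (auto simp: open_Collect_less)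
    define m where "m = measure M (ball x e)"
    have m: "emeasure M (ball x e) = ennreal m" "m > 0"
      using emeasure_ball_pos[OF x e(1)] by (auto simp: m_def emeasure_eq_measure)
    define g where "g y = dens y * indicator (ball x e) y / m" for y
    define N where "N = density lborel (\<lambda>y. ennreal (g y))"
    have [measurable]: "ball x e \<in> sets borel" by simp
    have [measurable]: "g \<in> borel_measurable borel" unfolding g_def by measurable
    have g0: "0 \<le> g y" for y using m by (auto simp: g_def dens_nonneg)
    have int: "(\<integral>\<^sup>+y. h y \<partial>N) = ennreal (1 / m) * (\<integral>\<^sup>+y. h y * indicator (ball x e) y \<partial>M)"
      if [measurable]: "h \<in> borel_measurable borel" for h
    proof -
      have "(\<integral>\<^sup>+y. h y \<partial>N) = (\<integral>\<^sup>+y. ennreal (1 / m) * (ennreal (dens y) * (h y * indicator (ball x e) y)) \<partial>lborel)"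
        unfolding N_def using m dens_nonneg
        by (subst nn_integral_density)
          (auto intro!: nn_integral_cong simp: g_def indicator_def ennreal_mult'[symmetric] mult.assoc[symmetric])
      also have "\<dots> = ennreal (1 / m) * (\<integral>\<^sup>+y. ennreal (dens y) * (h y * indicator (ball x e) y) \<partial>lborel)"
        by (subst nn_integral_cmult) auto
      also have "(\<integral>\<^sup>+y. ennreal (dens y) * (h y * indicator (ball x e) y) \<partial>lborel) = (\<integral>\<^sup>+y. h y * indicator (ball x e) y \<partial>M)"
        by (subst (2) M_eq_density, subst nn_integral_density) auto
      finally show ?thesis .
    qed
    have one: "ennreal (1 / m) * ennreal m = 1" using m by (simp add: ennreal_mult[symmetric])
    have "emeasure N (space N) = 1"
      using int[of "\<lambda>_. 1"] one by (simp add: N_def m)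
    moreover have "emeasure N (UNIV - {z 1..z K}) = 0"
    proof -
      have "emeasure N (UNIV - {z 1..z K}) = ennreal (1 / m) * (\<integral>\<^sup>+y. indicator (UNIV - {z 1..z K}) y * indicator (ball x e) y \<partial>M)"
        using int[of "indicator (UNIV - {z 1..z K})"] by (simp add: N_def)
      also have "(\<integral>\<^sup>+y. indicator (UNIV - {z 1..z K}) y * indicator (ball x e) y \<partial>M) = (\<integral>\<^sup>+y. 0 \<partial>M)"
        by (intro nn_integral_cong) (use e(2) in \<open>auto simp: indicator_def\<close>)
      finally show ?thesis by simp
    qed
    ultimately have N: "N \<in> unit" by (auto simp: unit_measures_def N_def intro!: prob_spaceI)
    obtain B where B: "B \<ge> 0" "\<And>x. dens x \<le> B" using dens_bounded by blast
    have "g y \<le> B / m" for y using m B by (auto simp: g_def indicator_def intro!: divide_right_mono)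
    then have "ennreal eq_const \<le> (\<integral>\<^sup>+x. pot x \<partial>N)"
      by (intro nn_integral_pot_le[OF N N_def _ g0]) auto
    also have "\<dots> = ennreal (1 / m) * (\<integral>\<^sup>+y. pot y * indicator (ball x e) y \<partial>M)" by (rule int) measurable
    also have "\<dots> \<le> ennreal (1 / m) * (\<integral>\<^sup>+y. ennreal v * indicator (ball x e) y \<partial>M)"
    proof (intro mult_left_mono nn_integral_mono)
      fix y show "pot y * indicator (ball x e) y \<le> ennreal v * indicator (ball x e) y"
        using e(2)[of y] pot_eq(1)[of y] by (auto simp: indicator_def \<psi>_def intro!: ennreal_leI)
    qed simp
    also have "\<dots> = ennreal v"
      using one m by (simp add: nn_integral_cmult_indicator sets_M mult.left_commute)
    \<comment> \<open>The second alternative arises because \<open>ennreal\<close> sends negative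
      numbers to 0; it is excluded by \<open>\<psi> x \<ge> 0\<close>, which makes
      \<open>eq_const\<close> positive.\<close>
    finally have "eq_const \<le> v \<or> eq_const \<le> 0" by (auto simp: ennreal_le_iff2)
    moreover have "\<psi> x \<ge> 0" unfolding \<psi>_def using dens_pos_imp[OF x] by (intro pot_eq) auto
    ultimately show False using v by auto
  qed
  \<comment> \<open>The lower bound \<open>ge\<close> holds almost everywhere for \<open>M\<close>,
    so a strict excess on a ball of positive mass would push the average above itself.\<close>
  have "\<psi> x \<le> eq_const"
  proof (rule ccontr)
    assume "\<not> \<psi> x \<le> eq_const"
    define v where "v = (\<psi> x + eq_const) / 2"
    have v: "v < \<psi> x" "eq_const < v" using \<open>\<not> \<psi> x \<le> eq_const\<close> by (auto simp: v_def)
    obtain e where e: "e > 0" "\<And>y. y \<in> ball x e \<Longrightarrow> v < \<psi> y \<and> y \<in> {z 1..z K} \<and> y \<notin> Z"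
      using near[OF assms, of "\<lambda>u. v < u"] v by (auto simp: open_Collect_less)
    have [measurable]: "ball x e \<in> sets borel" by simp
    have c0: "eq_const \<ge> 0" by (simp add: eq_const_def)
    have "ennreal eq_const + ennreal (v - eq_const) * emeasure M (ball x e)
        = (\<integral>\<^sup>+y. ennreal eq_const + ennreal (v - eq_const) * indicator (ball x e) y \<partial>M)"
      by (subst nn_integral_add; (subst nn_integral_cmult_indicator)?; simp add: sets_M)
    also have "\<dots> \<le> (\<integral>\<^sup>+y. pot y \<partial>M)"
    proof (rule nn_integral_mono_AE)
      show "AE y in M. ennreal eq_const + ennreal (v - eq_const) * indicator (ball x e) y \<le> pot y"
        using AE_dens_pos
      proof eventually_elim
        case (elim y)
        have p: "pot y = ennreal (\<psi> y)" using dens_pos_imp[OF elim] by (simp add: pot_eq \<psi>_def)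
        show ?case
        proof (cases "y \<in> ball x e")
          case True
          have "ennreal eq_const + ennreal (v - eq_const) = ennreal v" using v c0 by (simp flip: ennreal_plus)
          then show ?thesis using True e(2)[OF True] p by (auto intro!: ennreal_leI)
        next
          case False
          then show ?thesis using p ge[OF elim] by (auto intro!: ennreal_leI)
        qed
      qed
    qed
    also have "\<dots> = ennreal eq_const"
    proof -
      obtain B where B: "\<And>x. dens x \<le> B" using dens_bounded by blast
      show ?thesis by (rule nn_integral_pot_le(2)[OF M M_eq_density _ dens_nonneg B]) simp
    qed
    finally have "ennreal (v - eq_const) * emeasure M (ball x e) = 0"
      by (simp add: ennreal_add_left_cancel_le[of "ennreal eq_const" _ 0, simplified])
    then show False using emeasure_ball_pos[OF assms e(1)] v by simp
  qed
  with ge[OF assms] show ?thesis by (simp add: \<psi>_def)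
qed

text \<open>Continuity extends the constant from the open band to its end points, where the gap
  integrals are evaluated. This is possible because no charge lies on the closed band.\<close>

lemma eff_potential_band:
  assumes i: "i \<in> {1..<K}" "\<alpha> i < \<beta> i" and x: "x \<in> {\<alpha> i..\<beta> i}"
  shows "eff_potential x = (1 + ptot) * ln D - eq_const"
proof -
  have in_band: "y \<notin> Z" if y: "y \<in> {\<alpha> i..\<beta> i}" for y
  proof
    assume "y \<in> Z"
    then obtain j where j: "j \<in> {1..K}" "y = z j" by auto
    then show False using roots[OF i(1)] z_mono[of j i] z_mono[of "Suc i" j] i(1) y
      by (cases "j \<le> i") auto
  qed
  have "continuous_on {\<alpha> i..\<beta> i} eff_potential"
    using in_band isCont_eff_potential by (intro continuous_at_imp_continuous_on) auto
  then have "continuous_on (closure {\<alpha> i<..<\<beta> i}) eff_potential" using i by simp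
  moreover have "eff_potential y = (1 + ptot) * ln D - eq_const" if "y \<in> {\<alpha> i<..<\<beta> i}" for y
  proof -
    have "dens y > 0" unfolding dens_pos_iff using that i by blast
    then show ?thesis using pot_dens_pos[of y] by linarith
  qed
  moreover have "x \<in> closure {\<alpha> i<..<\<beta> i}" using x i(2) by simp
  ultimately show ?thesis by (rule continuous_constant_on_closure)
qed

end

section \<open>Uniqueness of the minimizer\<close>

text \<open>Frullani's integral: write the difference quotient as the integral of
  \<open>exp (- (s * u))\<close> over \<open>u\<close> in \<open>{r..R}\<close> and exchange the
  order. With \<open>r\<close> a squared distance it presents the logarithm as a mixture of
  Gaussians.\<close>

lemma nn_integral_exp_diff:
  fixes r R :: real
  assumes r: "0 < r" "r \<le> R"
  shows "(\<integral>\<^sup>+s. ennreal ((exp (- (s * r)) - exp (- (s * R))) / s) * indicator {0<..} s \<partial>lborel) = ennreal (ln R - ln r)"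
proof -
  have "(\<integral>\<^sup>+s. ennreal ((exp (- (s * r)) - exp (- (s * R))) / s) * indicator {0<..} s \<partial>lborel)
     = (\<integral>\<^sup>+s. \<integral>\<^sup>+u. ennreal (exp (- (s * u))) * indicator {r..R} u * indicator {0..} s \<partial>lborel \<partial>lborel)"
  proof (rule nn_integral_cong_AE)
    show "AE s in lborel. ennreal ((exp (- (s * r)) - exp (- (s * R))) / s) * indicator {0<..} s =
      (\<integral>\<^sup>+u. ennreal (exp (- (s * u))) * indicator {r..R} u * indicator {0..} s \<partial>lborel)"
      using AE_lborel_singleton[of "0::real"]
    proof eventually_elim
      case (elim s)
      show ?case
      proof (cases "s > 0")
        case True
        have "(\<integral>\<^sup>+u. ennreal (exp (- (s * u))) * indicator {r..R} u \<partial>lborel) = ennreal (- exp (- (s * R)) / s - - exp (- (s * r)) / s)"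
          by (rule nn_integral_FTC_Icc) (use True r in \<open>auto intro!: derivative_eq_intros\<close>)
        then show ?thesis using True by (simp add: diff_divide_distrib)
      next
        case False
        then show ?thesis using elim by simp
      qed
    qed
  qed
  also have "\<dots> = (\<integral>\<^sup>+u. \<integral>\<^sup>+s. ennreal (exp (- (s * u))) * indicator {r..R} u * indicator {0..} s \<partial>lborel \<partial>lborel)"
    by (rule lborel_pair.Fubini'[symmetric]) measurable
  also have "\<dots> = (\<integral>\<^sup>+u. ennreal (1 / u) * indicator {r..R} u \<partial>lborel)"
  proof (rule nn_integral_cong)
    fix u :: real
    show "(\<integral>\<^sup>+s. ennreal (exp (- (s * u))) * indicator {r..R} u * indicator {0..} s \<partial>lborel) = ennreal (1 / u) * indicator {r..R} u"
    proof (cases "u \<in> {r..R}")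
      case True
      then have u: "u > 0" using r by auto
      have "(\<integral>\<^sup>+s. ennreal (exp (- (s * u))) * indicator {0..} s \<partial>lborel) = ennreal (0 - - exp (- (0 * u)) / u)"
      proof (rule nn_integral_FTC_atLeast)
        have "((\<lambda>s. exp (- (s * u))) \<longlongrightarrow> 0) at_top"
          by (intro filterlim_compose[OF exp_at_bot] filterlim_compose[OF filterlim_uminus_at_bot_at_top]
              filterlim_at_top_mult_tendsto_pos[OF tendsto_const u] filterlim_ident)
        then have "((\<lambda>s. - exp (- (s * u)) / u) \<longlongrightarrow> - 0 / u) at_top" by (intro tendsto_intros) (use u in auto)
        then show "((\<lambda>s. - exp (- (s * u)) / u) \<longlongrightarrow> 0) at_top" by simp
      qed (use u in \<open>auto intro!: derivative_eq_intros\<close>)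
      then show ?thesis using True by simp
    qed simp
  qed
  also have "\<dots> = ennreal (ln R - ln r)"
    by (rule nn_integral_FTC_Icc) (use r in \<open>auto intro!: derivative_eq_intros\<close>)
  finally show ?thesis .
qed

section \<open>Positive definiteness of the Gaussian kernel and of its mixture\<close>

context point_charges
begin

definition gauss_mom :: "real measure \<Rightarrow> real \<Rightarrow> nat \<Rightarrow> real" where
  "gauss_mom M s i = (\<integral>x. x ^ i * exp (- (s * x\<^sup>2)) \<partial>M)"

definition gauss_form :: "real measure \<Rightarrow> real measure \<Rightarrow> real \<Rightarrow> real" where
  "gauss_form M N s = (\<integral>u. exp (- (s * (fst u - snd u)\<^sup>2)) \<partial>(M \<Otimes>\<^sub>M N))"

text \<open>
  Expanding \<open>exp (2 s x t)\<close> in \<open>exp (- s (x - t)\<^sup>2) = exp (- s x\<^sup>2) exp (- s t\<^sup>2) exp (2 s x t)\<close> diagonalizes the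
  Gaussian kernel.
\<close>
lemma gauss_form_sums:
  assumes M: "M \<in> unit" and N: "N \<in> unit"
  shows "(\<lambda>i. (2 * s) ^ i / fact i * (gauss_mom M s i * gauss_mom N s i)) sums gauss_form M N s"
proof -
  interpret M: prob_space M by (rule unitD[OF M])
  interpret N: prob_space N by (rule unitD[OF N])
  interpret P: pair_prob_space M N by unfold_locales
  have sN [measurable_cong]: "sets M = sets borel" "sets N = sets borel" using unitD(2) M N by auto
  define w where "w x = exp (- (s * x\<^sup>2))" for x :: real
  define f where "f i u = (2 * s) ^ i / fact i * ((fst u ^ i * w (fst u)) * (snd u ^ i * w (snd u)))" for i and u :: "real \<times> real"
  have f_eq: "f i u = (2 * s * fst u * snd u) ^ i /\<^sub>R fact i * (w (fst u) * w (snd u))" for i u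
    by (simp add: f_def power_mult_distrib divide_inverse mult_ac)
  have sums: "(\<lambda>i. f i u) sums exp (- (s * (fst u - snd u)\<^sup>2))" for u
  proof -
    have "(\<lambda>i. f i u) sums (exp (2 * s * fst u * snd u) * (w (fst u) * w (snd u)))"
      unfolding f_eq by (intro sums_mult2 exp_converges)
    also have "exp (2 * s * fst u * snd u) * (w (fst u) * w (snd u)) = exp (- (s * (fst u - snd u)\<^sup>2))"
      unfolding w_def exp_add[symmetric] by (rule arg_cong[of _ _ exp]) (simp add: power2_eq_square algebra_simps)
    finally show ?thesis .
  qed
  have cw: "continuous_on UNIV (\<lambda>x. x ^ i * w x)" for i
    unfolding w_def by (intro continuous_intros)
  have int: "integrable M (\<lambda>x. x ^ i * w x)" "integrable N (\<lambda>x. x ^ i * w x)" for i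
    using integrable_unit M N cw by auto
  have wM: "(\<lambda>x. x ^ i * w x) \<in> borel_measurable borel" for i using cw by (rule borel_measurable_continuous_onI)
  have [measurable]: "f i \<in> borel_measurable (borel \<Otimes>\<^sub>M borel)" for i
    unfolding f_def w_def by measurable
  define A where "A = \<bar>z 1\<bar> + \<bar>z K\<bar>"
  \<comment> \<open>The exponential series of the modulus of \<open>2 * s * x * t\<close> and the
    two Gaussian factors, each bounded on the interval: a constant dominating all partial
    sums.\<close>
  define B where "B = exp (\<bar>2 * s\<bar> * A * A) * (exp (\<bar>s\<bar> * A\<^sup>2) * exp (\<bar>s\<bar> * A\<^sup>2))"
  have bound: "norm (\<Sum>i<n. f i u) \<le> B" if "fst u \<in> {z 1..z K}" "snd u \<in> {z 1..z K}" for n u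
  proof -
    have a: "\<bar>fst u\<bar> \<le> A" "\<bar>snd u\<bar> \<le> A" using that by (auto simp: A_def)
    have w: "0 \<le> w x" "w x \<le> exp (\<bar>s\<bar> * A\<^sup>2)" if "\<bar>x\<bar> \<le> A" for x
    proof -
      have "- (s * x\<^sup>2) \<le> \<bar>s\<bar> * x\<^sup>2" using mult_right_mono[of "- s" "\<bar>s\<bar>" "x\<^sup>2"] by simp
      also have "\<dots> \<le> \<bar>s\<bar> * A\<^sup>2" using that by (intro mult_left_mono) (auto simp: abs_le_square_iff[symmetric])
      finally show "w x \<le> exp (\<bar>s\<bar> * A\<^sup>2)" by (simp add: w_def)
    qed (simp add: w_def)
    have "norm (\<Sum>i<n. f i u) \<le> (\<Sum>i<n. norm (f i u))" by (rule norm_sum)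
    also have "\<dots> = (\<Sum>i<n. \<bar>2 * s * fst u * snd u\<bar> ^ i /\<^sub>R fact i) * (w (fst u) * w (snd u))"
      unfolding f_eq using w(1)[OF a(1)] w(1)[OF a(2)]
      by (simp add: abs_mult power_abs sum_distrib_right)
    also have "\<dots> \<le> exp (\<bar>2 * s * fst u * snd u\<bar>) * (exp (\<bar>s\<bar> * A\<^sup>2) * exp (\<bar>s\<bar> * A\<^sup>2))"
    proof (intro mult_mono)
      show "(\<Sum>i<n. \<bar>2 * s * fst u * snd u\<bar> ^ i /\<^sub>R fact i) \<le> exp (\<bar>2 * s * fst u * snd u\<bar>)"
        unfolding exp_def by (rule sum_le_suminf[OF summable_exp_generic]) auto
    qed (use w a in \<open>auto intro!: mult_nonneg_nonneg sum_nonneg\<close>)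
    also have "\<dots> \<le> B"
      unfolding B_def
    proof (intro mult_right_mono)
      have "\<bar>2 * s * fst u * snd u\<bar> \<le> \<bar>2 * s\<bar> * A * A"
        unfolding abs_mult[of "2 * s * fst u"] abs_mult[of "2 * s"] using a by (intro mult_mono) auto
      then show "exp \<bar>2 * s * fst u * snd u\<bar> \<le> exp (\<bar>2 * s\<bar> * A * A)" by simp
    qed auto
    finally show ?thesis .
  qed
  have "(\<lambda>n. \<integral>u. (\<Sum>i<n. f i u) \<partial>(M \<Otimes>\<^sub>M N)) \<longlonglongrightarrow> gauss_form M N s"
    unfolding gauss_form_def
  proof (rule integral_dominated_convergence[where w = "\<lambda>_. B"])
    show "AE u in M \<Otimes>\<^sub>M N. norm (\<Sum>i<n. f i u) \<le> B" for n
      using AE_unit_pair[OF M N] by eventually_elim (use bound in auto)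
    show "AE u in M \<Otimes>\<^sub>M N. (\<lambda>n. \<Sum>i<n. f i u) \<longlonglongrightarrow> exp (- (s * (fst u - snd u)\<^sup>2))"
      using sums by (intro AE_I2) (simp add: sums_def)
  qed (auto simp: P.integrable_const)
  moreover have "(\<integral>u. (\<Sum>i<n. f i u) \<partial>(M \<Otimes>\<^sub>M N)) = (\<Sum>i<n. (2 * s) ^ i / fact i * (gauss_mom M s i * gauss_mom N s i))" for n
  proof -
    have i: "integrable (M \<Otimes>\<^sub>M N) (\<lambda>u. (fst u ^ i * w (fst u)) * (snd u ^ i * w (snd u)))" for i
    proof -
      have "compact ((\<lambda>x. x ^ i * w x) ` {z 1..z K})"
        by (intro compact_continuous_image continuous_on_subset[OF cw]) auto
      then obtain C where C: "\<And>x. x \<in> {z 1..z K} \<Longrightarrow> \<bar>x ^ i * w x\<bar> \<le> C"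
        using compact_imp_bounded by (force simp: bounded_iff)
      show ?thesis
      proof (rule P.integrable_const_bound[where B = "C * C"])
        show "AE u in M \<Otimes>\<^sub>M N. norm ((fst u ^ i * w (fst u)) * (snd u ^ i * w (snd u))) \<le> C * C"
          using AE_unit_pair[OF M N]
        proof eventually_elim
          case (elim u)
          then show ?case
            unfolding real_norm_def abs_mult[of "fst u ^ i * w (fst u)"]
            using C[of "fst u"] C[of "snd u"] by (intro mult_mono) auto
        qed
        show "(\<lambda>u. (fst u ^ i * w (fst u)) * (snd u ^ i * w (snd u))) \<in> borel_measurable (M \<Otimes>\<^sub>M N)"
          unfolding w_def by measurable
      qed
    qed
    have "(\<integral>u. (fst u ^ i * w (fst u)) * (snd u ^ i * w (snd u)) \<partial>(M \<Otimes>\<^sub>M N)) = gauss_mom M s i * gauss_mom N s i" for i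
      using P.integral_fst'[OF i[of i]] by (simp add: gauss_mom_def w_def)
    then show ?thesis
      unfolding f_def using i by (subst Bochner_Integration.integral_sum) auto
  qed
  ultimately show ?thesis by (simp add: sums_def)
qed

text \<open>The quadratic form of the signed measure \<open>M - N\<close>. Being a weighted sum of
  squares, for \<open>s > 0\<close> it is nonnegative and vanishes only if all Gaussian moments
  agree.\<close>

lemma gauss_form_diff_sums:
  assumes M: "M \<in> unit" and N: "N \<in> unit"
  shows "(\<lambda>i. (2 * s) ^ i / fact i * (gauss_mom M s i - gauss_mom N s i)\<^sup>2) sums
    (gauss_form M M s + gauss_form N N s - 2 * gauss_form M N s)"
proof -
  have "(\<lambda>i. (2 * s) ^ i / fact i * (gauss_mom M s i * gauss_mom M s i) + (2 * s) ^ i / fact i * (gauss_mom N s i * gauss_mom N s i)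
      - 2 * ((2 * s) ^ i / fact i * (gauss_mom M s i * gauss_mom N s i))) sums
    (gauss_form M M s + gauss_form N N s - 2 * gauss_form M N s)"
    by (intro sums_add sums_diff sums_mult gauss_form_sums M N)
  moreover have "(2 * s) ^ i / fact i * (gauss_mom M s i * gauss_mom M s i) + (2 * s) ^ i / fact i * (gauss_mom N s i * gauss_mom N s i)
      - 2 * ((2 * s) ^ i / fact i * (gauss_mom M s i * gauss_mom N s i)) = (2 * s) ^ i / fact i * (gauss_mom M s i - gauss_mom N s i)\<^sup>2" for i
    by (simp add: power2_eq_square algebra_simps)
  ultimately show ?thesis by simp
qed

lemma gauss_form_diff:
  assumes M: "M \<in> unit" and N: "N \<in> unit" and s: "s > 0"
  shows "0 \<le> gauss_form M M s + gauss_form N N s - 2 * gauss_form M N s"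
    "gauss_form M M s + gauss_form N N s - 2 * gauss_form M N s = 0 \<Longrightarrow> gauss_mom M s i = gauss_mom N s i"
proof -
  note sums = gauss_form_diff_sums[OF M N, of s]
  have nn: "0 \<le> (2 * s) ^ i / fact i * (gauss_mom M s i - gauss_mom N s i)\<^sup>2" for i using s by simp
  show "0 \<le> gauss_form M M s + gauss_form N N s - 2 * gauss_form M N s"
    using sums nn by (rule sums_le[OF _ sums_zero, rotated])
  assume "gauss_form M M s + gauss_form N N s - 2 * gauss_form M N s = 0"
  then have "(2 * s) ^ i / fact i * (gauss_mom M s i - gauss_mom N s i)\<^sup>2 = 0"
    using suminf_eq_zero_iff[OF sums_summable[OF sums] nn] sums_unique[OF sums] by simp
  then show "gauss_mom M s i = gauss_mom N s i" using s by simp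
qed

text \<open>Subtracting the value at distance \<open>D\<close> keeps the integrand nonnegative on
  the interval and removes the divergence of \<open>1 / s\<close> at 0 in the mixture.\<close>

lemma gauss_form_ge:
  assumes M: "M \<in> unit" and N: "N \<in> unit" and s: "s \<ge> 0"
  shows "(\<integral>\<^sup>+u. ennreal (exp (- (s * (fst u - snd u)\<^sup>2)) - exp (- (s * D\<^sup>2))) \<partial>(M \<Otimes>\<^sub>M N))
      = ennreal (gauss_form M N s - exp (- (s * D\<^sup>2)))"
    "exp (- (s * D\<^sup>2)) \<le> gauss_form M N s"
proof -
  interpret M: prob_space M by (rule unitD[OF M])
  interpret N: prob_space N by (rule unitD[OF N])
  interpret P: pair_prob_space M N by unfold_locales
  have sN [measurable_cong]: "sets M = sets borel" "sets N = sets borel" using unitD(2) M N by auto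
  have i: "integrable (M \<Otimes>\<^sub>M N) (\<lambda>u. exp (- (s * (fst u - snd u)\<^sup>2)))"
    by (rule P.integrable_const_bound[where B = 1]) (use s in \<open>auto intro!: mult_nonneg_nonneg\<close>)
  then have i': "integrable (M \<Otimes>\<^sub>M N) (\<lambda>u. exp (- (s * (fst u - snd u)\<^sup>2)) - exp (- (s * D\<^sup>2)))"
    by (intro Bochner_Integration.integrable_diff P.integrable_const)
  have nn: "AE u in M \<Otimes>\<^sub>M N. 0 \<le> exp (- (s * (fst u - snd u)\<^sup>2)) - exp (- (s * D\<^sup>2))"
    using AE_unit_pair[OF M N]
  proof eventually_elim
    case (elim u)
    then have "\<bar>fst u - snd u\<bar> \<le> \<bar>D\<bar>" by (auto simp: D_def)
    then have "(fst u - snd u)\<^sup>2 \<le> D\<^sup>2" by (simp only: abs_le_square_iff)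
    then show ?case using s by (simp add: mult_left_mono)
  qed
  have eq: "(\<integral>u. exp (- (s * (fst u - snd u)\<^sup>2)) - exp (- (s * D\<^sup>2)) \<partial>(M \<Otimes>\<^sub>M N)) = gauss_form M N s - exp (- (s * D\<^sup>2))"
    unfolding gauss_form_def using i by (subst Bochner_Integration.integral_diff) (auto simp: P.prob_space)
  show "(\<integral>\<^sup>+u. ennreal (exp (- (s * (fst u - snd u)\<^sup>2)) - exp (- (s * D\<^sup>2))) \<partial>(M \<Otimes>\<^sub>M N))
      = ennreal (gauss_form M N s - exp (- (s * D\<^sup>2)))"
    using nn_integral_eq_integral[OF i' nn] eq by simp
  show "exp (- (s * D\<^sup>2)) \<le> gauss_form M N s" using integral_nonneg_AE[OF nn] eq by simp
qed

lemma measurable_gauss_form: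
  assumes M: "M \<in> unit" and N: "N \<in> unit"
  shows "gauss_form M N \<in> borel_measurable borel"
proof -
  interpret M: prob_space M by (rule unitD[OF M])
  interpret N: prob_space N by (rule unitD[OF N])
  interpret P: pair_prob_space M N by unfold_locales
  have sN [measurable_cong]: "sets M = sets borel" "sets N = sets borel" using unitD(2) M N by auto
  show ?thesis unfolding gauss_form_def
    by (rule P.borel_measurable_lebesgue_integral) (simp add: case_prod_beta')
qed

text \<open>\<open>nn_integral_exp_diff\<close> with \<open>r = (x - t)\<^sup>2\<close> and
  \<open>R = D\<^sup>2\<close>, which explains the factor 2. It requires
  \<open>x \<noteq> t\<close>, and that holds almost everywhere because \<open>M\<close> has no
  atoms.\<close>

lemma mutual_eq_gauss:
  assumes M: "M \<in> unit" and N: "N \<in> unit" and atoms: "\<And>x. emeasure M {x} = 0"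
  shows "2 * mutual M N = (\<integral>\<^sup>+s. ennreal ((gauss_form M N s - exp (- (s * D\<^sup>2))) / s) * indicator {0<..} s \<partial>lborel)"
proof -
  interpret M: prob_space M by (rule unitD[OF M])
  interpret N: prob_space N by (rule unitD[OF N])
  interpret P: pair_prob_space M N by unfold_locales
  interpret Q: pair_sigma_finite "M \<Otimes>\<^sub>M N" lborel by unfold_locales
  have sN [measurable_cong]: "sets M = sets borel" "sets N = sets borel" using unitD(2) M N by auto
  define g where "g s u = (exp (- (s * (fst u - snd u)\<^sup>2)) - exp (- (s * D\<^sup>2))) / s" for s and u :: "real \<times> real"
  have [measurable]: "(\<lambda>v. g (fst v) (snd v)) \<in> borel_measurable (borel \<Otimes>\<^sub>M (borel \<Otimes>\<^sub>M borel))"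
    "(\<lambda>v. g (snd v) (fst v)) \<in> borel_measurable ((borel \<Otimes>\<^sub>M borel) \<Otimes>\<^sub>M borel)"
    unfolding g_def by measurable
  have gs [measurable]: "g s \<in> borel_measurable (borel \<Otimes>\<^sub>M borel)" for s
    unfolding g_def by measurable
  have gu [measurable]: "(\<lambda>s. g s u) \<in> borel_measurable borel" for u
    unfolding g_def by measurable
  have "AE y in N. AE x in M. x \<noteq> y"
  proof (rule AE_I2)
    fix y
    have "AE x in M. x \<notin> {y}" using atoms by (intro AE_not_in) (simp add: null_sets_def sN)
    then show "AE x in M. x \<noteq> y" by simp
  qed
  then have "AE x in M. AE y in N. x \<noteq> y" by (subst P.AE_commute) measurable
  then have ne: "AE u in M \<Otimes>\<^sub>M N. fst u \<noteq> snd u" by (subst P.AE_pair_iff[symmetric]) auto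
  have "2 * mutual M N = (\<integral>\<^sup>+y. \<integral>\<^sup>+x. 2 * log_pot D (x - y) \<partial>M \<partial>N)"
    unfolding mutual_def by (simp add: nn_integral_cmult log_pot_commute)
  also have "\<dots> = (\<integral>\<^sup>+u. 2 * log_pot D (fst u - snd u) \<partial>(M \<Otimes>\<^sub>M N))"
    by (subst P.nn_integral_snd[symmetric]) auto
  also have "\<dots> = (\<integral>\<^sup>+u. \<integral>\<^sup>+s. ennreal (g s u) * indicator {0<..} s \<partial>lborel \<partial>(M \<Otimes>\<^sub>M N))"
  proof (rule nn_integral_cong_AE)
    show "AE u in M \<Otimes>\<^sub>M N. 2 * log_pot D (fst u - snd u) = (\<integral>\<^sup>+s. ennreal (g s u) * indicator {0<..} s \<partial>lborel)"
      using ne AE_unit_pair[OF M N]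
    proof eventually_elim
      case (elim u)
      have abs: "\<bar>fst u - snd u\<bar> \<le> D" using elim by (auto simp: D_def)
      then have "\<bar>fst u - snd u\<bar> \<le> \<bar>D\<bar>" using D_pos by simp
      then have le: "(fst u - snd u)\<^sup>2 \<le> D\<^sup>2" by (simp only: abs_le_square_iff)
      have "ln (D\<^sup>2) - ln ((fst u - snd u)\<^sup>2) = 2 * ln (D / \<bar>fst u - snd u\<bar>)"
      proof -
        have "ln ((fst u - snd u)\<^sup>2) = ln (\<bar>fst u - snd u\<bar>\<^sup>2)" by simp
        also have "\<dots> = 2 * ln \<bar>fst u - snd u\<bar>" using elim by (subst ln_realpow) auto
        finally show ?thesis using elim D_pos by (simp add: ln_div ln_realpow)
      qed
      moreover have "0 \<le> ln (D / \<bar>fst u - snd u\<bar>)" using elim abs by simp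
      ultimately have "2 * log_pot D (fst u - snd u) = ennreal (ln (D\<^sup>2) - ln ((fst u - snd u)\<^sup>2))"
        using elim by (simp add: log_pot_def ennreal_mult)
      also have "\<dots> = (\<integral>\<^sup>+s. ennreal (g s u) * indicator {0<..} s \<partial>lborel)"
        unfolding g_def using elim le by (intro nn_integral_exp_diff[symmetric]) auto
      finally show ?case .
    qed
  qed
  also have "\<dots> = (\<integral>\<^sup>+s. \<integral>\<^sup>+u. ennreal (g s u) * indicator {0<..} s \<partial>(M \<Otimes>\<^sub>M N) \<partial>lborel)"
    by (rule Q.Fubini'[symmetric]) (simp add: case_prod_beta')
  also have "\<dots> = (\<integral>\<^sup>+s. ennreal ((gauss_form M N s - exp (- (s * D\<^sup>2))) / s) * indicator {0<..} s \<partial>lborel)"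
  proof (rule nn_integral_cong)
    fix s :: real
    show "(\<integral>\<^sup>+u. ennreal (g s u) * indicator {0<..} s \<partial>(M \<Otimes>\<^sub>M N)) = ennreal ((gauss_form M N s - exp (- (s * D\<^sup>2))) / s) * indicator {0<..} s"
    proof (cases "s > 0")
      case True
      have "(\<integral>\<^sup>+u. ennreal (g s u) \<partial>(M \<Otimes>\<^sub>M N)) = (\<integral>\<^sup>+u. ennreal (1 / s) * ennreal (exp (- (s * (fst u - snd u)\<^sup>2)) - exp (- (s * D\<^sup>2))) \<partial>(M \<Otimes>\<^sub>M N))"
        unfolding g_def using True by (intro nn_integral_cong) (simp add: ennreal_mult'[symmetric])
      also have "\<dots> = ennreal (1 / s) * ennreal (gauss_form M N s - exp (- (s * D\<^sup>2)))"
        using gauss_form_ge(1)[OF M N, of s] True by (subst nn_integral_cmult) auto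
      also have "\<dots> = ennreal ((gauss_form M N s - exp (- (s * D\<^sup>2))) / s)"
        using True by (simp add: ennreal_mult'[symmetric])
      finally show ?thesis using True by simp
    qed simp
  qed
  finally show ?thesis .
qed

text \<open>The hypothesis forces the nonnegative form \<open>q\<close> of \<open>M - N\<close> to
  have integral 0 against \<open>1 / s\<close>, so \<open>q\<close> vanishes for almost every
  \<open>s > 0\<close>. Along zeros tending to 0 the Gaussian moments agree and converge to the
  ordinary ones.\<close>

lemma moments_eq_of_mutual_le:
  assumes M: "M \<in> unit" and N: "N \<in> unit" and atoms: "\<And>x. emeasure M {x} = 0" "\<And>x. emeasure N {x} = 0"
    and fin: "mutual M N < \<infinity>" and le: "mutual M M + mutual N N \<le> 2 * mutual M N"
  shows "(\<integral>x. x ^ k \<partial>M) = (\<integral>x. x ^ k \<partial>N)"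
proof -
  interpret M: prob_space M by (rule unitD[OF M])
  interpret N: prob_space N by (rule unitD[OF N])
  have sN [measurable_cong]: "sets M = sets borel" "sets N = sets borel" using unitD(2) M N by auto
  note [measurable] = measurable_gauss_form[OF M M] measurable_gauss_form[OF N N] measurable_gauss_form[OF M N]
  define q where "q s = gauss_form M M s + gauss_form N N s - 2 * gauss_form M N s" for s
  have [measurable]: "q \<in> borel_measurable borel" unfolding q_def by measurable
  define h where "h M N s = ennreal ((gauss_form M N s - exp (- (s * D\<^sup>2))) / s) * indicator {0<..} s" for M N s
  have [measurable]: "h M M \<in> borel_measurable borel" "h N N \<in> borel_measurable borel" "h M N \<in> borel_measurable borel"
    unfolding h_def by measurable
  \<comment> \<open>The subtracted terms \<open>exp (- (s * D\<^sup>2))\<close> occur twice on each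
    side and cancel; the additive form avoids subtraction in \<open>ennreal\<close>.\<close>
  have pt: "h M M s + h N N s = 2 * h M N s + ennreal (q s / s) * indicator {0<..} s" for s
  proof (cases "s > 0")
    case True
    have nn: "0 \<le> (gauss_form M M s - exp (- (s * D\<^sup>2))) / s" "0 \<le> (gauss_form N N s - exp (- (s * D\<^sup>2))) / s"
      "0 \<le> (gauss_form M N s - exp (- (s * D\<^sup>2))) / s" "0 \<le> q s / s"
      using gauss_form_ge(2)[OF M M, of s] gauss_form_ge(2)[OF N N, of s] gauss_form_ge(2)[OF M N, of s]
        gauss_form_diff(1)[OF M N True] True by (auto simp: q_def)
    have sum: "ennreal x + ennreal y = 2 * ennreal v + ennreal u"
      if "0 \<le> x" "0 \<le> y" "0 \<le> v" "0 \<le> u" "x + y = 2 * v + u" for x y v u :: real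
    proof -
      have "ennreal x + ennreal y = ennreal (2 * v + u)" using that by (simp flip: ennreal_plus)
      then show ?thesis using that by (simp add: ennreal_mult')
    qed
    show ?thesis
      using sum[OF nn(1,2,3,4)] True
      by (simp add: h_def q_def divide_inverse algebra_simps)
  qed (simp add: h_def)
  have "2 * mutual M M + 2 * mutual N N = (\<integral>\<^sup>+s. h M M s + h N N s \<partial>lborel)"
    unfolding mutual_eq_gauss[OF M M atoms(1)] mutual_eq_gauss[OF N N atoms(2)] h_def[symmetric]
    by (simp add: nn_integral_add)
  also have "\<dots> = 2 * (2 * mutual M N) + (\<integral>\<^sup>+s. ennreal (q s / s) * indicator {0<..} s \<partial>lborel)"
    unfolding pt mutual_eq_gauss[OF M N atoms(1)] h_def[symmetric]
    by (subst nn_integral_add) (auto simp: nn_integral_cmult)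
  finally have eq: "2 * (mutual M M + mutual N N) = 2 * (2 * mutual M N) + (\<integral>\<^sup>+s. ennreal (q s / s) * indicator {0<..} s \<partial>lborel)"
    by (simp add: distrib_left)
  have "2 * (2 * mutual M N) + (\<integral>\<^sup>+s. ennreal (q s / s) * indicator {0<..} s \<partial>lborel) \<le> 2 * (2 * mutual M N) + 0"
    unfolding eq[symmetric] add_0_right using le by (rule mult_left_mono) simp
  moreover have "2 * (2 * mutual M N) < \<infinity>" using fin by (auto simp: ennreal_mult_less_top)
  ultimately have "(\<integral>\<^sup>+s. ennreal (q s / s) * indicator {0<..} s \<partial>lborel) = 0"
    by (subst (asm) ennreal_add_left_cancel_le) auto
  then have "AE s in lborel. ennreal (q s / s) * indicator {0<..} s = 0"
    by (subst (asm) nn_integral_0_iff_AE) auto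
  then have q0: "AE s in lborel. s > 0 \<longrightarrow> q s = 0"
    by eventually_elim (use gauss_form_diff(1)[OF M N] in \<open>force simp: q_def indicator_def ennreal_eq_0_iff divide_le_0_iff split: if_splits\<close>)
  \<comment> \<open>An exceptional null set cannot contain an interval
    \<open>{0<..<e}\<close>.\<close>
  have "\<exists>s. 0 < s \<and> s < e \<and> q s = 0" if "e > 0" for e
  proof (rule ccontr)
    assume neg: "\<not> ?thesis"
    have "AE s in lborel. s \<notin> {0<..<e}" using q0 by eventually_elim (use neg in auto)
    then have "{0<..<e} \<in> null_sets lborel" by (subst AE_iff_null_sets) auto
    then have "emeasure lborel {0<..<e} = 0" by auto
    then show False using that by simp
  qed
  then have "\<forall>n. \<exists>s. 0 < s \<and> s < 1 / real (Suc n) \<and> q s = 0" by simp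
  then obtain s where s: "\<And>n. 0 < s n" "\<And>n. s n < 1 / real (Suc n)" "\<And>n. q (s n) = 0" by metis
  have s0: "s \<longlonglongrightarrow> 0"
    by (rule tendsto_sandwich[OF _ _ tendsto_const LIMSEQ_Suc[OF lim_1_over_n]])
      (use s in \<open>auto intro!: always_eventually less_imp_le\<close>)
  have eqm: "gauss_mom M (s n) k = gauss_mom N (s n) k" for n
    using gauss_form_diff(2)[OF M N s(1)] s(3)[of n] unfolding q_def by blast
  have lim: "(\<lambda>n. gauss_mom L (s n) k) \<longlonglongrightarrow> (\<integral>x. x ^ k \<partial>L)" if L: "L \<in> unit" for L
  proof -
    have [measurable_cong]: "sets L = sets borel" using unitD(2) L by auto
    show ?thesis
      unfolding gauss_mom_def
    proof (rule integral_dominated_convergence[where w = "\<lambda>x. \<bar>x ^ k\<bar>"])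
      show "integrable L (\<lambda>x. \<bar>x ^ k\<bar>)" by (intro integrable_abs integrable_unit[OF L] continuous_intros)
      show "AE x in L. norm (x ^ k * exp (- (s n * x\<^sup>2))) \<le> \<bar>x ^ k\<bar>" for n
      proof (intro AE_I2)
        fix x
        have "exp (- (s n * x\<^sup>2)) \<le> 1" using s(1)[of n] by simp
        then have "\<bar>x ^ k\<bar> * exp (- (s n * x\<^sup>2)) \<le> \<bar>x ^ k\<bar> * 1" by (intro mult_left_mono) auto
        then show "norm (x ^ k * exp (- (s n * x\<^sup>2))) \<le> \<bar>x ^ k\<bar>" by (simp add: abs_mult)
      qed
      show "AE x in L. (\<lambda>n. x ^ k * exp (- (s n * x\<^sup>2))) \<longlonglongrightarrow> x ^ k"
      proof (intro AE_I2)
        fix x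
        have "(\<lambda>n. x ^ k * exp (- (s n * x\<^sup>2))) \<longlonglongrightarrow> x ^ k * exp (- (0 * x\<^sup>2))" by (intro tendsto_intros s0)
        then show "(\<lambda>n. x ^ k * exp (- (s n * x\<^sup>2))) \<longlonglongrightarrow> x ^ k" by simp
      qed
    qed measurable
  qed
  show ?thesis using LIMSEQ_unique[OF lim[OF M]] lim[OF N] by (simp add: eqm)
qed

end

context minimizer
begin

lemma minimizer_roots_exists: "\<exists>\<alpha> \<beta>. minimizer_roots K p z M \<alpha> \<beta>"
proof -
  have "\<forall>i\<in>{1..<K}. \<exists>\<alpha> \<beta>. z i < \<alpha> \<and> \<alpha> \<le> \<beta> \<and> \<beta> < z (Suc i) \<and> [:- \<alpha>, 1:] * [:- \<beta>, 1:] dvd curve"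
    using curve_root_pair_exists by blast
  then obtain \<alpha> \<beta> where "\<And>i. i \<in> {1..<K} \<Longrightarrow> z i < \<alpha> i \<and> \<alpha> i \<le> \<beta> i \<and> \<beta> i < z (Suc i) \<and> [:- \<alpha> i, 1:] * [:- \<beta> i, 1:] dvd curve"
    by metis
  then have "minimizer_roots K p z M \<alpha> \<beta>"
    by (intro minimizer_roots.intro minimizer_axioms minimizer_roots_axioms.intro)
  then show ?thesis by blast
qed

lemma dens_le: obtains B where "\<And>x. dens x \<le> B"
  using minimizer_roots_exists minimizer_roots.dens_bounded by blast

text \<open>In the sum of the two variational inequalities, each minimizer tested against the other,
  the external terms cancel. What remains is that the form of \<open>N - M\<close> is not
  positive.\<close>

lemma minimizer_unique:
  assumes N: "minimizer K p z N"
  shows "N = M"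
proof -
  interpret N: minimizer K p z N by (rule N)
  obtain B C where B: "\<And>x. dens x \<le> B" and C: "\<And>x. N.dens x \<le> C"
    using dens_le N.dens_le by metis
  note 1 = mutual_le_sum[OF M M_eq_density N.M N.M_eq_density measurable_dens N.measurable_dens dens_nonneg B N.dens_nonneg C minimal]
  note 2 = mutual_le_sum[OF N.M N.M_eq_density M M_eq_density N.measurable_dens measurable_dens N.dens_nonneg C dens_nonneg B N.minimal]
  have "mutual M M + mutual N N \<le> 2 * mutual M N"
  proof -
    have "(mutual M M + (\<integral>\<^sup>+x. ext_pot x \<partial>M)) + (mutual N N + (\<integral>\<^sup>+x. ext_pot x \<partial>N))
      \<le> (mutual M N + (\<integral>\<^sup>+x. ext_pot x \<partial>N)) + (mutual N M + (\<integral>\<^sup>+x. ext_pot x \<partial>M))"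
      by (rule add_mono[OF 1(1) 2(1)])
    then have "((\<integral>\<^sup>+x. ext_pot x \<partial>M) + (\<integral>\<^sup>+x. ext_pot x \<partial>N)) + (mutual M M + mutual N N)
      \<le> ((\<integral>\<^sup>+x. ext_pot x \<partial>M) + (\<integral>\<^sup>+x. ext_pot x \<partial>N)) + 2 * mutual M N"
      unfolding mutual_commute[OF N.M M] by (simp add: mult_2 ac_simps)
    moreover have "(\<integral>\<^sup>+x. ext_pot x \<partial>M) + (\<integral>\<^sup>+x. ext_pot x \<partial>N) < \<infinity>" using 1 by (simp add: ennreal_add_less_top)
    ultimately show ?thesis by (subst (asm) ennreal_add_left_cancel_le) auto
  qed
  then have "(\<integral>x. x ^ k \<partial>M) = (\<integral>x. x ^ k \<partial>N)" for k
    using moments_eq_of_mutual_le[OF M N.M no_atoms N.no_atoms 1(3)] by blast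
  \<comment> \<open>Equal moments give the same \<open>curve\<close>, and \<open>dens\<close> is an
    explicit function of it, so the densities coincide.\<close>
  then have "mom = N.mom" by (auto simp: mom_def N.mom_def fun_eq_iff)
  then have "curve = N.curve" by (simp add: curve_def N.curve_def)
  then have "dens = N.dens" by (auto simp: dens_def N.dens_def fun_eq_iff)
  then show ?thesis using M_eq_density N.M_eq_density by simp
qed

end

section \<open>Bands, gaps and principal values\<close>

text \<open>
  In contrast to \<^const>\<open>pv_integral_has_value\<close>, where a non-integrable function has integral \<open>0\<close>, this demands
  integrability off the excised neighbourhoods, which makes it additive in the interval.
\<close>
definition pv_has_integral :: "(real \<Rightarrow> real) \<Rightarrow> real \<Rightarrow> real \<Rightarrow> real set \<Rightarrow> real \<Rightarrow> bool" where
  "pv_has_integral f c d Zs v \<longleftrightarrow> (\<exists>I.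
     (\<forall>\<^sub>F \<epsilon> in at_right 0. (f has_integral I \<epsilon>) ({c..d} - (\<Union>\<zeta>\<in>Zs. {\<zeta> - \<epsilon><..<\<zeta> + \<epsilon>}))) \<and>
     (I \<longlongrightarrow> v) (at_right 0))"

lemma pv_has_integral_imp:
  assumes "pv_has_integral f c d Zs v" shows "pv_integral_has_value f c d Zs v"
proof -
  obtain I where I: "\<forall>\<^sub>F \<epsilon> in at_right 0. (f has_integral I \<epsilon>) ({c..d} - (\<Union>\<zeta>\<in>Zs. {\<zeta> - \<epsilon><..<\<zeta> + \<epsilon>}))"
    and lim: "(I \<longlongrightarrow> v) (at_right 0)" using assms unfolding pv_has_integral_def by blast
  have ev: "\<forall>\<^sub>F \<epsilon> in at_right 0. I \<epsilon> = integral ({c..d} - (\<Union>\<zeta>\<in>Zs. {\<zeta> - \<epsilon><..<\<zeta> + \<epsilon>})) f"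
    using I by eventually_elim (simp add: integral_unique)
  show ?thesis unfolding pv_integral_has_value_def by (rule iffD1[OF tendsto_cong[OF ev] lim])
qed

lemma pv_has_integral_combine:
  assumes "c \<le> e" "e \<le> d" "pv_has_integral f c e Zs v" "pv_has_integral f e d Zs v'"
  shows "pv_has_integral f c d Zs (v + v')"
proof -
  define N where "N \<epsilon> = (\<Union>\<zeta>\<in>Zs. {\<zeta> - \<epsilon><..<\<zeta> + \<epsilon>})" for \<epsilon>
  obtain I J where I: "\<forall>\<^sub>F \<epsilon> in at_right 0. (f has_integral I \<epsilon>) ({c..e} - N \<epsilon>)" "(I \<longlongrightarrow> v) (at_right 0)"
    and J: "\<forall>\<^sub>F \<epsilon> in at_right 0. (f has_integral J \<epsilon>) ({e..d} - N \<epsilon>)" "(J \<longlongrightarrow> v') (at_right 0)"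
    using assms unfolding pv_has_integral_def N_def by blast
  have "\<forall>\<^sub>F \<epsilon> in at_right 0. (f has_integral (I \<epsilon> + J \<epsilon>)) ({c..d} - N \<epsilon>)"
    using I(1) J(1)
  proof eventually_elim
    case (elim \<epsilon>)
    have "negligible (({c..e} - N \<epsilon>) \<inter> ({e..d} - N \<epsilon>))"
      by (rule negligible_subset[of "{e}"]) auto
    from has_integral_Un[OF elim this] have "(f has_integral (I \<epsilon> + J \<epsilon>)) (({c..e} - N \<epsilon>) \<union> ({e..d} - N \<epsilon>))" .
    moreover have "({c..e} - N \<epsilon>) \<union> ({e..d} - N \<epsilon>) = {c..d} - N \<epsilon>" using assms(1,2) by auto
    ultimately show ?case by simp
  qed
  moreover have "((\<lambda>\<epsilon>. I \<epsilon> + J \<epsilon>) \<longlongrightarrow> v + v') (at_right 0)" by (intro tendsto_add I J)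
  ultimately show ?thesis unfolding pv_has_integral_def N_def by (intro exI[of _ "\<lambda>\<epsilon>. I \<epsilon> + J \<epsilon>"] conjI)
qed

section \<open>Splitting \<open>T\<close> into \<open>R\<close> and \<open>P\<close>, signs, and
  integrals over the gaps\<close>

context minimizer_roots
begin

definition bands :: "nat set" where "bands = {i\<in>{1..<K}. \<alpha> i < \<beta> i}"

text \<open>One factor for each double root: off \<open>bands\<close> the two roots of a pair
  coincide, so \<open>T = (1 + p)^2 R P^2\<close>.\<close>

definition P_poly :: "real poly" where "P_poly = (\<Prod>i\<in>{1..<K} - bands. [:- \<alpha> i, 1:])"

definition R_fun :: "real \<Rightarrow> real" where "R_fun x = (\<Prod>i\<in>bands. (x - \<alpha> i) * (x - \<beta> i))"

definition Q_fun :: "real \<Rightarrow> real" where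
  "Q_fun x = sqrt \<bar>R_fun x\<bar> * poly P_poly x / poly Pi_poly x"

lemma finite_bands: "finite bands" and bands_subset: "bands \<subseteq> {1..<K}"
  by (auto simp: bands_def)

lemma degree_P_poly: "degree P_poly = K - card bands - 1" and lead_coeff_P_poly: "lead_coeff P_poly = 1"
proof -
  have "degree P_poly = card ({1..<K} - bands)"
    unfolding P_poly_def by (subst degree_prod_eq_sum_degree) auto
  also have "\<dots> = K - card bands - 1"
    using bands_subset finite_bands by (subst card_Diff_subset) auto
  finally show "degree P_poly = K - card bands - 1" .
  show "lead_coeff P_poly = 1" unfolding P_poly_def by (subst lead_coeff_prod) auto
qed

lemma poly_P_poly: "poly P_poly x = (\<Prod>i\<in>{1..<K} - bands. x - \<alpha> i)"
  by (simp add: P_poly_def poly_prod)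

lemma curve_eq: "poly curve x = (1 + ptot)\<^sup>2 * R_fun x * (poly P_poly x)\<^sup>2"
proof -
  have "(\<Prod>i=1..<K. (x - \<alpha> i) * (x - \<beta> i))
     = (\<Prod>i\<in>{1..<K} - bands. (x - \<alpha> i) * (x - \<beta> i)) * (\<Prod>i\<in>bands. (x - \<alpha> i) * (x - \<beta> i))"
    by (rule prod.subset_diff[OF bands_subset]) simp
  also have "(\<Prod>i\<in>{1..<K} - bands. (x - \<alpha> i) * (x - \<beta> i)) = (\<Prod>i\<in>{1..<K} - bands. (x - \<alpha> i)\<^sup>2)"
  proof (rule prod.cong[OF refl])
    fix i assume i: "i \<in> {1..<K} - bands"
    then have "\<alpha> i = \<beta> i" using roots[of i] by (auto simp: bands_def)
    then show "(x - \<alpha> i) * (x - \<beta> i) = (x - \<alpha> i)\<^sup>2" by (simp add: power2_eq_square)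
  qed
  finally show ?thesis by (simp add: poly_curve R_fun_def poly_P_poly prod_power_distrib)
qed

lemma sqrt_curve: "sqrt \<bar>poly curve x\<bar> = (1 + ptot) * (sqrt \<bar>R_fun x\<bar> * \<bar>poly P_poly x\<bar>)"
  unfolding curve_eq using ptot_pos by (simp add: abs_mult real_sqrt_mult)

lemma sgn_P_poly:
  assumes "\<And>i. i \<in> {1..<K} - bands \<Longrightarrow> x \<noteq> \<alpha> i"
  shows "sgn (poly P_poly x) = (-1) ^ card {i\<in>{1..<K} - bands. x < \<alpha> i}"
  unfolding poly_P_poly by (rule sgn_prod_diff) (use assms in auto)

text \<open>The sign \<open>(-1) ^ (K - j)\<close> of the root of \<open>T\<close> counts all pairs
  to the right of the segment. The double roots among them are absorbed by the sign changes of
  \<open>P\<close>, so only bands are counted in the end.\<close>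

lemma resolvent_Q:
  assumes j: "j \<in> {1..K}" and x: "x \<in> seg j"
  shows "resolvent x = (-1) ^ card {i\<in>bands. j \<le> i} * (1 + ptot) * (sqrt \<bar>R_fun x\<bar> * poly P_poly x)"
proof -
  have set: "{i\<in>{1..<K} - bands. x < \<alpha> i} = {i\<in>{1..<K} - bands. j \<le> i}"
    using x roots by (force simp: seg_def not_le[symmetric])
  have "sgn (poly P_poly x) = (-1) ^ card {i\<in>{1..<K} - bands. j \<le> i}"
    unfolding set[symmetric]
  proof (rule sgn_P_poly)
    fix i assume "i \<in> {1..<K} - bands"
    then have i: "i \<in> {1..<K}" by simp
    show "x \<noteq> \<alpha> i" using x i roots[OF i] unfolding seg_def by (cases "i < j") fastforce+
  qed
  then have P: "\<bar>poly P_poly x\<bar> = (-1) ^ card {i\<in>{1..<K} - bands. j \<le> i} * poly P_poly x"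
    by (metis abs_sgn mult.commute)
  have "card {i\<in>{1..<K} - bands. j \<le> i} + card {i\<in>bands. j \<le> i} = card ({i\<in>{1..<K} - bands. j \<le> i} \<union> {i\<in>bands. j \<le> i})"
    using finite_bands by (intro card_Un_disjoint[symmetric]) auto
  also have "{i\<in>{1..<K} - bands. j \<le> i} \<union> {i\<in>bands. j \<le> i} = {j..<K}" using bands_subset j by auto
  finally have c: "card {i\<in>{1..<K} - bands. j \<le> i} + card {i\<in>bands. j \<le> i} = K - j" by simp
  have "(-1) ^ (K - j) * (-1) ^ card {i\<in>{1..<K} - bands. j \<le> i} = ((-1) ^ card {i\<in>bands. j \<le> i} :: real)"
    unfolding c[symmetric] by (simp add: power_add minus_one_power_iff)
  moreover have "resolvent x = (-1) ^ (K - j) * ((1 + ptot) * (sqrt \<bar>R_fun x\<bar> * \<bar>poly P_poly x\<bar>))"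
    unfolding resolvent_seg[OF j x] sqrt_curve[symmetric] using curve_pos_seg[OF x] by simp
  ultimately show ?thesis unfolding P by (simp add: mult_ac)
qed

text \<open>On band \<open>i\<close> the sign of \<open>Pi\<close> counts the \<open>K - i\<close>
  charges to the right and that of \<open>P\<close> the double roots to the right. Their product
  leaves the bands to the right plus one, the latter because charges outnumber pairs by one.\<close>

lemma dens_Q:
  assumes i: "i \<in> bands" and x: "x \<in> {\<alpha> i..\<beta> i}"
  shows "dens x = (-1) ^ Suc (card {m\<in>bands. i < m}) * (1 + ptot) * Q_fun x / pi"
proof -
  have i': "i \<in> {1..<K}" "\<alpha> i < \<beta> i" using i by (auto simp: bands_def)
  have le: "poly curve x \<le> 0"
  proof (cases "x = \<alpha> i \<or> x = \<beta> i")
    case True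
    then have "R_fun x = 0" unfolding R_fun_def using i finite_bands by (intro prod_zero bexI[of _ i]) auto
    then show ?thesis by (simp add: curve_eq)
  next
    case False
    then have "poly curve x < 0" using x by (intro curve_neg_band[OF i'(1)]) auto
    then show ?thesis by simp
  qed
  have off: "x < \<alpha> m \<longleftrightarrow> i < m" "x \<noteq> \<alpha> m" if "m \<in> {1..<K} - bands" for m
  proof -
    have m: "m \<in> {1..<K}" "m \<noteq> i" using that i by auto
    then consider "m < i" | "i < m" by linarith
    then have "(x < \<alpha> m \<longleftrightarrow> i < m) \<and> x \<noteq> \<alpha> m"
      by cases (use roots_sep[OF m(1) i'(1)] roots_sep[OF i'(1) m(1)] roots[OF m(1)] x in auto)
    then show "x < \<alpha> m \<longleftrightarrow> i < m" "x \<noteq> \<alpha> m" by auto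
  qed
  have offz: "x < z j \<longleftrightarrow> i < j" "x \<noteq> z j" if "j \<in> {1..K}" for j
    using roots[OF i'(1)] z_mono[of j i] z_mono[of "Suc i" j] that i'(1) x
    by (cases "j \<le> i"; auto)+
  have "sgn (poly P_poly x) = (-1) ^ card {m\<in>{1..<K} - bands. x < \<alpha> m}" by (rule sgn_P_poly) (use off in auto)
  also have "{m\<in>{1..<K} - bands. x < \<alpha> m} = {m\<in>{1..<K} - bands. i < m}" using off by auto
  finally have sP: "sgn (poly P_poly x) = (-1) ^ card {m\<in>{1..<K} - bands. i < m}" .
  have "sgn (poly Pi_poly x) = (-1) ^ card {j\<in>{1..K}. x < z j}"
    unfolding poly_Pi_poly by (rule sgn_prod_diff) (use offz in auto)
  also have "{j\<in>{1..K}. x < z j} = {i<..K}" using offz(1) i' by auto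
  finally have sPi: "sgn (poly Pi_poly x) = (-1) ^ (K - i)" by simp
  have "card {m\<in>{1..<K} - bands. i < m} + card {m\<in>bands. i < m} = card ({m\<in>{1..<K} - bands. i < m} \<union> {m\<in>bands. i < m})"
    using finite_bands by (intro card_Un_disjoint[symmetric]) auto
  also have "{m\<in>{1..<K} - bands. i < m} \<union> {m\<in>bands. i < m} = {i<..<K}" using bands_subset i' by auto
  finally have c: "card {m\<in>{1..<K} - bands. i < m} + card {m\<in>bands. i < m} = K - i - 1" by simp
  have "K - i = Suc (card {m\<in>{1..<K} - bands. i < m} + card {m\<in>bands. i < m})"
    unfolding c using i'(1) by auto
  then have "(-1) ^ card {m\<in>{1..<K} - bands. i < m} * (-1) ^ (K - i) = ((-1) ^ Suc (card {m\<in>bands. i < m}) :: real)"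
    by (simp add: power_add minus_one_power_iff)
  then have s: "sgn (poly P_poly x / poly Pi_poly x) = (-1) ^ Suc (card {m\<in>bands. i < m})"
    unfolding sgn_divide sP sPi by (simp add: minus_one_power_iff split: if_splits)
  have "dens x = sqrt \<bar>poly curve x\<bar> / (pi * \<bar>poly Pi_poly x\<bar>)" using le by (simp add: dens_def max_def)
  also have "\<dots> = (1 + ptot) * sqrt \<bar>R_fun x\<bar> * \<bar>poly P_poly x / poly Pi_poly x\<bar> / pi"
    unfolding sqrt_curve by (simp add: abs_divide mult.assoc mult.commute[of pi])
  also have "\<bar>poly P_poly x / poly Pi_poly x\<bar> = (-1) ^ Suc (card {m\<in>bands. i < m}) * (poly P_poly x / poly Pi_poly x)"
    unfolding s[symmetric] by (simp add: abs_sgn mult.commute)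
  finally show ?thesis by (simp add: Q_fun_def)
qed

text \<open>\<open>resolvent_Q\<close> at a charge, where the term \<open>Pi G\<close> drops out and
  only the known value of \<open>N\<close> remains.\<close>

lemma poly_P_poly_z:
  assumes j: "j \<in> {1..K}"
  shows "poly P_poly (z j) = (-1) ^ card {i\<in>bands. j \<le> i} * p j * (\<Prod>m\<in>{1..K} - {j}. z j - z m)
    / ((1 + ptot) * sqrt \<bar>R_fun (z j)\<bar>)"
proof -
  have ne: "(1 + ptot) * sqrt \<bar>R_fun (z j)\<bar> \<noteq> 0"
    using curve_z[OF j] ptot_pos by (auto simp: curve_eq)
  have "p j * (\<Prod>m\<in>{1..K} - {j}. z j - z m)
     = (-1) ^ card {i\<in>bands. j \<le> i} * (1 + ptot) * (sqrt \<bar>R_fun (z j)\<bar> * poly P_poly (z j))"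
    using resolvent_Q[OF j z_in_seg[OF j]] resolvent_z[OF j] poly_residue_poly_z[OF j] by simp
  then have "(-1) ^ card {i\<in>bands. j \<le> i} * (p j * (\<Prod>m\<in>{1..K} - {j}. z j - z m))
     = ((-1) ^ card {i\<in>bands. j \<le> i} * (-1) ^ card {i\<in>bands. j \<le> i}) * (((1 + ptot) * sqrt \<bar>R_fun (z j)\<bar>) * poly P_poly (z j))"
    by (simp only: mult_ac)
  also have "(-1) ^ card {i\<in>bands. j \<le> i} * (-1) ^ card {i\<in>bands. j \<le> i} = (1::real)"
    by (simp add: minus_one_power_iff)
  finally show ?thesis using ne by (simp add: field_simps)
qed

text \<open>On either side of the only charge of the segment, \<open>Q_fun\<close> is the derivative
  of a multiple of \<open>eff_potential\<close>. The logarithmic singularity takes the same value at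
  equal distances on the two sides, so it cancels in the principal value and only the difference
  between the ends is left.\<close>

lemma pv_segment:
  assumes j: "j - 1 \<in> {1..<K}" "j \<in> {1..<K}"
  shows "pv_has_integral Q_fun (\<beta> (j - 1)) (\<alpha> j) Z
    ((-1) ^ card {i\<in>bands. j \<le> i} / (1 + ptot) * (eff_potential (\<alpha> j) - eff_potential (\<beta> (j - 1))))"
proof -
  have j': "j \<in> {1..K}" "j - 1 \<in> {1..K}" "Suc j \<in> {1..K}" "Suc (j - 1) = j" using j by auto
  define c d where "c = \<beta> (j - 1)" "d = \<alpha> j"
  define k where "k = (-1) ^ card {i\<in>bands. j \<le> i} / (1 + ptot)"
  define G where "G x = k * eff_potential x" for x
  have ord: "z (j - 1) < c" "c < z j" "z j < d" "d < z (Suc j)"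
    using roots[OF j(1)] roots[OF j(2)] j'(4) by (auto simp: c_d_def)
  have k2: "k * ((-1) ^ card {i\<in>bands. j \<le> i} * (1 + ptot)) = 1"
    using ptot_pos by (simp add: k_def minus_one_power_iff)
  have seg: "x \<in> seg j" if "c < x" "x < d" for x
  proof -
    have "\<beta> i < x" if "i \<in> {1..<K}" "i < j" for i
    proof (cases "i = j - 1")
      case False
      then have "i < j - 1" using that by auto
      then show ?thesis using roots_sep[OF that(1) j(1)] roots[OF j(1)] \<open>c < x\<close> by (auto simp: c_d_def)
    qed (use \<open>c < x\<close> in \<open>simp add: c_d_def\<close>)
    moreover have "x < \<alpha> i" if "i \<in> {1..<K}" "j \<le> i" for i
      using roots_sep[of j i] roots[OF j(2)] that j \<open>x < d\<close> by (cases "i = j") (auto simp: c_d_def)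
    ultimately show ?thesis by (auto simp: seg_def)
  qed
  have notZ: "x \<notin> Z" if le: "c \<le> x" "x \<le> d" "x \<noteq> z j" for x
  proof
    assume "x \<in> Z"
    then obtain m where m: "m \<in> {1..K}" "x = z m" by auto
    then have "m \<noteq> j" using le(3) by auto
    then consider "m \<le> j - 1" | "Suc j \<le> m" by linarith
    then show False
      using z_mono[of m "j - 1"] z_mono[of "Suc j" m] m ord le j' by cases auto
  qed
  have deriv: "(G has_vector_derivative Q_fun x) (at x)" if "c < x" "x < d" "x \<noteq> z j" for x
  proof -
    have "(G has_real_derivative k * (resolvent x / poly Pi_poly x)) (at x)"
      unfolding G_def using that seg curve_pos_seg notZ by (intro DERIV_cmult eff_potential_deriv) auto
    also have "k * (resolvent x / poly Pi_poly x)
       = (k * ((-1) ^ card {i\<in>bands. j \<le> i} * (1 + ptot))) * Q_fun x"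
      unfolding resolvent_Q[OF j'(1) seg[OF that(1,2)]] Q_fun_def by simp
    finally show ?thesis unfolding k2 by (simp add: has_real_derivative_iff_has_vector_derivative)
  qed
  have cont: "isCont G x" if "c \<le> x" "x \<le> d" "x \<noteq> z j" for x
    unfolding G_def using notZ[OF that] by (intro continuous_intros isCont_eff_potential)
  define I where "I \<epsilon> = (G (z j - \<epsilon>) - G c) + (G d - G (z j + \<epsilon>))" for \<epsilon>
  \<comment> \<open>Below this size the hole around \<open>z j\<close> stays inside the segment, and
    the holes around the neighbouring charges do not reach it.\<close>
  define e0 where "e0 = min (min (z j - c) (d - z j)) (min (c - z (j - 1)) (z (Suc j) - d))"
  have e0: "e0 > 0" using ord by (simp add: e0_def)
  have "(Q_fun has_integral I \<epsilon>) ({c..d} - (\<Union>\<zeta>\<in>Z. {\<zeta> - \<epsilon><..<\<zeta> + \<epsilon>}))" if e: "0 < \<epsilon>" "\<epsilon> < e0" for \<epsilon>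
  proof -
    have e': "\<epsilon> < z j - c" "\<epsilon> < d - z j" "\<epsilon> < c - z (j - 1)" "\<epsilon> < z (Suc j) - d" using e by (auto simp: e0_def)
    have "(Q_fun has_integral (G (z j - \<epsilon>) - G c)) {c..z j - \<epsilon>}"
      using e e' deriv cont
      by (intro fundamental_theorem_of_calculus_interior continuous_at_imp_continuous_on) auto
    moreover have "(Q_fun has_integral (G d - G (z j + \<epsilon>))) {z j + \<epsilon>..d}"
      using e e' deriv cont
      by (intro fundamental_theorem_of_calculus_interior continuous_at_imp_continuous_on) auto
    moreover have "negligible ({c..z j - \<epsilon>} \<inter> {z j + \<epsilon>..d})"
    proof -
      have "{c..z j - \<epsilon>} \<inter> {z j + \<epsilon>..d} = {}" using e by auto
      then show ?thesis by simp
    qed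
    ultimately have "(Q_fun has_integral I \<epsilon>) ({c..z j - \<epsilon>} \<union> {z j + \<epsilon>..d})"
      unfolding I_def by (rule has_integral_Un)
    also have "{c..z j - \<epsilon>} \<union> {z j + \<epsilon>..d} = {c..d} - (\<Union>\<zeta>\<in>Z. {\<zeta> - \<epsilon><..<\<zeta> + \<epsilon>})"
    proof (intro set_eqI iffI)
      fix x assume x: "x \<in> {c..z j - \<epsilon>} \<union> {z j + \<epsilon>..d}"
      have "x \<notin> {z m - \<epsilon><..<z m + \<epsilon>}" if m: "m \<in> {1..K}" for m
      proof -
        consider "m = j" | "m \<le> j - 1" | "Suc j \<le> m" by linarith
        then show ?thesis
          by cases (use x e' z_mono[of m "j - 1"] z_mono[of "Suc j" m] m j' in auto)
      qed
      then show "x \<in> {c..d} - (\<Union>\<zeta>\<in>Z. {\<zeta> - \<epsilon><..<\<zeta> + \<epsilon>})" using x e e' by auto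
    next
      fix x assume "x \<in> {c..d} - (\<Union>\<zeta>\<in>Z. {\<zeta> - \<epsilon><..<\<zeta> + \<epsilon>})"
      then show "x \<in> {c..z j - \<epsilon>} \<union> {z j + \<epsilon>..d}" using j'(1) by force
    qed
    finally show ?thesis .
  qed
  then have "\<forall>\<^sub>F \<epsilon> in at_right 0. (Q_fun has_integral I \<epsilon>) ({c..d} - (\<Union>\<zeta>\<in>Z. {\<zeta> - \<epsilon><..<\<zeta> + \<epsilon>}))"
    using e0 by (auto simp: eventually_at_right[of 0 1])
  moreover have "(I \<longlongrightarrow> k * (eff_potential d - eff_potential c)) (at_right 0)"
  proof -
    have shift: "((\<lambda>\<epsilon>::real. z j - \<epsilon>) \<longlongrightarrow> z j) (at_right 0)" "((\<lambda>\<epsilon>::real. z j + \<epsilon>) \<longlongrightarrow> z j) (at_right 0)"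
      by (auto intro!: tendsto_eq_intros)
    have U: "((\<lambda>\<epsilon>. log_potential (z j - \<epsilon>) - log_potential (z j + \<epsilon>)) \<longlongrightarrow> log_potential (z j) - log_potential (z j)) (at_right 0)"
      by (intro tendsto_diff isCont_tendsto_compose[OF isCont_log_potential] shift)
    \<comment> \<open>For \<open>m = j\<close> the difference is exactly 0, since both points have
      distance \<epsilon> from the charge; the other terms are continuous.\<close>
    have V: "((\<lambda>\<epsilon>. p m * (ln \<bar>z j - \<epsilon> - z m\<bar> - ln \<bar>z j + \<epsilon> - z m\<bar>)) \<longlongrightarrow> 0) (at_right 0)" if m: "m \<in> {1..K}" for m
    proof (cases "m = j")
      case False
      then have "z j \<noteq> z m" using inj_onD[OF z_inj, of j m] m j' by auto
      then have "((\<lambda>\<epsilon>. p m * (ln \<bar>z j - \<epsilon> - z m\<bar> - ln \<bar>z j + \<epsilon> - z m\<bar>)) \<longlongrightarrow> p m * (ln \<bar>z j - z m\<bar> - ln \<bar>z j - z m\<bar>)) (at_right 0)"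
        by (intro tendsto_intros shift) auto
      then show ?thesis by simp
    qed simp
    have "((\<lambda>\<epsilon>. (log_potential (z j - \<epsilon>) - log_potential (z j + \<epsilon>))
        + (\<Sum>m=1..K. p m * (ln \<bar>z j - \<epsilon> - z m\<bar> - ln \<bar>z j + \<epsilon> - z m\<bar>))) \<longlongrightarrow>
        (log_potential (z j) - log_potential (z j)) + (\<Sum>m=1..K. 0)) (at_right 0)"
      by (intro tendsto_add U tendsto_sum V)
    then have "((\<lambda>\<epsilon>. eff_potential (z j - \<epsilon>) - eff_potential (z j + \<epsilon>)) \<longlongrightarrow> 0) (at_right 0)"
      by (simp add: eff_potential_def right_diff_distrib sum_subtractf algebra_simps)
    then have "((\<lambda>\<epsilon>. k * (eff_potential (z j - \<epsilon>) - eff_potential (z j + \<epsilon>)) + k * (eff_potential d - eff_potential c))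
        \<longlongrightarrow> k * 0 + k * (eff_potential d - eff_potential c)) (at_right 0)"
      by (intro tendsto_intros)
    moreover have "I = (\<lambda>\<epsilon>. k * (eff_potential (z j - \<epsilon>) - eff_potential (z j + \<epsilon>)) + k * (eff_potential d - eff_potential c))"
      by (simp add: fun_eq_iff I_def G_def algebra_simps)
    ultimately show ?thesis by (simp only: mult_zero_right add_0_left)
  qed
  ultimately show ?thesis unfolding pv_has_integral_def c_d_def k_def by blast
qed

text \<open>Between consecutive bands lie segments joined at double roots. No band is passed, so the
  sign factor is the same on all of them and the differences of the potential telescope to the
  difference between two band edges, where it takes the same value.\<close>

lemma pv_gap:
  assumes i: "i \<in> bands" "i' \<in> bands" "i < i'" and gap: "\<And>m. i < m \<Longrightarrow> m < i' \<Longrightarrow> m \<notin> bands"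
  shows "pv_has_integral Q_fun (\<beta> i) (\<alpha> i') Z 0"
proof -
  have i1: "i \<in> {1..<K}" "i' \<in> {1..<K}" using i bands_subset by auto
  \<comment> \<open>Induction over the segments. The sign factor is written with \<open>i'\<close>
    rather than \<open>m\<close>, so that it stays fixed during the induction.\<close>
  have "i < m \<Longrightarrow> m \<le> i' \<Longrightarrow> pv_has_integral Q_fun (\<beta> i) (\<alpha> m) Z
      ((-1) ^ card {n\<in>bands. i' \<le> n} / (1 + ptot) * (eff_potential (\<alpha> m) - eff_potential (\<beta> i)))" for m
  proof (induction m)
    case (Suc m)
    then have m: "Suc m \<in> {1..<K}" "Suc m - 1 \<in> {1..<K}" using i1 by auto
    have "{n\<in>bands. Suc m \<le> n} = {n\<in>bands. i' \<le> n}"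
    proof (intro set_eqI iffI)
      fix n assume "n \<in> {n\<in>bands. Suc m \<le> n}"
      then show "n \<in> {n\<in>bands. i' \<le> n}" using gap[of n] Suc.prems by (cases "n < i'") auto
    qed (use Suc.prems in auto)
    with pv_segment[OF m(2,1)] have seg: "pv_has_integral Q_fun (\<beta> m) (\<alpha> (Suc m)) Z
      ((-1) ^ card {n\<in>bands. i' \<le> n} / (1 + ptot) * (eff_potential (\<alpha> (Suc m)) - eff_potential (\<beta> m)))" by simp
    show ?case
    proof (cases "m = i")
      case False
      then have "i < m" "m < i'" using Suc.prems by auto
      then have "m \<notin> bands" using gap by blast
      then have eq: "\<alpha> m = \<beta> m" using roots[of m] m by (force simp: bands_def)
      have "\<beta> i \<le> \<beta> m" "\<beta> m \<le> \<alpha> (Suc m)"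
        using roots_sep[of i m] roots_sep[of m "Suc m"] roots[of m] i1 m \<open>i < m\<close> eq by auto
      then have "pv_has_integral Q_fun (\<beta> i) (\<alpha> (Suc m)) Z
        ((-1) ^ card {n\<in>bands. i' \<le> n} / (1 + ptot) * (eff_potential (\<beta> m) - eff_potential (\<beta> i)) +
         (-1) ^ card {n\<in>bands. i' \<le> n} / (1 + ptot) * (eff_potential (\<alpha> (Suc m)) - eff_potential (\<beta> m)))"
        using Suc.IH[OF \<open>i < m\<close>] \<open>m < i'\<close> seg unfolding eq by (intro pv_has_integral_combine) auto
      moreover have "k * (b - a) + k * (c - b) = k * (c - a)" for k a b c :: real
        by (simp add: algebra_simps)
      ultimately show ?thesis by (simp only:)
    qed (use seg in simp)
  qed simp
  from this[of i'] have "pv_has_integral Q_fun (\<beta> i) (\<alpha> i') Z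
      ((-1) ^ card {n\<in>bands. i' \<le> n} / (1 + ptot) * (eff_potential (\<alpha> i') - eff_potential (\<beta> i)))" using i by simp
  moreover have "eff_potential (\<alpha> i') = eff_potential (\<beta> i)"
    using eff_potential_band[of i' "\<alpha> i'"] eff_potential_band[of i "\<beta> i"] i by (auto simp: bands_def)
  ultimately show ?thesis by simp
qed

lemma measure_support_M: "measure_support M = (\<Union>i\<in>bands. {\<alpha> i..\<beta> i})"
proof (intro set_eqI iffI)
  fix x assume "x \<in> (\<Union>i\<in>bands. {\<alpha> i..\<beta> i})"
  then obtain i where i: "i \<in> {1..<K}" "\<alpha> i < \<beta> i" "x \<in> {\<alpha> i..\<beta> i}" by (auto simp: bands_def)
  have "emeasure M (ball x e) > 0" if e: "e > 0" for e
  proof -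
    have "x \<in> closure {\<alpha> i<..<\<beta> i}" using i by simp
    then obtain y where y: "y \<in> {\<alpha> i<..<\<beta> i}" "dist y x < e" using e unfolding closure_approachable by blast
    then have "dens y > 0" using dens_pos_iff i by blast
    moreover have "ball y (e - dist y x) \<subseteq> ball x e" by (auto simp: subset_iff dist_real_def)
    ultimately show ?thesis
      using emeasure_ball_pos[of y "e - dist y x"] y
        emeasure_mono[of "ball y (e - dist y x)" "ball x e" M] by (auto simp: sets_M)
  qed
  then show "x \<in> measure_support M" by (simp add: measure_support_def)
next
  fix x assume x: "x \<in> measure_support M"
  show "x \<in> (\<Union>i\<in>bands. {\<alpha> i..\<beta> i})"
  proof (rule ccontr)
    assume "x \<notin> (\<Union>i\<in>bands. {\<alpha> i..\<beta> i})"
    moreover have "closed (\<Union>i\<in>bands. {\<alpha> i..\<beta> i})" using finite_bands by (intro closed_UN) auto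
    ultimately obtain e where e: "e > 0" "ball x e \<subseteq> - (\<Union>i\<in>bands. {\<alpha> i..\<beta> i})"
      unfolding closed_def open_contains_ball by blast
    have "AE y in M. y \<notin> ball x e"
      using AE_dens_pos
    proof eventually_elim
      case (elim y)
      then obtain i where "i \<in> {1..<K}" "y \<in> {\<alpha> i<..<\<beta> i}" unfolding dens_pos_iff by blast
      then have "y \<in> (\<Union>i\<in>bands. {\<alpha> i..\<beta> i})" by (auto simp: bands_def intro!: bexI[of _ i])
      then show ?case using e by blast
    qed
    then have "emeasure M (ball x e) = 0" by (subst (asm) AE_iff_null_sets[symmetric]) (auto simp: sets_M)
    then show False using x e by (auto simp: measure_support_def)
  qed
qed

lemma bands_nonempty: "bands \<noteq> {}"
proof
  assume "bands = {}"
  then have le: "dens x \<le> 0" for x using dens_pos_iff[of x] by (force simp: bands_def not_le[symmetric])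
  have "AE x in M. False" using AE_dens_pos by eventually_elim (use le in \<open>simp add: not_less[symmetric]\<close>)
  then show False using AE_False by simp
qed

end

section \<open>Renumbering the bands and collecting the formulas\<close>

theorem theorem2p1:
  fixes K :: nat and A :: real and p z :: "nat \<Rightarrow> real" and w :: "real \<Rightarrow> real"
  assumes K: "K \<ge> 2"
    and A: "A > 0"
    and ppos: "\<And>i. i \<in> {1..K} \<Longrightarrow> p i > 0"
    and zinc: "\<And>i. i \<in> {1..<K} \<Longrightarrow> z i < z (Suc i)"
    and w_def: "\<And>x. w x = A * (\<Prod>i=1..K. \<bar>x - z i\<bar> powr p i)"
  shows "\<exists>(L::nat) (P::real poly) (as::nat \<Rightarrow> real) (bs::nat \<Rightarrow> real).
     1 \<le> L \<and> L \<le> K - 1 \<and>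
     lead_coeff P = 1 \<and> degree P = K - L - 1 \<and>
     z 1 < as 1 \<and> bs L < z K \<and>
     (\<forall>l\<in>{1..L}. as l < bs l) \<and>
     (\<forall>l\<in>{1..<L}. bs l < as (Suc l)) \<and>
     (\<forall>l\<in>{1..L}. \<forall>j\<in>{1..K}. z j \<notin> {as l..bs l}) \<and>
     (let R = (\<lambda>x. \<Prod>l=1..L. (x - as l) * (x - bs l));
          ptot = (\<Sum>j=1..K. p j);
          Q = (\<lambda>x. sqrt \<bar>R x\<bar> * poly P x / (\<Prod>j=1..K. (x - z j)))
      in
       (\<forall>M. is_equilibrium_measure w (z 1) (z K) M \<longrightarrow>
          measure_support M = (\<Union>l\<in>{1..L}. {as l..bs l}) \<and>
          (\<forall>l\<in>{1..L}.
             (\<forall>x\<in>{as l..bs l}. (-1) ^ (L + l + 1) * (1 + ptot) * Q x / pi \<ge> 0) \<and>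
             (\<forall>B\<in>sets borel. B \<subseteq> {as l..bs l} \<longrightarrow>
                emeasure M B =
                  (\<integral>\<^sup>+ x\<in>B. ennreal ((-1) ^ (L + l + 1) * (1 + ptot) * Q x / pi) \<partial>lborel)))) \<and>
       (\<forall>j\<in>{1..K}. \<forall>l\<in>{0..L}.
          (l = 0 \<or> bs l \<le> z j) \<and> (l = L \<or> z j \<le> as (Suc l)) \<longrightarrow>
          poly P (z j) =
            (-1) ^ (L + l) * p j * (\<Prod>m\<in>{1..K} - {j}. z j - z m)
            / ((1 + ptot) * sqrt \<bar>R (z j)\<bar>)) \<and>
       (\<forall>l\<in>{1..<L}.
          pv_integral_has_value Q (bs l) (as (Suc l)) {z j |j. j \<in> {1..K}} 0))"
proof -
  interpret point_charges K p z by unfold_locales (fact K, fact ppos, fact zinc)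
  have w: "w = weight A" by (simp add: fun_eq_iff w_def weight_def)
  obtain M where "M \<in> unit" "\<forall>N\<in>unit. energy M \<le> energy N" using exists_minimizer by blast
  then interpret minimizer K p z M by unfold_locales auto
  obtain \<alpha> \<beta> where "minimizer_roots K p z M \<alpha> \<beta>" using minimizer_roots_exists by blast
  then interpret minimizer_roots K p z M \<alpha> \<beta> .
  \<comment> \<open>The witnesses are built from one minimizer, while the claim concerns every
    equilibrium measure; uniqueness closes this gap.\<close>
  have equilibrium: "N = M" if "is_equilibrium_measure w (z 1) (z K) N" for N
  proof (rule minimizer_unique)
    show "minimizer K p z N"
      using that unfolding w is_equilibrium_measure_iff[OF A] by unfold_locales auto
  qed
  define L where "L = card bands"
  obtain h where h: "bij_betw h {..<L} bands" "strict_mono_on {..<L} h"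
    unfolding L_def using ex_bij_betw_strict_mono_card[OF finite_bands] by blast
  \<comment> \<open>The increasing enumeration \<open>h\<close> starts at 0, the intervals of the
    theorem at 1. By truncated subtraction \<open>e 0\<close> equals \<open>e 1\<close>, so
    \<open>l = 0\<close> is always treated separately.\<close>
  define e where "e l = h (l - 1)" for l
  have bij: "bij_betw e {1..L} bands"
  proof -
    have "bij_betw (\<lambda>l. l - 1) {1..L} {..<L}"
      by (rule bij_betw_byWitness[where f' = Suc]) auto
    from bij_betw_trans[OF this h(1)] show ?thesis by (simp add: e_def[abs_def] o_def)
  qed
  have e_mono: "e l < e l'" if "l \<in> {1..L}" "l' \<in> {1..L}" "l < l'" for l l'
    unfolding e_def using that by (intro strict_mono_onD[OF h(2)]) auto
  have e_less: "e l < e l' \<longleftrightarrow> l < l'" if "l \<in> {1..L}" "l' \<in> {1..L}" for l l'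
    using e_mono[OF that] e_mono[OF that(2,1)] by (cases l l' rule: linorder_cases) auto
  have e_in: "e l \<in> bands" if "l \<in> {1..L}" for l using bij that by (auto simp: bij_betw_def)
  have e_surj: "\<exists>l\<in>{1..L}. i = e l" if "i \<in> bands" for i using bij that by (auto simp: bij_betw_def)
  have e_K: "e l \<in> {1..<K}" "\<alpha> (e l) < \<beta> (e l)" if "l \<in> {1..L}" for l
    using e_in[OF that] by (auto simp: bands_def)
  have e_card: "card {i\<in>bands. e l < i} = L - l" if "l \<in> {1..L}" for l
  proof -
    have "{i\<in>bands. e l < i} = e ` {l<..L}"
    proof (intro set_eqI iffI)
      fix i assume i: "i \<in> {i\<in>bands. e l < i}"
      then obtain l' where "l' \<in> {1..L}" "i = e l'" using e_surj by blast
      then show "i \<in> e ` {l<..L}" using i e_less[OF that] by auto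
    next
      fix i assume "i \<in> e ` {l<..L}"
      then obtain l' where "l' \<in> {l<..L}" "i = e l'" by blast
      then show "i \<in> {i\<in>bands. e l < i}" using e_in[of l'] e_less[OF that, of l'] that by auto
    qed
    moreover have "inj_on e {l<..L}"
      by (rule inj_on_subset[of e "{1..L}"]) (use bij that in \<open>auto simp: bij_betw_def\<close>)
    ultimately show ?thesis by (simp add: card_image)
  qed
  have L1: "1 \<le> L" using bands_nonempty finite_bands by (simp add: L_def Suc_le_eq card_gt_0_iff)
  have LK: "L \<le> K - 1" using card_mono[OF _ bands_subset] by (simp add: L_def)
  define as bs where "as l = \<alpha> (e l)" "bs l = \<beta> (e l)" for l
  have R: "(\<Prod>l=1..L. (x - as l) * (x - bs l)) = R_fun x" for x
    unfolding R_fun_def as_bs_def by (rule prod.reindex_bij_betw[OF bij])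
  have Q: "sqrt \<bar>R_fun x\<bar> * poly P_poly x / (\<Prod>j=1..K. (x - z j)) = Q_fun x" for x
    by (simp add: Q_fun_def poly_Pi_poly)
  have bands_eq: "(\<Union>l\<in>{1..L}. {as l..bs l}) = (\<Union>i\<in>bands. {\<alpha> i..\<beta> i})"
  proof -
    have "bands = e ` {1..L}" using bij by (simp add: bij_betw_def)
    then show ?thesis by (simp add: as_bs_def)
  qed
  have gap_z: "z j < \<alpha> i" if "j \<in> {1..K}" "i \<in> {1..<K}" "j \<le> i" for i j
    using roots[OF that(2)] z_mono[of j i] that by auto
  have gap_z': "\<beta> i < z j" if "j \<in> {1..K}" "i \<in> {1..<K}" "i < j" for i j
    using roots[OF that(2)] z_mono[of "Suc i" j] that by auto
  have dens: "(-1) ^ (L + l + 1) * (1 + ptot) * Q_fun x / pi = dens x"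
    if "l \<in> {1..L}" "x \<in> {as l..bs l}" for l x
  proof -
    \<comment> \<open>The exponent of the theorem and that of \<open>dens_Q\<close> differ by the
      even number \<open>2 * l\<close>.\<close>
    have "even (L + l + 1) \<longleftrightarrow> even (Suc (L - l))" using that by auto
    then have "(-1) ^ (L + l + 1) = ((-1) ^ Suc (L - l) :: real)" by (simp only: minus_one_power_iff)
    then show ?thesis
      using dens_Q[OF e_in[OF that(1)], of x] that unfolding e_card[OF that(1)] as_bs_def by simp
  qed
  have support: "measure_support M = (\<Union>l\<in>{1..L}. {as l..bs l})"
    unfolding bands_eq by (rule measure_support_M)
  have density: "emeasure M B = (\<integral>\<^sup>+ x\<in>B. ennreal ((-1) ^ (L + l + 1) * (1 + ptot) * Q_fun x / pi) \<partial>lborel)"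
    if "l \<in> {1..L}" "B \<in> sets borel" "B \<subseteq> {as l..bs l}" for l B
  proof -
    have "emeasure M B = (\<integral>\<^sup>+x. ennreal (dens x) * indicator B x \<partial>lborel)"
      by (subst M_eq_density) (use that in \<open>auto simp: emeasure_density\<close>)
    also have "\<dots> = (\<integral>\<^sup>+ x\<in>B. ennreal ((-1) ^ (L + l + 1) * (1 + ptot) * Q_fun x / pi) \<partial>lborel)"
    proof (rule nn_integral_cong)
      fix x
      show "ennreal (dens x) * indicator B x = ennreal ((-1) ^ (L + l + 1) * (1 + ptot) * Q_fun x / pi) * indicator B x"
        using dens[OF that(1), of x] that(3) by (cases "x \<in> B") auto
    qed
    finally show ?thesis .
  qed
  have Pz: "poly P_poly (z j) = (-1) ^ (L + l) * p j * (\<Prod>m\<in>{1..K} - {j}. z j - z m) / ((1 + ptot) * sqrt \<bar>R_fun (z j)\<bar>)"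
    if j: "j \<in> {1..K}" and l: "l \<in> {0..L}" and lower: "l = 0 \<or> bs l \<le> z j" and upper: "l = L \<or> z j \<le> as (Suc l)" for j l
  proof -
    \<comment> \<open>A charge between the intervals \<open>l\<close> and \<open>l + 1\<close> has
      exactly the bands beyond \<open>l\<close> to its right, which turns the count of
      \<open>poly_P_poly_z\<close> into \<open>L - l\<close>.\<close>
    have "{i\<in>bands. j \<le> i} = (if l = 0 then bands else {i\<in>bands. e l < i})"
    proof -
      have "e l < j" if "l \<noteq> 0"
      proof (rule ccontr)
        assume "\<not> e l < j"
        then show False using gap_z[OF j e_K(1), of l] e_K(2)[of l] lower l that by (auto simp: as_bs_def)
      qed
      moreover have "j \<le> i" if i: "i \<in> bands" "l = 0 \<or> e l < i" for i
      proof -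
        obtain l' where l': "l' \<in> {1..L}" "i = e l'" using e_surj i by blast
        have "l < l'" using i l' e_less[of l l'] l by (cases "l = 0") auto
        then have "e (Suc l) \<le> i" using e_mono[of "Suc l" l'] l' by (cases "Suc l = l'") auto
        moreover have "j \<le> e (Suc l)"
        proof (rule ccontr)
          assume "\<not> j \<le> e (Suc l)"
          moreover have "Suc l \<in> {1..L}" using \<open>l < l'\<close> l' by auto
          ultimately show False
            using gap_z'[OF j e_K(1), of "Suc l"] e_K(2)[of "Suc l"] upper \<open>l < l'\<close> l' by (auto simp: as_bs_def)
        qed
        ultimately show ?thesis by simp
      qed
      ultimately show ?thesis by auto
    qed
    then have "card {i\<in>bands. j \<le> i} = L - l" using e_card[of l] l by (auto simp: L_def)
    moreover have "(-1) ^ (L - l) = ((-1) ^ (L + l) :: real)" using l by (simp add: minus_one_power_iff)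
    ultimately show ?thesis using poly_P_poly_z[OF j] by simp
  qed
  have pv: "pv_integral_has_value Q_fun (bs l) (as (Suc l)) {z j |j. j \<in> {1..K}} 0" if l: "l \<in> {1..<L}" for l
  proof -
    have l': "l \<in> {1..L}" "Suc l \<in> {1..L}" using l by auto
    have "pv_has_integral Q_fun (bs l) (as (Suc l)) Z 0"
      unfolding as_bs_def
    proof (rule pv_gap[OF e_in[OF l'(1)] e_in[OF l'(2)] e_mono[OF l']])
      fix m assume m: "e l < m" "m < e (Suc l)"
      show "m \<notin> bands"
      proof
        assume "m \<in> bands"
        then obtain k where "k \<in> {1..L}" "m = e k" using e_surj by blast
        then show False using m e_less[of l k] e_less[of k "Suc l"] l' by auto
      qed
    qed simp
    moreover have "{z j |j. j \<in> {1..K}} = Z" by auto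
    ultimately show ?thesis using pv_has_integral_imp by simp
  qed
  show ?thesis
    unfolding Let_def
  proof (rule exI[of _ L], rule exI[of _ P_poly], rule exI[of _ as], rule exI[of _ bs],
      intro conjI ballI allI impI)
    show "1 \<le> L" "L \<le> K - 1" by fact+
    show "lead_coeff P_poly = 1" "degree P_poly = K - L - 1"
      unfolding L_def by (rule lead_coeff_P_poly degree_P_poly)+
    show "z 1 < as 1" using gap_z[of 1 "e 1"] e_K[of 1] L1 K by (auto simp: as_bs_def)
    show "bs L < z K" using gap_z'[of K "e L"] e_K[of L] L1 K by (auto simp: as_bs_def)
    show "as l < bs l" if "l \<in> {1..L}" for l using e_K[OF that] by (simp add: as_bs_def)
    show "bs l < as (Suc l)" if "l \<in> {1..<L}" for l
      unfolding as_bs_def using that by (intro roots_sep e_K e_mono) auto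
    show "z j \<notin> {as l..bs l}" if "l \<in> {1..L}" "j \<in> {1..K}" for l j
      using gap_z[OF that(2) e_K(1)[OF that(1)]] gap_z'[OF that(2) e_K(1)[OF that(1)]]
      by (cases "j \<le> e l") (auto simp: as_bs_def)
    show "measure_support N = (\<Union>l\<in>{1..L}. {as l..bs l})" if "is_equilibrium_measure w (z 1) (z K) N" for N
      using support equilibrium[OF that] by simp
    show "0 \<le> (-1) ^ (L + l + 1) * (1 + (\<Sum>j=1..K. p j)) * (sqrt \<bar>\<Prod>l=1..L. (x - as l) * (x - bs l)\<bar> * poly P_poly x / (\<Prod>j=1..K. (x - z j))) / pi"
      if "l \<in> {1..L}" "x \<in> {as l..bs l}" for l x
      unfolding R Q ptot_def[symmetric] dens[OF that] by (rule dens_nonneg)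
    show "emeasure N B = (\<integral>\<^sup>+ x\<in>B. ennreal ((-1) ^ (L + l + 1) * (1 + (\<Sum>j=1..K. p j)) *
        (sqrt \<bar>\<Prod>l=1..L. (x - as l) * (x - bs l)\<bar> * poly P_poly x / (\<Prod>j=1..K. (x - z j))) / pi) \<partial>lborel)"
      if "is_equilibrium_measure w (z 1) (z K) N" "l \<in> {1..L}" "B \<in> sets borel" "B \<subseteq> {as l..bs l}" for N l B
      unfolding R Q ptot_def[symmetric] equilibrium[OF that(1)] by (rule density) fact+
    show "poly P_poly (z j) = (-1) ^ (L + l) * p j * (\<Prod>m\<in>{1..K} - {j}. z j - z m) /
        ((1 + (\<Sum>j=1..K. p j)) * sqrt \<bar>\<Prod>l=1..L. (z j - as l) * (z j - bs l)\<bar>)"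
      if "j \<in> {1..K}" "l \<in> {0..L}" "(l = 0 \<or> bs l \<le> z j) \<and> (l = L \<or> z j \<le> as (Suc l))" for j l
      unfolding R ptot_def[symmetric] using that by (intro Pz) auto
    show "pv_integral_has_value (\<lambda>x. sqrt \<bar>\<Prod>l=1..L. (x - as l) * (x - bs l)\<bar> * poly P_poly x / (\<Prod>j=1..K. (x - z j)))
        (bs l) (as (Suc l)) {z j |j. j \<in> {1..K}} 0" if "l \<in> {1..<L}" for l
      unfolding R Q by (rule pv[OF that])
  qed
qed

end
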